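(* Let $k$ be a positive integer and $\ell\ge2$ an integer. For every integer $j$ with $1\le j\le\ell$ and $\gcd(j,\ell)=1$, $$N_k(x;\ell,j):=\#\{n\le x:\ P_k(n)\equiv j\ (\mathrm{mod}\ \ell)\}=\frac{x}{\varphi(\ell)}+O\!\left(\frac{x(\log\log x)^k}{\log x}\right)$$ as $x\to\infty$. In particular the sequence $\{P_k(n)\}$ is uniformly distributed in the reduced residue classes modulo $\ell$.
   Context: For a positive integer $n$ with distinct prime factors $q_1>q_2>\cdots>q_r$ (so $r=\omega(n)$ is the number of distinct prime factors), $P_k(n):=q_k$ if $r\ge k$, and $P_k(n):=1$ if $r<k$. $\varphi$ is Euler's totient function. Implied constants may depend on $k$ and $\ell$. *)

theory Defs
  imports "HOL-Number_Theory.Number_Theory" "HOL-Library.Landau_Symbols"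
begin

(* The primes dividing n are listed without multiplicity, so P_k(n) is the k-th largest
   distinct prime factor.  Only k >= 1 is meaningful. *)
definition distinct_prime_factors_desc :: "nat \<Rightarrow> nat list" where
  "distinct_prime_factors_desc n = rev (sorted_list_of_set (prime_factors n))"

definition kth_prime_factor :: "nat \<Rightarrow> nat \<Rightarrow> nat" where
  "kth_prime_factor k n =
     (if k \<le> length (distinct_prime_factors_desc n)
      then distinct_prime_factors_desc n ! (k - 1) else 1)"

definition residue_count :: "(nat \<Rightarrow> nat) \<Rightarrow> nat \<Rightarrow> nat \<Rightarrow> real \<Rightarrow> nat" where
  "residue_count a l j x = card {n. 1 \<le> n \<and> real n \<le> x \<and> [a n = j] (mod l)}"

(* Each reduced class modulo l is hit by a(1), a(2), ... with natural density 1 / totient l.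
   As there are totient l such classes, the terms not coprime to l then have density 0. *)
definition unif_dist_reduced_residues :: "(nat \<Rightarrow> nat) \<Rightarrow> nat \<Rightarrow> bool" where
  "unif_dist_reduced_residues a l \<longleftrightarrow>
     (\<forall>j. coprime j l \<longrightarrow>
        (\<lambda>N. real (residue_count a l j (real N)) / real N) \<longlonglongrightarrow> 1 / real (totient l))"

end

theory Submission
  imports Defs "HOL-Analysis.Analysis" "HOL-Number_Theory.Prime_Powers"
    "HOL-Computational_Algebra.Squarefree" "HOL-Real_Asymp.Real_Asymp"
begin

text \<open>
  Write \<open>n = b * p * m\<close> with \<open>p = P\<^sub>k(n)\<close>, where \<open>b\<close> collects the \<open>k - 1\<close> larger primes and \<open>m\<close> is
  \<open>p\<close>-smooth.  With \<open>c(p) = [p \<equiv> j] - 1/\<phi>(l)\<close>, the error term is a sum over \<open>b\<close> of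
  \<open>\<Sum>p. c(p) \<Psi>(X/p, p)\<close> with \<open>X = x/b\<close>.  No prime number theorem is needed: the elementary estimate
  \<open>\<Psi>(t, z) = t \<rho>(ln t / ln z) + O(t / ln z)\<close> shows that \<open>p \<Psi>(X/p, p) / X\<close> is, up to \<open>O(1 / ln p)\<close>, an
  increasing function of \<open>p\<close> with values in \<open>[0, 1]\<close>, so partial summation against Mertens' theorem for
  progressions, \<open>\<Sum>p\<le>N. c(p) ln p / p = O(1)\<close>, bounds the inner sum by \<open>O(X ln ln X / ln X)\<close>;
  the primes \<open>p \<le> exp (ln X / ln ln X)\<close> contribute that little trivially.  Summing over \<open>b\<close> costs a factor
  \<open>ln ln x\<close> for each of its \<open>k - 1\<close> prime powers.
\<close>

section \<open>Partial summation and Mertens' theorem\<close>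

text \<open>A relative error O(1/ln z) in the estimate for \<Psi> is just affordable: over p > y it
  costs the sum of 1/(p ln p), which is O(1/ln y), and Abel summation against Mertens' theorem costs
  O(1/ln y) as well. So y should be large; but the n <= X without primes above y are bounded only by
  X \<rho>(ln X / ln y) + O(X / ln y). The decay \<rho>(u) <= e^(3-u) makes this small enough once u
  = ln X / ln y is about ln ln X, which fixes the threshold and is the origin of the factor ln ln X.
  Monotonicity comes from ln(X/p)/ln p = ln X / ln p - 1, decreasing in p, with \<rho> decreasing.
  The inner sum runs only over p below the least prime factor of b. This merely truncates the range,
  so a bound uniform in the upper limit suffices. In the sum over b the logarithm must stay as
  ln(x/b), which is small for b near x; hence the sums of 1/(b ln(x/b)) are bounded as a whole.
  Mertens' theorem for progressions rests on L(1, \<chi>) \<noteq> 0, proved by elementary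
  sums.\<close>

lemma abel_antimono:
  fixes u :: "nat \<Rightarrow> 'a::real_normed_vector"
  assumes "m \<le> n" and B: "\<And>k. m \<le> k \<Longrightarrow> k \<le> n \<Longrightarrow> norm (\<Sum>i=m..k. u i) \<le> B"
    and f: "\<And>i. m \<le> i \<Longrightarrow> i < n \<Longrightarrow> f (Suc i) \<le> f i" and "0 \<le> f n"
  shows "norm (\<Sum>i=m..n. f i *\<^sub>R u i) \<le> B * f m"
proof -
  \<comment> \<open>Without the boundary term f k U(k), where U denotes the partial sums, there
    remains the sum of (f i - f (i+1)) U(i), whose weights are nonnegative and telescope.\<close>
  have main: "norm ((\<Sum>i=m..k. f i *\<^sub>R u i) - f k *\<^sub>R (\<Sum>i=m..k. u i)) \<le> B * (f m - f k)"
    if "m \<le> k" "k \<le> n" for k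
    using that
  proof (induction k rule: dec_induct)
    case base
    then show ?case by simp
  next
    case (step k)
    have "(\<Sum>i=m..Suc k. f i *\<^sub>R u i) - f (Suc k) *\<^sub>R (\<Sum>i=m..Suc k. u i) =
      ((\<Sum>i=m..k. f i *\<^sub>R u i) - f k *\<^sub>R (\<Sum>i=m..k. u i)) + (f k - f (Suc k)) *\<^sub>R (\<Sum>i=m..k. u i)"
      using step by (simp add: algebra_simps)
    also have "norm \<dots> \<le> B * (f m - f k) + (f k - f (Suc k)) * B"
    proof (rule norm_triangle_le[OF add_mono])
      show "norm ((f k - f (Suc k)) *\<^sub>R (\<Sum>i=m..k. u i)) \<le> (f k - f (Suc k)) * B"
        using f[of k] B[of k] step by (simp add: mult_left_mono)
    qed (use step in auto)
    finally show ?case by (simp add: algebra_simps)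
  qed
  have "norm (\<Sum>i=m..n. f i *\<^sub>R u i) \<le>
      norm ((\<Sum>i=m..n. f i *\<^sub>R u i) - f n *\<^sub>R (\<Sum>i=m..n. u i)) + norm (f n *\<^sub>R (\<Sum>i=m..n. u i))"
    by (metis diff_add_cancel norm_triangle_ineq)
  also have "\<dots> \<le> B * (f m - f n) + f n * B"
    using main[of n] B[of n] assms(1) \<open>0 \<le> f n\<close> by (auto intro!: add_mono mult_left_mono)
  finally show ?thesis by (simp add: algebra_simps)
qed

text \<open>Reduces to the decreasing case through the weights \<open>f n - f i\<close>; the
  boundary term, \<open>f n\<close> times the full sum, is what doubles the constant.\<close>

lemma abel_mono:
  fixes u :: "nat \<Rightarrow> 'a::real_normed_vector"
  assumes "m \<le> n" and B: "\<And>k. m \<le> k \<Longrightarrow> k \<le> n \<Longrightarrow> norm (\<Sum>i=m..k. u i) \<le> B"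
    and f: "\<And>i. m \<le> i \<Longrightarrow> i < n \<Longrightarrow> f i \<le> f (Suc i)" and "0 \<le> f m" "f n \<le> F"
  shows "norm (\<Sum>i=m..n. f i *\<^sub>R u i) \<le> 2 * B * F"
proof -
  have B0: "0 \<le> B" using B[of m] assms(1) order_trans[OF norm_ge_zero] by blast
  have mono: "f m \<le> f n"
    using assms(1) f by (induction n rule: dec_induct) (auto, force)
  have "norm (\<Sum>i=m..n. (f n - f i) *\<^sub>R u i) \<le> B * (f n - f m)"
    using assms by (intro abel_antimono[where f = "\<lambda>i. f n - f i"]) auto
  moreover have "norm (f n *\<^sub>R (\<Sum>i=m..n. u i)) \<le> f n * B"
    using B[of n] assms(1,4) mono by (auto intro!: mult_left_mono)
  moreover have "(\<Sum>i=m..n. f i *\<^sub>R u i) = f n *\<^sub>R (\<Sum>i=m..n. u i) - (\<Sum>i=m..n. (f n - f i) *\<^sub>R u i)"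
    by (simp add: algebra_simps sum_subtractf scaleR_sum_right)
  ultimately have "norm (\<Sum>i=m..n. f i *\<^sub>R u i) \<le> f n * B + B * (f n - f m)"
    using norm_triangle_ineq4[of "f n *\<^sub>R (\<Sum>i=m..n. u i)" "\<Sum>i=m..n. (f n - f i) *\<^sub>R u i"] by simp
  also have "\<dots> = 2 * B * f n - B * f m" by (simp add: algebra_simps)
  also have "\<dots> \<le> 2 * B * f n" using B0 assms(4) by simp
  also have "\<dots> \<le> 2 * B * F" using B0 assms(5) by (intro mult_left_mono) auto
  finally show ?thesis .
qed

text \<open>Pairs (n, d) with d dividing n correspond to pairs (d, m) with d m <= N through n = d
  m.\<close>

lemma sum_divisors_swap:
  fixes F :: "nat \<Rightarrow> nat \<Rightarrow> 'a::comm_monoid_add"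
  shows "(\<Sum>n=1..N. \<Sum>d | d dvd n. F d (n div d)) = (\<Sum>d=1..N. \<Sum>m=1..N div d. F d m)"
proof -
  have "(\<Sum>n=1..N. \<Sum>d | d dvd n. F d (n div d)) = (\<Sum>(n,d)\<in>Sigma {1..N} (\<lambda>n. {d. d dvd n}). F d (n div d))"
    by (rule sum.Sigma) auto
  also have "\<dots> = (\<Sum>(d,m)\<in>Sigma {1..N} (\<lambda>d. {1..N div d}). F d m)"
    by (rule sum.reindex_bij_witness[where j = "\<lambda>(n,d). (d, n div d)" and i = "\<lambda>(d,m). (d * m, d)"])
       (auto simp: div_le_mono less_eq_div_iff_mult_less_eq Suc_le_eq mult.commute dvd_div_eq_0_iff
             intro: le_trans[OF dvd_imp_le] intro!: Nat.gr0I)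
  also have "\<dots> = (\<Sum>d=1..N. \<Sum>m=1..N div d. F d m)"
    by (rule sum.Sigma[symmetric]) auto
  finally show ?thesis .
qed

section \<open>Chebyshev's bound and Mertens' first theorem\<close>

abbreviation mangoldt_real :: "nat \<Rightarrow> real" ("\<Lambda>") where "\<Lambda> \<equiv> mangoldt"

text \<open>Legendre's formula for ln N!: expand each ln n as the divisor sum of \<Lambda> and count
  the multiples of d up to N.\<close>

lemma sum_mangoldt_floor: "(\<Sum>d=1..N. \<Lambda> d * real (N div d)) = (\<Sum>n=1..N. ln (real n))"
proof -
  have "(\<Sum>n=1..N. ln (real n)) = (\<Sum>n=1..N. \<Sum>d | d dvd n. \<Lambda> d)"
    by (intro sum.cong refl) (use mangoldt_sum[where 'a = real] in auto)
  also have "\<dots> = (\<Sum>d=1..N. \<Lambda> d * real (N div d))"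
    using sum_divisors_swap[of "\<lambda>d m. \<Lambda> d" N] by (simp add: mult.commute)
  finally show ?thesis by simp
qed

lemma ln_diff_bounds:
  assumes "n \<ge> 1"
  shows "1 / (real n + 1) \<le> ln (real n + 1) - ln (real n)" "ln (real n + 1) - ln (real n) \<le> 1 / real n"
proof -
  have "ln (real n + 1) - ln (real n) = ln (1 + 1 / real n)"
    using assms by (simp add: ln_divide_pos[symmetric] add_divide_distrib del: ln_divide_pos)
  also have "\<dots> \<le> 1 / real n" by (rule ln_add_one_self_le_self) auto
  finally show "ln (real n + 1) - ln (real n) \<le> 1 / real n" .
  have "ln (real n / (real n + 1)) \<le> real n / (real n + 1) - 1"
    using assms by (intro ln_le_minus_one) auto
  then show "1 / (real n + 1) \<le> ln (real n + 1) - ln (real n)"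
    using assms by (simp add: ln_div field_simps)
qed

text \<open>Weak form of Stirling's formula. The induction step is \<open>ln_diff_bounds\<close>
  multiplied by n and by n + 1.\<close>

lemma sum_ln_bounds:
  assumes "N \<ge> 1"
  shows "real N * ln (real N) - real N + 1 \<le> (\<Sum>n=1..N. ln (real n))"
    "(\<Sum>n=1..N. ln (real n)) \<le> real N * ln (real N) - real N + 1 + ln (real N)"
proof -
  have "real N * ln (real N) - real N + 1 \<le> (\<Sum>n=1..N. ln (real n)) \<and>
    (\<Sum>n=1..N. ln (real n)) \<le> real N * ln (real N) - real N + 1 + ln (real N)"
    using assms
  proof (induction N rule: dec_induct)
    case (step n)
    have "real n * (ln (real n + 1) - ln (real n)) \<le> real n * (1 / real n)"
      "(real n + 1) * (1 / (real n + 1)) \<le> (real n + 1) * (ln (real n + 1) - ln (real n))"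
      using ln_diff_bounds[of n] step by (intro mult_left_mono; simp)+
    then show ?case using step by (simp add: algebra_simps)
  qed auto
  then show "real N * ln (real N) - real N + 1 \<le> (\<Sum>n=1..N. ln (real n))"
    "(\<Sum>n=1..N. ln (real n)) \<le> real N * ln (real N) - real N + 1 + ln (real N)" by auto
qed

definition psi :: "nat \<Rightarrow> real" where "psi N = (\<Sum>d=1..N. \<Lambda> d)"

text \<open>Chebyshev's argument with the logarithm of the central binomial coefficient, written as
  the sum of \<Lambda>(d) (floor(2M/d) - 2 floor(M/d)): every coefficient is nonnegative, and it is
  at least 1 for M < d <= 2M. Stirling bounds the whole sum.\<close>

lemma psi_double: 
  assumes "M \<ge> 1" shows "psi (2 * M) \<le> psi M + 4 * real M"
proof -
  have "psi (2 * M) - psi M = (\<Sum>d=Suc M..2*M. \<Lambda> d)"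
    unfolding psi_def using sum.ub_add_nat[of 1 M \<Lambda> M] by (simp add: mult_2)
  also have "\<dots> \<le> (\<Sum>d=1..2*M. \<Lambda> d * (real (2*M div d) - 2 * real (M div d)))"
  proof -
    have ge: "2 * (M div d) \<le> 2 * M div d" for d
    proof (cases "d = 0")
      case False
      have "2 * (M div d) * d \<le> 2 * M" by simp
      then show ?thesis using False by (simp add: less_eq_div_iff_mult_less_eq)
    qed auto
    have "(\<Sum>d=Suc M..2*M. \<Lambda> d) \<le> (\<Sum>d=Suc M..2*M. \<Lambda> d * (real (2*M div d) - 2 * real (M div d)))"
    proof (rule sum_mono)
      fix d assume "d \<in> {Suc M..2*M}"
      then have "M div d = 0" "2 * M div d \<ge> 1" by (auto simp: less_eq_div_iff_mult_less_eq)
      then have "\<Lambda> d * 1 \<le> \<Lambda> d * (real (2*M div d) - 2 * real (M div d))"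
        by (intro mult_left_mono mangoldt_nonneg) auto
      then show "\<Lambda> d \<le> \<Lambda> d * (real (2*M div d) - 2 * real (M div d))" by simp
    qed
    also have "\<dots> \<le> (\<Sum>d=1..2*M. \<Lambda> d * (real (2*M div d) - 2 * real (M div d)))"
    proof (rule sum_mono2)
      fix d
      have "real (2 * (M div d)) \<le> real (2 * M div d)" using ge[of d] by (rule of_nat_mono)
      then show "0 \<le> \<Lambda> d * (real (2*M div d) - 2 * real (M div d))"
        by (intro mult_nonneg_nonneg mangoldt_nonneg) auto
    qed auto
    finally show ?thesis .
  qed
  also have "\<dots> = (\<Sum>d=1..2*M. \<Lambda> d * real (2*M div d)) - 2 * (\<Sum>d=1..2*M. \<Lambda> d * real (M div d))"
    by (simp add: algebra_simps sum_subtractf sum_distrib_left)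
  also have "(\<Sum>d=1..2*M. \<Lambda> d * real (M div d)) = (\<Sum>d=1..M. \<Lambda> d * real (M div d))"
    by (rule sum.mono_neutral_right) auto
  also have "(\<Sum>d=1..2*M. \<Lambda> d * real (2*M div d)) - 2 * (\<Sum>d=1..M. \<Lambda> d * real (M div d))
      \<le> (real (2*M) * ln (real (2*M)) - real (2*M) + 1 + ln (real (2*M))) - 2 * (real M * ln (real M) - real M + 1)"
    unfolding sum_mangoldt_floor using assms by (intro diff_mono mult_left_mono sum_ln_bounds) auto
  also have "\<dots> = 2 * real M * ln 2 + ln (real (2*M)) - 1"
    using assms by (simp add: ln_mult algebra_simps)
  also have "\<dots> \<le> 2 * real M * 1 + (real (2 * M) - 1) - 1"
  proof -
    have "ln (real (2*M)) \<le> real (2*M) - 1" using assms by (intro ln_le_minus_one) auto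
    moreover have "2 * real M * ln 2 \<le> 2 * real M * 1" using ln_le_minus_one[of 2] by (intro mult_left_mono) auto
    ultimately show ?thesis by linarith
  qed
  finally show ?thesis by simp
qed

text \<open>Halving: psi(M) <= 8M and \<open>psi_double\<close> give psi(2M) <= 12M, which leaves
  room for the extra term \<Lambda>(N) <= N - 1 of an odd N = 2M + 1.\<close>

lemma chebyshev_psi: "psi N \<le> 8 * real N"
proof (induction N rule: less_induct)
  case (less N)
  show ?case
  proof (cases "N \<le> 1")
    case True
    then show ?thesis by (cases N) (auto simp: psi_def)
  next
    case False
    define M where "M = N div 2"
    have M: "M \<ge> 1" "M < N" using False by (auto simp: M_def)
    then have 1: "psi (2 * M) \<le> 12 * real M" using psi_double[of M] less[of M] by simp
    show ?thesis
    proof (cases "even N")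
      case True
      then show ?thesis using 1 by (auto simp: M_def)
    next
      case False
      then have N: "N = Suc (2 * M)" by (auto simp: M_def elim!: oddE)
      have "\<Lambda> N \<le> ln (real N)" by (intro mangoldt_le) (use M in auto)
      also have "\<dots> \<le> real N - 1" using N by (intro ln_le_minus_one) auto
      finally have "psi N \<le> psi (2 * M) + (real N - 1)" by (simp add: N psi_def)
      then show ?thesis using 1 N by simp
    qed
  qed
qed

text \<open>Replacing floor(N/d) by N/d in Legendre's formula changes the sum by at most psi(N) =
  O(N); then divide by N.\<close>

lemma mertens_mangoldt:
  assumes "N \<ge> 1" shows "\<bar>(\<Sum>d=1..N. \<Lambda> d / real d) - ln (real N)\<bar> \<le> 8"
proof -
  let ?A = "\<Sum>d=1..N. \<Lambda> d / real d" and ?T = "\<Sum>n=1..N. ln (real n)"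
  have N: "real N > 0" using assms by simp
  have fl: "real N / real d - 1 \<le> real (N div d)" "real (N div d) \<le> real N / real d" if "d \<ge> 1" for d
    using floor_divide_of_nat_eq[of N d, where 'a = real] floor_correct[of "real N / real d"]
    by linarith+
  have "?T = (\<Sum>d=1..N. \<Lambda> d * real (N div d))" by (rule sum_mangoldt_floor[symmetric])
  also have "\<dots> \<le> (\<Sum>d=1..N. \<Lambda> d * (real N / real d))"
    using fl by (intro sum_mono mult_left_mono mangoldt_nonneg) auto
  also have "\<dots> = real N * ?A" by (simp add: sum_distrib_left mult.commute)
  finally have 1: "?T \<le> real N * ?A" .
  have "real N * ?A - psi N = (\<Sum>d=1..N. \<Lambda> d * (real N / real d - 1))"
    by (simp add: sum_distrib_left psi_def sum_subtractf algebra_simps)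
  also have "\<dots> \<le> (\<Sum>d=1..N. \<Lambda> d * real (N div d))"
    using fl by (intro sum_mono mult_left_mono mangoldt_nonneg) auto
  also have "\<dots> = ?T" by (rule sum_mangoldt_floor)
  finally have 2: "real N * ?A \<le> ?T + psi N" by simp
  have "real N * ?A \<le> real N * ln (real N) - real N + 1 + ln (real N) + 8 * real N"
    using 2 sum_ln_bounds(2)[OF assms] chebyshev_psi[of N] by linarith
  also have "\<dots> \<le> real N * (ln (real N) + 8)"
    using ln_le_minus_one[OF N] by (simp add: algebra_simps)
  finally have "?A \<le> ln (real N) + 8" using N by (simp only: mult_le_cancel_left_pos)
  moreover have "real N * (ln (real N) - 1) \<le> real N * ?A"
    using 1 sum_ln_bounds(1)[OF assms] by (simp add: algebra_simps)
  then have "ln (real N) - 1 \<le> ?A" using N by (simp only: mult_le_cancel_left_pos)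
  ultimately show ?thesis by linarith
qed

text \<open>The right-hand side is a telescoping majorant: the summand at n is at most the decrease
  of (ln n + 2)/n from n - 1 to n.\<close>

lemma sum_ln_over_square:
  assumes "N \<ge> 1"
  shows "(\<Sum>n=2..N. ln (real n) / (real n * (real n - 1))) \<le> 2 - (ln (real N) + 2) / real N"
  using assms
proof (induction N rule: dec_induct)
  case (step n)
  have n: "real n \<ge> 1" using step by simp
  have "(real n + 1) * (ln (real n + 1) - ln (real n)) \<le> (real n + 1) * (1 / real n)"
    using ln_diff_bounds[of n] step by (intro mult_left_mono) auto
  also have "\<dots> \<le> 2" using n by (simp add: field_simps)
  finally have *: "(real n + 1) * ln (real n + 1) - (real n + 1) * ln (real n) \<le> 2" by (simp add: algebra_simps)
  have "ln (real n + 1) / ((real n + 1) * real n) \<le> (ln (real n) + 2) / real n - (ln (real n + 1) + 2) / (real n + 1)"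
  proof -
    have "(ln (real n) + 2) / real n - (ln (real n + 1) + 2) / (real n + 1) =
      ((real n + 1) * (ln (real n) + 2) - real n * (ln (real n + 1) + 2)) / ((real n + 1) * real n)"
      using n by (simp add: field_simps)
    also have "\<dots> \<ge> ln (real n + 1) / ((real n + 1) * real n)"
      using n * by (intro divide_right_mono) (auto simp: algebra_simps)
    finally show ?thesis .
  qed
  then show ?case using step by (simp add: add.commute)
qed auto

text \<open>Only the powers p^k with k >= 2 contribute; the geometric series over k leaves ln p / (p
  (p - 1)), which is then summed over all integers instead of primes.\<close>

lemma sum_nonprime_mangoldt: "(\<Sum>d | d \<in> {1..N} \<and> \<not> prime d. \<Lambda> d / real d) \<le> 2"
proof (cases "N \<ge> 1")
  case True
  define A where "A = {d. d \<in> {1..N} \<and> \<not> prime d \<and> primepow d}"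
  define P where "P = {p. prime p \<and> p \<le> N}"
  have fP: "finite P" by (simp add: P_def)
  have "(\<Sum>d | d \<in> {1..N} \<and> \<not> prime d. \<Lambda> d / real d) = (\<Sum>d\<in>A. \<Lambda> d / real d)"
    by (rule sum.mono_neutral_right) (auto simp: A_def mangoldt_def)
  also have "\<dots> \<le> (\<Sum>d\<in>(\<lambda>(p,k). p ^ Suc k) ` (P \<times> {1..N}). \<Lambda> d / real d)"
  proof (rule sum_mono2)
    show "A \<subseteq> (\<lambda>(p,k). p ^ Suc k) ` (P \<times> {1..N})"
    proof
      fix d assume d: "d \<in> A"
      then obtain p k where pk: "prime p" "k > 0" "d = p ^ k" by (auto simp: A_def primepow_def)
      then have "k \<noteq> 1" using d by (auto simp: A_def)
      then obtain j where j: "k = Suc j" "j \<ge> 1" using pk by (cases k) auto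
      have "p \<ge> 2" using pk by (simp add: prime_ge_2_nat)
      \<comment> \<open>The chain k < 2^k <= p^k <= N caps the exponent and keeps the index set
        finite.\<close>
      have "k < 2 ^ k" by simp
      also have "\<dots> \<le> p ^ k" using \<open>p \<ge> 2\<close> by (rule power_mono) simp
      also have "\<dots> \<le> N" using d pk by (auto simp: A_def)
      finally have "k \<le> N" by simp
      moreover have "p \<le> N" using d pk self_le_power[of p k] \<open>p \<ge> 2\<close> by (auto simp: A_def)
      ultimately show "d \<in> (\<lambda>(p,k). p ^ Suc k) ` (P \<times> {1..N})"
        using j pk by (auto intro!: image_eqI[where x = "(p,j)"] simp: P_def)
    qed
  qed (use fP in \<open>auto intro: divide_nonneg_nonneg mangoldt_nonneg\<close>)
  also have "\<dots> \<le> (\<Sum>(p,k)\<in>P \<times> {1..N}. \<Lambda> (p ^ Suc k) / real (p ^ Suc k))"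
    using sum_image_le[where f = "\<lambda>(p::nat,k). p ^ Suc k" and I = "P \<times> {1..N}" and g = "\<lambda>d. \<Lambda> d / real d"] fP
    by (simp add: case_prod_unfold mangoldt_nonneg comp_def del: power_Suc)
  also have "\<dots> = (\<Sum>p\<in>P. \<Sum>k=1..N. \<Lambda> (p ^ Suc k) / real (p ^ Suc k))"
    by (rule sum.cartesian_product[symmetric])
  also have "\<dots> \<le> (\<Sum>p\<in>P. ln (real p) / (real p * (real p - 1)))"
  proof (rule sum_mono)
    fix p assume "p \<in> P"
    then have p: "prime p" "real p \<ge> 2" using prime_ge_2_nat by (auto simp: P_def)
    have eq: "(\<Sum>k=1..N. \<Lambda> (p ^ Suc k) / real (p ^ Suc k)) = (ln (real p) / real p) * (\<Sum>k=1..N. (1 / real p) ^ k)"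
      using p by (simp add: sum_distrib_left power_divide del: power_Suc) (simp add: field_simps)
    have "(\<Sum>k=1..N. (1 / real p) ^ k) \<le> 1 / (real p - 1)"
    proof -
      have "(\<Sum>k=1..N. (1 / real p) ^ k) = (1/real p - (1/real p)^Suc N) / (1 - 1 / real p)"
        using sum_gp[of "1/real p" 1 N] p True by auto
      also have "\<dots> \<le> (1 / real p) / (1 - 1 / real p)"
        using p by (intro divide_right_mono) auto
      also have "\<dots> = 1 / (real p - 1)" using p by (simp add: field_simps)
      finally show ?thesis .
    qed
    then have *: "ln (real p) / real p * (\<Sum>k=1..N. (1 / real p) ^ k) \<le> ln (real p) / real p * (1 / (real p - 1))"
      using p by (intro mult_left_mono) auto
    then show "(\<Sum>k=1..N. \<Lambda> (p ^ Suc k) / real (p ^ Suc k)) \<le> ln (real p) / (real p * (real p - 1))"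
      unfolding eq by simp
  qed
  also have "\<dots> \<le> (\<Sum>n=2..N. ln (real n) / (real n * (real n - 1)))"
    by (rule sum_mono2) (auto simp: P_def prime_ge_2_nat)
  also have "\<dots> \<le> 2 - (ln (real N) + 2) / real N" by (rule sum_ln_over_square[OF True])
  also have "\<dots> \<le> 2" using True by simp
  finally show ?thesis .
qed auto

text \<open>Extended by 0 to all naturals, so that partial summation runs over integer intervals
  instead of over the primes.\<close>

definition plog :: "nat \<Rightarrow> real" where "plog n = (if prime n then ln (real n) / real n else 0)"

lemma plog_nonneg: "0 \<le> plog n"
  by (cases "n = 0") (auto simp: plog_def)

lemma sum_mangoldt_plog: 
  "(\<Sum>d=1..N. \<Lambda> d / real d) = (\<Sum>n=1..N. plog n) + (\<Sum>d | d \<in> {1..N} \<and> \<not> prime d. \<Lambda> d / real d)"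
proof -
  have "(\<Sum>d=1..N. \<Lambda> d / real d) = (\<Sum>d=1..N. (plog d + (if \<not> prime d then \<Lambda> d / real d else 0)))"
    by (intro sum.cong) (auto simp: plog_def)
  also have "\<dots> = (\<Sum>n=1..N. plog n) + (\<Sum>d | d \<in> {1..N} \<and> \<not> prime d. \<Lambda> d / real d)"
    by (simp only: sum.distrib sum.inter_filter[symmetric] finite_atLeastAtMost)
  finally show ?thesis .
qed

lemma mertens_plog:
  assumes "N \<ge> 1" shows "\<bar>(\<Sum>n=1..N. plog n) - ln (real N)\<bar> \<le> 10"
proof -
  have "0 \<le> (\<Sum>d | d \<in> {1..N} \<and> \<not> prime d. \<Lambda> d / real d)"
    by (intro sum_nonneg divide_nonneg_nonneg mangoldt_nonneg) auto
  then show ?thesis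
    using mertens_mangoldt[OF assms] sum_mangoldt_plog[of N] sum_nonprime_mangoldt[of N] by linarith
qed

lemma telescope_le:
  fixes F g :: "nat \<Rightarrow> real"
  assumes "m \<le> n" "\<And>i. m < i \<Longrightarrow> i \<le> n \<Longrightarrow> g i \<le> F i - F (i - 1)"
  shows "(\<Sum>i=Suc m..n. g i) \<le> F n - F m"
  using assms
proof (induction n rule: dec_induct)
  case (step n)
  have "g (Suc n) \<le> F (Suc n) - F n" using step.prems[of "Suc n"] step.hyps by simp
  moreover have "(\<Sum>i=Suc m..n. g i) \<le> F n - F m" using step by auto
  ultimately show ?case using step by simp
qed auto

lemma telescope_eq:
  fixes F :: "nat \<Rightarrow> real"
  assumes "m \<le> n"
  shows "(\<Sum>i=Suc m..n. F i - F (i - 1)) = F n - F m"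
  using assms by (induction n rule: dec_induct) auto

section \<open>Sums over primes and prime powers\<close>

text \<open>The increments of ln are the density with which \<open>plog\<close> is compared;
  Mertens' theorem at m and at k contributes 10 each.\<close>

lemma plog_deviation:
  assumes "1 \<le> m" "m \<le> k"
  shows "\<bar>\<Sum>i=Suc m..k. plog i - (ln (real i) - ln (real (i - 1)))\<bar> \<le> 20"
proof -
  have "(\<Sum>i=1..k. plog i) = (\<Sum>i=1..m. plog i) + (\<Sum>i=Suc m..k. plog i)"
    using assms sum.ub_add_nat[of 1 m plog "k - m"] by simp
  then show ?thesis
    using mertens_plog[of m] mertens_plog[of k] assms telescope_eq[of m k "\<lambda>i. ln (real i)"]
    by (simp add: sum_subtractf)
qed

text \<open>Trades a sum over primes for a sum against the increments of ln, which can be telescoped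
  like an integral in the variable ln i.\<close>

lemma plog_abel_upper:
  assumes "1 \<le> m" "m < n" and f: "\<And>i. m < i \<Longrightarrow> i < n \<Longrightarrow> f (Suc i) \<le> f i" and "0 \<le> f n"
  shows "(\<Sum>i=Suc m..n. plog i * f i) \<le> 20 * f (Suc m) + (\<Sum>i=Suc m..n. (ln (real i) - ln (real (i - 1))) * f i)"
proof -
  have "norm (\<Sum>i=Suc m..n. f i *\<^sub>R (plog i - (ln (real i) - ln (real (i - 1))))) \<le> 20 * f (Suc m)"
    using assms plog_deviation[of m] by (intro abel_antimono) auto
  then show ?thesis by (simp add: algebra_simps sum_subtractf sum.distrib)
qed

text \<open>Upper half of Mertens' second theorem, by partial summation with weight 1/ln i and
  primitive ln ln. The 32 is made of 20/ln 2 <= 30, of 1 for the term i = 2, and of - ln ln 2 <=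
  1.\<close>

lemma sum_prime_recip:
  assumes "N \<ge> 2"
  shows "(\<Sum>p | prime p \<and> p \<le> N. 1 / real p) \<le> 32 + ln (ln (real N))"
proof -
  have ln2: "ln 2 \<ge> (2/3::real)" by (rule ln2_ge_two_thirds)
  have "(\<Sum>p | prime p \<and> p \<le> N. 1 / real p) = (\<Sum>i=Suc 1..N. plog i * (1 / ln (real i)))"
  proof (rule sum.mono_neutral_cong_left)
    show "{p. prime p \<and> p \<le> N} \<subseteq> {Suc 1..N}" using prime_gt_1_nat by (auto simp: Suc_le_eq)
    show "1 / real p = plog p * (1 / ln (real p))" if "p \<in> {p. prime p \<and> p \<le> N}" for p
      using that prime_gt_1_nat[of p] by (simp add: plog_def)
  qed (auto simp: plog_def)
  also have "\<dots> \<le> 20 * (1 / ln (real (Suc 1))) + (\<Sum>i=Suc 1..N. (ln (real i) - ln (real (i - 1))) * (1 / ln (real i)))"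
    using assms by (intro plog_abel_upper) (auto simp: field_simps intro!: divide_left_mono)
  also have "20 * (1 / ln (real (Suc 1))) \<le> 30" using ln2 by (simp add: field_simps)
  \<comment> \<open>The term i = 2 is split off because the primitive ln ln (i - 1) cannot be used
    at ln 1 = 0.\<close>
  also have "(\<Sum>i=Suc 1..N. (ln (real i) - ln (real (i - 1))) * (1 / ln (real i))) =
      1 + (\<Sum>i=Suc 2..N. (ln (real i) - ln (real (i - 1))) * (1 / ln (real i)))"
    using assms by (subst sum.atLeast_Suc_atMost) (auto simp: numeral_2_eq_2)
  also have "(\<Sum>i=Suc 2..N. (ln (real i) - ln (real (i - 1))) * (1 / ln (real i))) \<le> ln (ln (real N)) - ln (ln (real 2))"
  proof (rule telescope_le[OF assms])
    fix i :: nat assume i: "2 < i"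
    have l: "ln (real i) > 0" "ln (real (i - 1)) > 0" using i by auto
    have "ln (ln (real (i - 1)) / ln (real i)) \<le> ln (real (i - 1)) / ln (real i) - 1"
      using l by (intro ln_le_minus_one) auto
    then show "(ln (real i) - ln (real (i - 1))) * (1 / ln (real i)) \<le> ln (ln (real i)) - ln (ln (real (i - 1)))"
      using l by (simp add: ln_divide_pos diff_divide_distrib algebra_simps)
  qed
  finally have le: "(\<Sum>p | prime p \<and> p \<le> N. 1 / real p) \<le> 30 + (1 + (ln (ln (real N)) - ln (ln (real 2))))"
    by simp
  have "ln (ln (real 2)) \<ge> - 1"
  proof -
    have "ln (1 / ln 2) \<le> 1 / ln 2 - (1::real)" by (intro ln_le_minus_one) auto
    also have "\<dots> \<le> 1" using ln2 by (simp add: field_simps)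
    finally show ?thesis by (simp add: ln_div)
  qed
  then show ?thesis using le by simp
qed

text \<open>At a prime i the summand is 1/(i ln i), so this is a tail of the convergent sum of 1/(p
  ln p): the total cost of relative errors O(1/ln p).\<close>

lemma sum_prime_recip_ln_tail:
  assumes "1 \<le> m" "m < n"
  shows "(\<Sum>i=Suc m..n. plog i / (ln (real i))\<^sup>2) \<le> 34 / ln (real m + 1)"
proof -
  have ln2: "ln 2 \<ge> (2/3::real)" by (rule ln2_ge_two_thirds)
  have L: "ln (real m + 1) \<ge> 2/3" using assms(1) order_trans[OF ln2, of "ln (real m + 1)"] by simp
  have "(\<Sum>i=Suc m..n. plog i / (ln (real i))\<^sup>2) = (\<Sum>i=Suc m..n. plog i * (1 / (ln (real i))\<^sup>2))" by simp
  also have "\<dots> \<le> 20 * (1 / (ln (real (Suc m)))\<^sup>2) +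
     (\<Sum>i=Suc m..n. (ln (real i) - ln (real (i - 1))) * (1 / (ln (real i))\<^sup>2))"
    using assms by (intro plog_abel_upper) (auto intro!: divide_left_mono power_mono)
  also have "20 * (1 / (ln (real (Suc m)))\<^sup>2) \<le> 30 / ln (real m + 1)"
  proof -
    have "20 / ln (real m + 1) / ln (real m + 1) \<le> 30 / ln (real m + 1)"
      using L assms(1) by (intro divide_right_mono) (auto simp: pos_divide_le_eq)
    then show ?thesis by (simp add: power2_eq_square add.commute)
  qed
  also have "(\<Sum>i=Suc m..n. (ln (real i) - ln (real (i - 1))) * (1 / (ln (real i))\<^sup>2)) \<le> 4 / ln (real m + 1)"
  proof -
    have tele: "(\<Sum>i=Suc k..n. (ln (real i) - ln (real (i - 1))) * (1 / (ln (real i))\<^sup>2)) \<le> 1 / ln (real k)"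
      if "k \<ge> 2" "k \<le> n" for k
    proof -
      have "(\<Sum>i=Suc k..n. (ln (real i) - ln (real (i - 1))) * (1 / (ln (real i))\<^sup>2)) 
         \<le> - 1 / ln (real n) - (- 1 / ln (real k))"
      proof (rule telescope_le[OF \<open>k \<le> n\<close>])
        fix i assume i: "k < i"
        define a b where "a = ln (real i)" and "b = ln (real (i - 1))"
        have ab: "b > 0" "b \<le> a" using i that by (auto simp: a_def b_def)
        \<comment> \<open>Comparing a^2 with a b turns the summand into 1/b - 1/a, which
          telescopes.\<close>
        have "(a - b) * (1 / a\<^sup>2) \<le> (a - b) * (1 / (a * b))"
          using ab by (intro mult_left_mono divide_left_mono) (auto simp: power2_eq_square)
        also have "\<dots> = - 1 / a - (- 1 / b)" using ab by (simp add: field_simps)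
        finally show "(ln (real i) - ln (real (i - 1))) * (1 / (ln (real i))\<^sup>2) \<le>
            - 1 / ln (real i) - (- 1 / ln (real (i - 1)))" by (simp add: a_def b_def)
      qed
      also have "\<dots> \<le> 1 / ln (real k)" using that by simp
      finally show ?thesis .
    qed
    show ?thesis
    \<comment> \<open>For m = 1 the bound 1/ln m is void, so i = 2 is taken out; for larger m, m + 1
      <= m^2 passes from ln m to ln (m + 1).\<close>
    proof (cases "m = 1")
      case True
      then have "(\<Sum>i=Suc m..n. (ln (real i) - ln (real (i - 1))) * (1 / (ln (real i))\<^sup>2)) =
         1 / ln 2 + (\<Sum>i=Suc 2..n. (ln (real i) - ln (real (i - 1))) * (1 / (ln (real i))\<^sup>2))"
        using assms by (subst sum.atLeast_Suc_atMost) (auto simp: numeral_2_eq_2 power2_eq_square)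
      also have "\<dots> \<le> 1 / ln 2 + 1 / ln (real 2)" using assms True by (intro add_left_mono tele) auto
      also have "\<dots> \<le> 4 / ln (real m + 1)" using True by (simp add: divide_right_mono)
      finally show ?thesis .
    next
      case False
      then have m: "m \<ge> 2" using assms by simp
      have "real m + 1 \<le> real m * real m" 
      proof -
        have "m + 1 \<le> m * m" using m by (metis Suc_eq_plus1 add_le_mono mult_2 mult_le_mono1 one_le_numeral order_trans Suc_1 Suc_leD add_left_mono plus_1_eq_Suc)
        then show ?thesis by (metis of_nat_1 of_nat_add of_nat_le_iff of_nat_mult)
      qed
      then have "ln (real m + 1) \<le> ln (real m * real m)" using m by (subst ln_le_cancel_iff) auto
      then have "ln (real m + 1) \<le> 2 * ln (real m)" using m by (simp add: ln_mult)
      then have "1 / ln (real m) \<le> 4 / ln (real m + 1)" using m L by (simp add: field_simps)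
      then show ?thesis using tele[of m] m assms by simp
    qed
  qed
  finally show ?thesis by simp
qed

section \<open>Sums over prime powers and their number\<close>

lemma ln2_le_mangoldt: assumes "primepow d" shows "2/3 \<le> \<Lambda> d"
proof -
  have "aprimedivisor d \<ge> 2" using aprimedivisor_gt_Suc_0_nat[OF primepow_gt_Suc_0[OF assms]] by simp
  then have "ln 2 \<le> ln (real (aprimedivisor d))" by simp
  then show ?thesis using assms ln2_ge_two_thirds by (simp add: mangoldt_def)
qed

text \<open>Since \<Lambda> is at least 2/3 on prime powers, the proper ones add at most (3/2) 2 = 3
  to the sum over primes.\<close>

lemma sum_primepow_recip:
  assumes "N \<ge> 2"
  shows "(\<Sum>q | primepow q \<and> q \<le> N. 1 / real q) \<le> 35 + ln (ln (real N))"
proof -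
  have "(\<Sum>q | primepow q \<and> q \<le> N. 1 / real q) \<le>
     (\<Sum>p\<in>{p. prime p \<and> p \<le> N} \<union> {d. d \<in> {1..N} \<and> \<not> prime d \<and> primepow d}. 1 / real p)"
    by (rule sum_mono2) (auto simp: Suc_le_eq primepow_gt_0_nat)
  also have "\<dots> = (\<Sum>p | prime p \<and> p \<le> N. 1 / real p) + (\<Sum>d | d \<in> {1..N} \<and> \<not> prime d \<and> primepow d. 1 / real d)"
    by (rule sum.union_disjoint) auto
  also have "(\<Sum>d | d \<in> {1..N} \<and> \<not> prime d \<and> primepow d. 1 / real d) \<le>
     (\<Sum>d | d \<in> {1..N} \<and> \<not> prime d \<and> primepow d. 3/2 * (\<Lambda> d / real d))"
  proof (rule sum_mono)
    fix d assume d: "d \<in> {d. d \<in> {1..N} \<and> \<not> prime d \<and> primepow d}"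
    then show "1 / real d \<le> 3/2 * (\<Lambda> d / real d)" using ln2_le_mangoldt[of d] by (simp add: field_simps)
  qed
  also have "\<dots> \<le> (\<Sum>d | d \<in> {1..N} \<and> \<not> prime d. 3/2 * (\<Lambda> d / real d))"
    by (rule sum_mono2) (auto intro!: mult_nonneg_nonneg divide_nonneg_nonneg mangoldt_nonneg)
  also have "\<dots> = 3/2 * (\<Sum>d | d \<in> {1..N} \<and> \<not> prime d. \<Lambda> d / real d)" by (simp add: sum_distrib_left)
  also have "\<dots> \<le> 3" using sum_nonprime_mangoldt[of N] by simp
  finally show ?thesis using sum_prime_recip[OF assms] by linarith
qed

text \<open>Split by the base prime p. If p^4 >= N, then \<Lambda>(q) >= (ln N)/4 and Chebyshev's
  bound counts these q. Otherwise p < N^(1/4) and the exponent is O(ln N), so such q are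
  few.\<close>

lemma card_primepow_le:
  assumes "N \<ge> 1"
  shows "real (card {q. primepow q \<and> q \<le> N}) * ln (real N) \<le> 160 * real N"
proof -
  define A where "A = {q. primepow q \<and> q \<le> N \<and> N \<le> aprimedivisor q ^ 4}"
  define B where "B = {q. primepow q \<and> q \<le> N \<and> \<not> N \<le> aprimedivisor q ^ 4}"
  \<comment> \<open>An eighth root, so that ln N = 8 ln x with ln x <= x: the at most 2 N^(1/4) ln N
    powers of small base, times ln N, give 128 x^2 (ln x)^2 <= 128 x^4 <= 128 N.\<close>
  define x where "x = real N powr (1/8)"
  have N1: "real N \<ge> 1" using assms by simp
  have x1: "x \<ge> 1" using N1 by (simp add: x_def ge_one_powr_ge_zero)
  have xN: "x ^ 8 = real N" "x ^ 2 = real N powr (1/4)"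
    using N1 by (simp_all add: x_def powr_power)
  have lnN: "ln (real N) = 8 * ln x" using N1 by (simp add: x_def ln_powr)
  have lnx: "ln x \<le> x" using ln_le_minus_one[of x] x1 by simp
  have ln0: "ln (real N) \<ge> 0" using N1 by simp
  have "real (card A) * (ln (real N) / 4) = (\<Sum>q\<in>A. ln (real N) / 4)" by simp
  also have "\<dots> \<le> (\<Sum>q\<in>A. \<Lambda> q)"
  proof (rule sum_mono)
    fix q assume q: "q \<in> A"
    define p where "p = aprimedivisor q"
    have "ln (real N) \<le> ln (real p ^ 4)"
      using q N1 unfolding A_def p_def by (intro ln_mono) (auto simp flip: of_nat_power)
    also have "\<dots> = 4 * \<Lambda> q" using q by (simp add: ln_realpow mangoldt_def A_def p_def)
    finally show "ln (real N) / 4 \<le> \<Lambda> q" by simp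
  qed
  also have "\<dots> \<le> psi N" unfolding psi_def
    by (rule sum_mono2) (auto simp: A_def mangoldt_nonneg Suc_le_eq primepow_gt_0_nat)
  also have "\<dots> \<le> 8 * real N" by (rule chebyshev_psi)
  finally have cA: "real (card A) * ln (real N) \<le> 32 * real N" by simp
  have "B \<subseteq> (\<lambda>(p,e). p ^ e) ` ({1..nat \<lfloor>x ^ 2\<rfloor>} \<times> {1..nat \<lfloor>2 * ln (real N)\<rfloor>})"
  proof
    fix q assume q: "q \<in> B"
    then obtain p k where pk: "prime p" "k > 0" "q = p ^ k" by (auto simp: B_def primepow_def)
    then have ap: "aprimedivisor q = p" by (simp add: aprimedivisor_prime_power)
    have p2: "p \<ge> 2" using pk prime_ge_2_nat by blast
    have "real p ^ 4 < real N" using q ap unfolding B_def by (metis (mono_tags, lifting) mem_Collect_eq not_le of_nat_less_iff of_nat_power)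
    moreover have "(x ^ 2) ^ 4 = real N" by (simp add: xN(1) flip: power_mult)
    ultimately have "real p ^ 4 \<le> (x ^ 2) ^ 4" by linarith
    have px: "real p \<le> x ^ 2"
    proof (rule ccontr)
      assume "\<not> real p \<le> x ^ 2"
      then have "(x ^ 2) ^ 4 < real p ^ 4" by (intro power_strict_mono) auto
      with \<open>real p ^ 4 \<le> (x ^ 2) ^ 4\<close> show False by linarith
    qed
    have "2 ^ k \<le> q" using p2 pk by (simp add: power_mono)
    then have "2 ^ k \<le> N" using q by (simp add: B_def)
    then have "real (2 ^ k) \<le> real N" by (simp only: of_nat_le_iff)
    then have "ln (2 ^ k) \<le> ln (real N)" using N1 by (subst ln_le_cancel_iff) auto
    then have "real k * ln 2 \<le> ln (real N)" by (simp add: ln_realpow)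
    moreover have "real k * (2/3) \<le> real k * ln 2" using ln2_ge_two_thirds by (intro mult_left_mono) auto
    ultimately have "real k \<le> 2 * ln (real N)" using ln0 by simp
    then have "k \<le> nat \<lfloor>2 * ln (real N)\<rfloor>" by (simp add: le_nat_floor)
    moreover have "p \<le> nat \<lfloor>x ^ 2\<rfloor>" using px by (simp add: le_nat_floor)
    ultimately show "q \<in> (\<lambda>(p,e). p ^ e) ` ({1..nat \<lfloor>x ^ 2\<rfloor>} \<times> {1..nat \<lfloor>2 * ln (real N)\<rfloor>})"
      using pk p2 by (auto intro!: image_eqI[where x = "(p,k)"])
  qed
  then have "card B \<le> card ((\<lambda>(p::nat,e). p ^ e) ` ({1..nat \<lfloor>x ^ 2\<rfloor>} \<times> {1..nat \<lfloor>2 * ln (real N)\<rfloor>}))"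
    by (intro card_mono) auto
  also have "\<dots> \<le> card ({1..nat \<lfloor>x ^ 2\<rfloor>} \<times> {1..nat \<lfloor>2 * ln (real N)\<rfloor>})" by (intro card_image_le) auto
  finally have "card B \<le> nat \<lfloor>x ^ 2\<rfloor> * nat \<lfloor>2 * ln (real N)\<rfloor>"
    by (simp add: card_cartesian_product)
  then have "real (card B) \<le> real (nat \<lfloor>x ^ 2\<rfloor>) * real (nat \<lfloor>2 * ln (real N)\<rfloor>)"
    by (metis of_nat_le_iff of_nat_mult)
  also have "\<dots> \<le> x ^ 2 * (2 * ln (real N))"
    using ln0 x1 by (intro mult_mono of_nat_floor) auto
  finally have "real (card B) * ln (real N) \<le> x ^ 2 * (2 * ln (real N)) * ln (real N)"
    using ln0 by (intro mult_right_mono) auto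
  also have "\<dots> = 128 * (x ^ 2 * (ln x * ln x))" by (simp add: lnN)
  also have "\<dots> \<le> 128 * (x ^ 2 * (x * x))" using lnx x1 by (intro mult_left_mono mult_mono) auto
  also have "\<dots> = 128 * x ^ 4" by (simp add: power2_eq_square power4_eq_xxxx)
  also have "\<dots> \<le> 128 * x ^ 8" using x1 by (intro mult_left_mono power_increasing) auto
  finally have cB: "real (card B) * ln (real N) \<le> 128 * real N" by (simp add: xN)
  have "{q. primepow q \<and> q \<le> N} = A \<union> B" by (auto simp: A_def B_def)
  then have "card {q. primepow q \<and> q \<le> N} \<le> card A + card B" by (simp add: card_Un_le)
  then have "real (card {q. primepow q \<and> q \<le> N}) * ln (real N) \<le> real (card A + card B) * ln (real N)"
    using ln0 by (intro mult_right_mono) auto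
  then show ?thesis using cA cB by (simp add: algebra_simps)
qed

text \<open>The shifts make \<open>loglog x \<ge> 1\<close> for every \<open>x \<ge> 1\<close>.\<close>

definition loglog :: "real \<Rightarrow> real" where "loglog x = 1 + ln (1 + ln x)"

lemma loglog_ge_1: "x \<ge> 1 \<Longrightarrow> loglog x \<ge> 1" by (simp add: loglog_def)

lemma loglog_mono: "1 \<le> x \<Longrightarrow> x \<le> y \<Longrightarrow> loglog x \<le> loglog y"
  using ln_mono[of x y] ln_ge_zero[of x] unfolding loglog_def by (intro add_left_mono ln_mono) linarith+

lemma harmonic_le: "I \<ge> 1 \<Longrightarrow> (\<Sum>i=1..I. 1 / real i) \<le> 1 + ln (real I)"
proof (induction I rule: dec_induct)
  case (step n)
  then show ?case using ln_diff_bounds(1)[of n] by (simp add: add.commute)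
qed auto

text \<open>For q <= sqrt X the logarithm is at least (ln X)/2 and Mertens' second theorem applies.
  For larger q, Chebyshev's bound on the block where X/q is about 2^i gives O(1/(i ln X)), and the
  harmonic sum over i <= log2 X is again O(ln ln X).\<close>

lemma sum_primepow_recip_ln:
  assumes X: "X \<ge> 2"
  shows "(\<Sum>q | primepow q \<and> real q \<le> X / 2. 1 / (real q * ln (X / real q))) \<le> 2000 * loglog X / ln X"
proof -
  define S where "S = {q. primepow q \<and> real q \<le> X / 2}"
  define S1 where "S1 = {q \<in> S. real q \<le> sqrt X}"
  define S2 where "S2 = {q \<in> S. sqrt X < real q}"
  define h where "h = (\<lambda>q::nat. 1 / (real q * ln (X / real q)))"
  have "S \<subseteq> {..nat \<lfloor>X\<rfloor>}" using X by (auto simp: S_def le_nat_floor)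
  then have "finite S" by (rule finite_subset) auto
  then have fin12: "finite S1" "finite S2" by (auto simp: S1_def S2_def)
  have lnX: "ln X > 0" using X by simp
  have LL: "loglog X \<ge> 1" using X by (intro loglog_ge_1) auto
  have qpos: "real q \<ge> 2" if "q \<in> S" for q
    using that primepow_gt_Suc_0[of q] by (simp add: S_def)
  have "sum h S1 \<le> (\<Sum>q\<in>S1. 2 / ln X * (1 / real q))"
  proof (rule sum_mono)
    fix q assume q: "q \<in> S1"
    then have q2: "real q \<ge> 2" "real q \<le> X / 2" using qpos by (auto simp: S1_def S_def)
    have "X = sqrt X * sqrt X" using X by simp
    also have "\<dots> \<ge> sqrt X * real q" using q X by (intro mult_left_mono) (auto simp: S1_def)
    finally have "sqrt X \<le> X / real q" using q2 by (simp add: field_simps)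
    then have "ln (sqrt X) \<le> ln (X / real q)" using X q2 by (subst ln_le_cancel_iff) auto
    then have "ln X / 2 \<le> ln (X / real q)" using X by (simp add: ln_sqrt)
    then show "h q \<le> 2 / ln X * (1 / real q)"
      unfolding h_def using lnX q2 by (simp add: field_simps)
  qed
  also have "\<dots> = 2 / ln X * (\<Sum>q\<in>S1. 1 / real q)" by (simp add: sum_distrib_left)
  also have "\<dots> \<le> 2 / ln X * (36 * loglog X)"
  proof (rule mult_left_mono)
    have N2: "nat \<lfloor>X\<rfloor> \<ge> 2" using X by (simp add: le_nat_floor)
    have "(\<Sum>q\<in>S1. 1 / real q) \<le> (\<Sum>q | primepow q \<and> q \<le> nat \<lfloor>X\<rfloor>. 1 / real q)"
      using X by (intro sum_mono2) (auto simp: S1_def S_def le_nat_floor)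
    also have "\<dots> \<le> 35 + ln (ln (real (nat \<lfloor>X\<rfloor>)))" by (rule sum_primepow_recip[OF N2])
    finally have le: "(\<Sum>q\<in>S1. 1 / real q) \<le> 35 + ln (ln (real (nat \<lfloor>X\<rfloor>)))" .
    have "ln (ln (real (nat \<lfloor>X\<rfloor>))) \<le> ln (1 + ln X)"
    proof -
      have "0 < real (nat \<lfloor>X\<rfloor>)" "real (nat \<lfloor>X\<rfloor>) \<le> X" using N2 X by linarith+
      then have "ln (real (nat \<lfloor>X\<rfloor>)) \<le> ln X" by (intro ln_mono) auto
      moreover have "ln (real (nat \<lfloor>X\<rfloor>)) > 0" using N2 by (intro ln_gt_zero) linarith
      ultimately show ?thesis by (subst ln_le_cancel_iff) auto
    qed
    then show "(\<Sum>q\<in>S1. 1 / real q) \<le> 36 * loglog X"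
    proof -
      assume "ln (ln (real (nat \<lfloor>X\<rfloor>))) \<le> ln (1 + ln X)"
      then have "(\<Sum>q\<in>S1. 1 / real q) \<le> 35 + ln (1 + ln X)"
        using le by (meson add_left_mono order_trans)
      also have "\<dots> \<le> 36 * loglog X" using LL by (simp add: loglog_def)
      finally show ?thesis .
    qed
  qed (use lnX in auto)
  finally have 1: "sum h S1 \<le> 72 * loglog X / ln X" by simp
  define I where "I = nat \<lfloor>log 2 X\<rfloor>"
  \<comment> \<open>The dyadic index: 2^i <= X/q < 2^(i+1) for i = g q, so ln (X/q) is of size
    i.\<close>
  define g where "g = (\<lambda>q::nat. nat \<lfloor>log 2 (X / real q)\<rfloor>)"
  have I1: "I \<ge> 1" using X by (simp add: I_def le_nat_floor)
  have g1: "g q \<ge> 1 \<and> g q \<le> I" and gpow: "2 ^ g q \<le> X / real q \<and> X / real q < 2 ^ (g q + 1)" if "q \<in> S" for q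
  proof -
    have q: "real q \<ge> 2" "real q \<le> X / 2" using qpos that by (auto simp: S_def)
    then have Xq: "X / real q \<ge> 2" by (simp add: field_simps)
    then have l1: "log 2 (X / real q) \<ge> 1" by simp
    then have "g q \<ge> 1" by (simp add: g_def le_nat_floor)
    moreover have "log 2 (X / real q) \<le> log 2 X" using q X by (subst log_le_cancel_iff) (auto simp: field_simps)
    then have "g q \<le> I" unfolding g_def I_def by (intro nat_mono floor_mono)
    ultimately show "g q \<ge> 1 \<and> g q \<le> I" by simp
    have "real (g q) \<le> log 2 (X / real q)" "log 2 (X / real q) < real (g q) + 1"
      using l1 unfolding g_def by linarith+
    then have "2 powr real (g q) \<le> X / real q" "X / real q < 2 powr (real (g q + 1))"
      using Xq by (simp_all add: le_log_iff log_less_iff add.commute)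
    then show "2 ^ g q \<le> X / real q \<and> X / real q < 2 ^ (g q + 1)"
      by (simp only: powr_realpow zero_less_numeral)
  qed
  have "sum h S2 = (\<Sum>i=1..I. \<Sum>q | q \<in> S2 \<and> g q = i. h q)"
    using fin12 g1 by (intro sum.group[symmetric]) (auto simp: S2_def)
  also have "\<dots> \<le> (\<Sum>i=1..I. 960 / ln X * (1 / real i))"
  proof (rule sum_mono)
    fix i assume i: "i \<in> {1..I}"
    define F where "F = {q. q \<in> S2 \<and> g q = i}"
    show "(\<Sum>q | q \<in> S2 \<and> g q = i. h q) \<le> 960 / ln X * (1 / real i)"
    proof (cases "F = {}")
      case True
      then have "(\<Sum>q | q \<in> S2 \<and> g q = i. h q) = 0" unfolding F_def[symmetric] by simp
      then show ?thesis using i lnX by simp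
    next
      case False
      define M where "M = nat \<lfloor>X / 2 ^ i\<rfloor>"
      have FM: "F \<subseteq> {q. primepow q \<and> q \<le> M}"
      proof
        fix q assume q: "q \<in> F"
        then have "q \<in> S" "g q = i" by (auto simp: F_def S2_def)
        then have "2 ^ i \<le> X / real q" "real q \<ge> 2" using gpow[of q] qpos[of q] by auto
        then have "real q \<le> X / 2 ^ i" by (simp add: field_simps)
        then show "q \<in> {q. primepow q \<and> q \<le> M}" using \<open>q \<in> S\<close> by (auto simp: S_def M_def le_nat_floor)
      qed
      \<comment> \<open>A nonempty block contains some q0 > sqrt X; hence M >= sqrt X, and ln M in
        Chebyshev's bound may be replaced by (ln X)/2.\<close>
      obtain q0 where q0: "q0 \<in> F" using False by auto
      have "sqrt X < real q0" "q0 \<le> M" using q0 FM by (auto simp: F_def S2_def)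
      then have "sqrt X \<le> real M" by linarith
      then have "ln (sqrt X) \<le> ln (real M)" using X by (intro ln_mono) auto
      then have lnM: "ln X / 2 \<le> ln (real M)" using X by (simp add: ln_sqrt)
      have M1: "M \<ge> 1" using \<open>sqrt X < real q0\<close> \<open>q0 \<le> M\<close> X by (cases q0) auto
      have "real (card F) \<le> real (card {q. primepow q \<and> q \<le> M})" using FM by (auto intro!: card_mono)
      then have "real (card F) * (ln X / 2) \<le> real (card {q. primepow q \<and> q \<le> M}) * ln (real M)"
        using lnM lnX by (intro mult_mono) auto
      also have "\<dots> \<le> 160 * real M" by (rule card_primepow_le[OF M1])
      also have "\<dots> \<le> 160 * (X / 2 ^ i)" unfolding M_def using X by (intro mult_left_mono of_nat_floor) auto
      finally have cF: "real (card F) \<le> 320 * (X / 2 ^ i) / ln X" using lnX by (simp add: field_simps)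
      have "(\<Sum>q\<in>F. h q) \<le> (\<Sum>q\<in>F. 2 ^ (i + 1) / X * (3 / (2 * real i)))"
      proof (rule sum_mono)
        fix q assume q: "q \<in> F"
        then have "q \<in> S" "g q = i" by (auto simp: F_def S2_def)
        then have q': "2 ^ i \<le> X / real q" "X / real q < 2 ^ (i+1)" "real q \<ge> 2" using gpow[of q] qpos[of q] by auto
        have "1 / real q \<le> 2 ^ (i + 1) / X" using q' X by (simp add: field_simps)
        moreover have "ln (2 ^ i) \<le> ln (X / real q)" using q' X by (subst ln_le_cancel_iff) auto
        then have "real i * ln 2 \<le> ln (X / real q)" by (simp add: ln_realpow)
        then have "real i * (2/3) \<le> ln (X / real q)"
          using ln2_ge_two_thirds by (meson mult_left_mono of_nat_0_le_iff order_trans)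
        then have "1 / ln (X / real q) \<le> 1 / (real i * (2/3))" using i by (intro divide_left_mono) auto
        then have "1 / ln (X / real q) \<le> 3 / (2 * real i)" by (simp add: field_simps)
        ultimately have "(1 / real q) * (1 / ln (X / real q)) \<le> 2 ^ (i + 1) / X * (3 / (2 * real i))"
          using X order_trans[OF _ \<open>real i * (2/3) \<le> ln (X / real q)\<close>, of 0]
          by (intro mult_mono) (simp_all del: ln_ge_zero_iff)
        then show "h q \<le> 2 ^ (i + 1) / X * (3 / (2 * real i))" by (simp add: h_def)
      qed
      also have "\<dots> = real (card F) * (2 ^ (i + 1) / X * (3 / (2 * real i)))" by simp
      also have "\<dots> \<le> 320 * (X / 2 ^ i) / ln X * (2 ^ (i + 1) / X * (3 / (2 * real i)))"
        using cF X by (intro mult_right_mono) auto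
      also have "\<dots> = 960 / ln X * (1 / real i)" using X i by (simp add: field_simps)
      finally show ?thesis by (simp add: F_def)
    qed
  qed
  also have "\<dots> = 960 / ln X * (\<Sum>i=1..I. 1 / real i)" by (simp add: sum_distrib_left)
  also have "\<dots> \<le> 960 / ln X * (2 * loglog X)"
  proof (rule mult_left_mono)
    have "real I \<le> log 2 X" using X unfolding I_def by (intro of_nat_floor) auto
    also have "\<dots> = ln X / ln 2" by (simp add: log_def)
    also have "\<dots> \<le> ln X / (2/3)" using lnX ln2_ge_two_thirds by (intro divide_left_mono) auto
    also have "\<dots> \<le> 2 * (1 + ln X)" using lnX by simp
    finally have "ln (real I) \<le> ln (2 * (1 + ln X))" using I1 lnX by (subst ln_le_cancel_iff) auto
    also have "\<dots> = ln 2 + ln (1 + ln X)" using lnX by (intro ln_mult_pos) auto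
    also have "\<dots> \<le> 1 + ln (1 + ln X)" using ln_le_minus_one[of 2] by simp
    also have "\<dots> = loglog X" by (simp add: loglog_def)
    finally have "1 + ln (real I) \<le> 2 * loglog X" using LL by linarith
    then show "(\<Sum>i=1..I. 1 / real i) \<le> 2 * loglog X" using harmonic_le[OF I1] by linarith
  qed (use lnX in auto)
  finally have 2: "sum h S2 \<le> 1920 * loglog X / ln X" by simp
  have "sum h S = sum h (S1 \<union> S2)" by (rule arg_cong[where f = "sum h"]) (auto simp: S1_def S2_def)
  also have "\<dots> = sum h S1 + sum h S2" using fin12 by (intro sum.union_disjoint) (auto simp: S1_def S2_def)
  finally have "sum h S = sum h S1 + sum h S2" .
  then have "sum h S \<le> (72 + 1920) * loglog X / ln X" using 1 2 by (simp add: add_divide_distrib ring_distribs)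
  also have "\<dots> \<le> 2000 * loglog X / ln X" using lnX LL by (intro divide_right_mono mult_right_mono) auto
  finally show ?thesis by (simp add: S_def h_def)
qed

section \<open>The Dickman function\<close>

text \<open>
  Method of steps for the delay equation \<open>u \<rho>'(u) = - \<rho>(u - 1)\<close>: each application of the
  integral equation enlarges by one the interval on which the solution is correct.
\<close>

primrec rho_step :: "nat \<Rightarrow> real \<Rightarrow> real" where
  "rho_step 0 u = 1"
| "rho_step (Suc n) u = (if u \<le> 1 then 1 else 1 - integral {1..u} (\<lambda>v. rho_step n (v - 1) / v))"

lemma continuous_rho_step: "continuous_on {..b} (rho_step n)"
proof (induction n arbitrary: b)
  case 0
  then show ?case by (simp add: rho_step_def)
next
  case (Suc n)
  define B where "B = max b 1"
  have c: "continuous_on {1..B} (\<lambda>v. rho_step n (v - 1) / v)"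
    by (intro continuous_intros continuous_on_compose2[OF Suc[of B]]) auto
  have "continuous_on {1..B} (\<lambda>u. 1 - integral {1..u} (\<lambda>v. rho_step n (v - 1) / v))"
    by (intro continuous_intros indefinite_integral_continuous_1 integrable_continuous_real c)
  then have "continuous_on ({..1} \<union> {1..B}) (\<lambda>u. if u \<le> 1 then 1 else 1 - integral {1..u} (\<lambda>v. rho_step n (v - 1) / v))"
    by (intro continuous_on_cases) auto
  moreover have "rho_step (Suc n) = (\<lambda>u. if u \<le> 1 then 1 else 1 - integral {1..u} (\<lambda>v. rho_step n (v - 1) / v))"
    by (rule ext) simp
  moreover have "{..b} \<subseteq> {..1} \<union> {1..B}" by (auto simp: B_def)
  ultimately show ?case
    using continuous_on_subset[of "{..1} \<union> {1..B}" "rho_step (Suc n)" "{..b}"] by simp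
qed

lemma rho_step_Suc: "u \<le> real n + 1 \<Longrightarrow> rho_step (Suc n) u = rho_step n u"
proof (induction n arbitrary: u)
  case (Suc n)
  show ?case
  proof (cases "u \<le> 1")
    case False
    have "integral {1..u} (\<lambda>v. rho_step (Suc n) (v - 1) / v) = integral {1..u} (\<lambda>v. rho_step n (v - 1) / v)"
      using Suc.prems by (intro integral_cong) (subst Suc.IH; auto)
    then show ?thesis using False by (simp del: rho_step.simps add: rho_step.simps(2)[of "Suc n"] rho_step.simps(2)[of n])
  qed auto
qed auto

lemma rho_step_eq:
  assumes "n \<le> m" "u \<le> real n + 1"
  shows "rho_step m u = rho_step n u"
  using assms(1)
proof (induction m rule: dec_induct)
  case (step m)
  then have "u \<le> real m + 1" using assms(2) by linarith
  then show ?case using rho_step_Suc[of u m] step by metis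
qed auto

text \<open>Every number n of steps with u <= n + 1 gives the same value. Negative arguments yield 1
  rather than the customary 0, which keeps the function decreasing on the whole line.\<close>

definition rho :: "real \<Rightarrow> real" where "rho u = rho_step (nat \<lceil>u\<rceil>) u"

lemma rho_eq_step: "u \<le> real n + 1 \<Longrightarrow> rho u = rho_step n u"
  unfolding rho_def using rho_step_eq[of "nat \<lceil>u\<rceil>" n u] rho_step_eq[of n "nat \<lceil>u\<rceil>" u]
  by (cases "nat \<lceil>u\<rceil> \<le> n") (auto, linarith)

lemma rho_eq_1: "u \<le> 1 \<Longrightarrow> rho u = 1"
  using rho_eq_step[of u 0] by simp

lemma continuous_rho: "continuous_on {a..b} rho"
proof -
  obtain n :: nat where "b \<le> real n + 1" using real_arch_simple[of b] by (metis add.commute add_increasing zero_le_one)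
  then have "continuous_on {a..b} rho \<longleftrightarrow> continuous_on {a..b} (rho_step n)"
    by (intro continuous_on_cong) (auto simp: rho_eq_step)
  then show ?thesis using continuous_on_subset[OF continuous_rho_step[of b n]] by auto
qed

lemma continuous_rho_shift: "1 \<le> a \<Longrightarrow> continuous_on {a..b} (\<lambda>v. rho (v - 1) / v)"
  by (intro continuous_intros continuous_on_compose2[OF continuous_rho[of "a - 1" "b - 1"]]) auto

lemma rho_integral:
  assumes "1 \<le> u" shows "rho u = 1 - integral {1..u} (\<lambda>v. rho (v - 1) / v)"
proof (cases "u = 1")
  case False
  obtain n :: nat where n: "u \<le> real n" using real_arch_simple by blast
  have "rho u = rho_step (Suc n) u" using n by (intro rho_eq_step) simp
  also have "\<dots> = 1 - integral {1..u} (\<lambda>v. rho_step n (v - 1) / v)" using assms False by simp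
  also have "integral {1..u} (\<lambda>v. rho_step n (v - 1) / v) = integral {1..u} (\<lambda>v. rho (v - 1) / v)"
    using n by (intro integral_cong) (subst rho_eq_step[of _ n]; simp)
  finally show ?thesis .
qed (simp add: rho_eq_1)

definition rho_int :: "real \<Rightarrow> real" where "rho_int u = integral {0..u} rho"

lemma rho_int_diff: "0 \<le> a \<Longrightarrow> a \<le> b \<Longrightarrow> rho_int b - rho_int a = integral {a..b} rho"
  unfolding rho_int_def
  using Henstock_Kurzweil_Integration.integral_combine[of 0 a b rho] integrable_continuous_real[OF continuous_rho[of 0 b]]
  by simp

lemma rho_int_deriv: 
  assumes "0 \<le> u" "u \<le> b"
  shows "(rho_int has_real_derivative rho u) (at u within {0..b})"
  unfolding rho_int_def[abs_def] using assms by (intro integral_has_real_derivative continuous_rho) auto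

lemma rho_deriv: 
  assumes "1 \<le> u" "u \<le> b"
  shows "(rho has_real_derivative - rho (u - 1) / u) (at u within {1..b})"
proof -
  have "((\<lambda>u. 1 - integral {1..u} (\<lambda>v. rho (v - 1) / v)) has_real_derivative 0 - rho (u - 1) / u) (at u within {1..b})"
    using assms by (intro derivative_intros integral_has_real_derivative continuous_rho_shift) auto
  then show ?thesis
    by (rule has_field_derivative_transform_within[of _ _ _ _ 1, THEN DERIV_cong]) (use assms rho_integral in auto)
qed

text \<open>Both sides have derivative rho(u) - rho(u - 1) by the delay equation and agree at u = 1.
  This averaged form is the counterpart of the logarithmic identity for smooth numbers.\<close>

lemma rho_int_identity:
  assumes "1 \<le> u" shows "rho_int u - rho_int (u - 1) = u * rho u"
proof -
  have "((\<lambda>u. u * rho u - (rho_int u - rho_int (u - 1))) has_real_derivative 0) (at v within {1..u})"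
    if v: "v \<in> {1..u}" for v
  proof -
    have 1: "(rho_int has_real_derivative rho v) (at v within {1..u})"
      using rho_int_deriv[of v u] v by (auto intro: DERIV_subset)
    have 2: "((\<lambda>u. rho_int (u - 1)) has_real_derivative rho (v - 1) * 1) (at v within {1..u})"
    proof (rule DERIV_image_chain[where f = rho_int and g = "\<lambda>u. u - 1", unfolded o_def])
      show "(rho_int has_real_derivative rho (v - 1)) (at (v - 1) within (\<lambda>u. u - 1) ` {1..u})"
        using rho_int_deriv[of "v - 1" u] v by (rule_tac DERIV_subset[where s = "{0..u}"]) auto
      show "((\<lambda>u. u - 1) has_real_derivative 1) (at v within {1..u})"
        by (auto intro!: derivative_eq_intros)
    qed
    have "((\<lambda>u. u * rho u - (rho_int u - rho_int (u - 1))) has_real_derivative 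
        (1 * rho v + (- rho (v - 1) / v) * v) - (rho v - rho (v - 1) * 1)) (at v within {1..u})"
      using v by (intro DERIV_diff DERIV_mult DERIV_ident 1 2 rho_deriv) auto
    then show ?thesis using v by simp
  qed
  then obtain c where c: "\<forall>v\<in>{1..u}. v * rho v - (rho_int v - rho_int (v - 1)) = c"
    using has_field_derivative_zero_constant[of "{1..u}" "\<lambda>u. u * rho u - (rho_int u - rho_int (u - 1))"] by auto
  have "rho_int 1 - rho_int 0 = integral {0..1} rho" by (rule rho_int_diff) auto
  also have "\<dots> = integral {0..1::real} (\<lambda>_. 1::real)"
    by (rule Henstock_Kurzweil_Integration.integral_cong) (simp add: rho_eq_1)
  finally have "rho_int 1 - rho_int 0 = 1" by simp
  then have "c = 0" using c[rule_format, of 1] assms by (simp add: rho_eq_1)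
  then show ?thesis using c[rule_format, of u] assms by simp
qed

text \<open>Nonnegativity up to n makes the integrand rho(v - 1)/v nonnegative, hence rho decreasing
  up to n + 1. Then u rho(u), the integral of rho over [u - 1, u], is at least rho(u), so (u - 1)
  rho(u) >= 0, which carries nonnegativity to n + 1.\<close>

lemma rho_nonneg_aux: "\<forall>u\<le>real n. rho u \<ge> 0"
  and rho_antimono_aux: "a \<le> b \<Longrightarrow> b \<le> real n + 1 \<Longrightarrow> rho b \<le> rho a"
proof -
  have step: "rho b \<le> rho a" if nn: "\<forall>u\<le>real n. rho u \<ge> 0" and ab: "a \<le> b" "b \<le> real n + 1" for n a b
  proof -
    have main: "rho b \<le> rho a" if "1 \<le> a" "a \<le> b" "b \<le> real n + 1" for a b
    proof -
      have int: "(\<lambda>v. rho (v - 1) / v) integrable_on {1..b}" by (intro integrable_continuous_real continuous_rho_shift) auto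
      have "integral {1..a} (\<lambda>v. rho (v - 1) / v) + integral {a..b} (\<lambda>v. rho (v - 1) / v) = integral {1..b} (\<lambda>v. rho (v - 1) / v)"
        using that int by (intro Henstock_Kurzweil_Integration.integral_combine) auto
      moreover have "integral {a..b} (\<lambda>v. rho (v - 1) / v) \<ge> 0"
        using that nn by (intro integral_nonneg integrable_continuous_real continuous_rho_shift) auto
      ultimately show ?thesis using rho_integral[of a] rho_integral[of b] that by simp
    qed
    show ?thesis
    proof (cases "1 \<le> a")
      case True
      then show ?thesis using main ab by auto
    next
      case False
      then show ?thesis using main[of 1 b] ab rho_eq_1[of a] rho_eq_1[of b] rho_eq_1[of 1] by (cases "1 \<le> b") auto
    qed
  qed
  have nn: "\<forall>u\<le>real n. rho u \<ge> 0" for n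
  proof (induction n)
    case 0
    then show ?case by (auto simp: rho_eq_1)
  next
    case (Suc n)
    show ?case
    proof (intro allI impI)
      fix u assume u: "u \<le> real (Suc n)"
      show "rho u \<ge> 0"
      proof (cases "u \<le> 1")
        case False
        have "integral {u - 1..u} (\<lambda>_. rho u) \<le> integral {u - 1..u} rho"
          using step[OF Suc] u by (intro integral_le integrable_continuous_real continuous_rho) auto
        then have "rho u \<le> u * rho u"
          using rho_int_identity[of u] rho_int_diff[of "u - 1" u] False by simp
        then have "0 \<le> (u - 1) * rho u" by (simp add: algebra_simps)
        then show ?thesis using False by (simp add: zero_le_mult_iff)
      qed (simp add: rho_eq_1)
    qed
  qed
  then show "\<forall>u\<le>real n. rho u \<ge> 0" .
  show "a \<le> b \<Longrightarrow> b \<le> real n + 1 \<Longrightarrow> rho b \<le> rho a" by (rule step[OF nn])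
qed

lemma rho_nonneg: "rho u \<ge> 0"
  using rho_nonneg_aux[of "nat \<lceil>u\<rceil>"] real_nat_ceiling_ge by blast

lemma rho_antimono: "a \<le> b \<Longrightarrow> rho b \<le> rho a"
  using rho_antimono_aux[of a b "nat \<lceil>b\<rceil>"] real_nat_ceiling_ge[of b] by linarith

lemma rho_le_1: "rho u \<le> 1"
  using rho_antimono[of "min u 0" u] rho_eq_1[of "min u 0"] by simp

lemma rho_int_bounds:
  assumes "0 \<le> a" "a \<le> b"
  shows "rho b * (b - a) \<le> rho_int b - rho_int a" "rho_int b - rho_int a \<le> rho a * (b - a)"
proof -
  have "integral {a..b} (\<lambda>_. rho b) \<le> integral {a..b} rho" "integral {a..b} rho \<le> integral {a..b} (\<lambda>_. rho a)"
    using rho_antimono by (intro integral_le integrable_continuous_real continuous_rho; auto)+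
  then show "rho b * (b - a) \<le> rho_int b - rho_int a" "rho_int b - rho_int a \<le> rho a * (b - a)"
    using assms by (auto simp: rho_int_diff mult.commute)
qed

text \<open>From u rho(u) <= rho(u - 1), each unit step beyond u = 3 gains a factor 1/3 <= 1/e. The
  true decay is much faster, but any exponential rate e^(-u) suffices.\<close>

lemma rho_decay: "rho u \<le> exp (3 - u)"
proof -
  have "\<forall>u\<le>real n + 3. rho u \<le> exp (3 - u)" for n
  proof (induction n)
    case 0
    have "rho u \<le> exp (3 - u)" if "u \<le> 3" for u
      using rho_le_1[of u] that one_le_exp_iff[of "3 - u"] by linarith
    then show ?case by simp
  next
    case (Suc n)
    show ?case
    proof (intro allI impI)
      fix u assume u: "u \<le> real (Suc n) + 3"
      show "rho u \<le> exp (3 - u)"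
      proof (cases "u \<le> 3")
        case True
        then show ?thesis using rho_le_1[of u] one_le_exp_iff[of "3 - u"] by linarith
      next
        case False
        have "3 * rho u \<le> u * rho u" using False rho_nonneg by (intro mult_right_mono) auto
        also have "\<dots> \<le> rho (u - 1)" using rho_int_identity[of u] rho_int_bounds(2)[of "u-1" u] False by simp
        also have "\<dots> \<le> exp (3 - (u - 1))" using Suc[rule_format, of "u - 1"] u by simp
        also have "\<dots> = exp 1 * exp (3 - u)" by (simp flip: exp_add)
        also have "\<dots> \<le> 3 * exp (3 - u)" using exp_le by (intro mult_right_mono) auto
        finally show ?thesis by simp
      qed
    qed
  qed
  then show ?thesis using real_nat_ceiling_ge[of u] by (meson add_increasing2 zero_le_numeral)
qed

section \<open>Smooth numbers\<close>

definition smooth :: "nat \<Rightarrow> nat \<Rightarrow> bool" where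
  "smooth z m \<longleftrightarrow> m > 0 \<and> (\<forall>p. prime p \<and> p dvd m \<longrightarrow> p \<le> z)"

definition smooths :: "real \<Rightarrow> nat \<Rightarrow> nat set" where
  "smooths t z = {m. smooth z m \<and> real m \<le> t}"

definition Psi :: "real \<Rightarrow> nat \<Rightarrow> real" where
  "Psi t z = real (card (smooths t z))"

lemma smooth_mult: "smooth z (a * b) \<longleftrightarrow> smooth z a \<and> smooth z b"
  by (auto simp: smooth_def prime_dvd_mult_iff)

lemma smooth_prime: "prime p \<Longrightarrow> smooth z p \<longleftrightarrow> p \<le> z"
  using primes_dvd_imp_eq prime_gt_0_nat by (auto simp: smooth_def)

lemma smooths_subset: "smooths t z \<subseteq> {1..nat \<lfloor>t\<rfloor>}"
  by (auto simp: smooths_def smooth_def le_nat_floor)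

lemma finite_smooths [simp]: "finite (smooths t z)"
  using smooths_subset finite_subset by blast

lemma Psi_nonneg [simp]: "0 \<le> Psi t z" by (simp add: Psi_def)

lemma Psi_le: "0 \<le> t \<Longrightarrow> Psi t z \<le> t"
  using card_mono[OF _ smooths_subset[of t z]] of_nat_floor[of t] unfolding Psi_def
  by (simp, linarith)

lemma Psi_eq_0: "t < 1 \<Longrightarrow> Psi t z = 0"
  using smooths_subset[of t z] by (simp add: Psi_def)

lemma Psi_ge:
  assumes "t \<le> real z" shows "t - 1 \<le> Psi t z"
proof -
  have "{1..nat \<lfloor>t\<rfloor>} \<subseteq> smooths t z"
  proof
    fix m assume m: "m \<in> {1..nat \<lfloor>t\<rfloor>}"
    then have "int m \<le> \<lfloor>t\<rfloor>" by auto
    then have mt: "real m \<le> t" by linarith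
    then have "m \<le> z" using assms by linarith
    moreover have "p \<le> m" if "prime p" "p dvd m" for p using that m by (auto intro: dvd_imp_le)
    ultimately show "m \<in> smooths t z" using m mt by (auto simp: smooths_def smooth_def intro: order_trans)
  qed
  then have "nat \<lfloor>t\<rfloor> \<le> card (smooths t z)" using card_mono[of "smooths t z" "{1..nat \<lfloor>t\<rfloor>}"] by simp
  then have "real (nat \<lfloor>t\<rfloor>) \<le> Psi t z" by (simp add: Psi_def)
  then show ?thesis by linarith
qed

section \<open>The logarithmic identity for smooth numbers and for the Dickman function\<close>

lemma sum_ln_quotient:
  assumes "t \<ge> 1"
  shows "(\<Sum>m=1..nat \<lfloor>t\<rfloor>. ln t - ln (real m)) \<le> t"
proof -
  define N where "N = nat \<lfloor>t\<rfloor>"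
  have N: "N \<ge> 1" "real N \<le> t" using assms by (auto simp: N_def le_nat_floor)
  have "ln (t / real N) \<le> t / real N - 1" using N assms by (intro ln_le_minus_one) auto
  then have "real N * (ln t - ln (real N)) \<le> real N * (t / real N - 1)"
    using N assms by (intro mult_left_mono) (auto simp: ln_div)
  also have "\<dots> = t - real N" using N by (simp add: field_simps)
  finally have "real N * ln t - real N * ln (real N) \<le> t - real N" by (simp add: algebra_simps)
  moreover have "(\<Sum>m=1..N. ln t - ln (real m)) = real N * ln t - (\<Sum>m=1..N. ln (real m))"
    by (simp add: sum_subtractf)
  ultimately show ?thesis using sum_ln_bounds(1)[OF N(1)] unfolding N_def[symmetric] by linarith
qed

text \<open>Evaluate the sum of ln m over smooth m in two ways. Expanding ln by \<Lambda> gives the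
  sum of \<Lambda>(d) Psi(t/d, z), whose prime d form M and whose other d add between 0 and 2t.
  Replacing ln m by ln t adds between 0 and t.\<close>

lemma Psi_log_identity:
  fixes t :: real and z :: nat
  assumes t: "t \<ge> 1"
  defines "M \<equiv> (\<Sum>p | prime p \<and> p \<le> z. ln (real p) * Psi (t / real p) z)"
  shows "0 \<le> Psi t z * ln t - M" "Psi t z * ln t - M \<le> 3 * t"
proof -
  let ?N = "nat \<lfloor>t\<rfloor>" and ?S = "smooths t z"
  have le_iff: "real m \<le> t / real d \<longleftrightarrow> real (d * m) \<le> t" if "d > 0" for d m :: nat
    using that by (simp add: field_simps)
  have Spos: "d > 0" if "d \<in> ?S" for d using that by (simp add: smooths_def smooth_def)
  have fwd: "d \<in> ?S \<and> m div d \<in> smooths (t / real d) z \<and> d * (m div d) = m" if *: "m \<in> ?S" "d dvd m" for m d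
  proof -
    obtain e where e: "m = d * e" using * by (elim dvdE)
    have pos: "d > 0" "e > 0" using Spos[OF *(1)] e by auto
    have "real d \<le> real m" using e pos by simp
    also have "\<dots> \<le> t" using * by (simp add: smooths_def)
    finally have "real d \<le> t" .
    then show ?thesis using * e pos le_iff[of d e] by (auto simp: smooths_def smooth_mult)
  qed
  have bwd: "d * m \<in> ?S \<and> d > 0" if "d \<in> ?S" "m \<in> smooths (t / real d) z" for d m
    using that Spos[of d] le_iff[of d m] by (auto simp: smooths_def smooth_mult)
  have "(\<Sum>m\<in>?S. ln (real m)) = (\<Sum>m\<in>?S. \<Sum>d | d dvd m. \<Lambda> d)"
    using mangoldt_sum[where 'a = real] Spos by (intro sum.cong refl) auto
  also have "\<dots> = (\<Sum>(m,d)\<in>Sigma ?S (\<lambda>m. {d. d dvd m}). \<Lambda> d)"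
    using Spos by (intro sum.Sigma) auto
  also have "\<dots> = (\<Sum>(d,m)\<in>Sigma ?S (\<lambda>d. smooths (t / real d) z). \<Lambda> d)"
    by (rule sum.reindex_bij_witness[where j = "\<lambda>(m,d). (d, m div d)" and i = "\<lambda>(d,m). (d * m, d)"])
       (use fwd bwd in auto)
  also have "\<dots> = (\<Sum>d\<in>?S. \<Lambda> d * Psi (t / real d) z)"
    by (subst sum.Sigma[symmetric]) (auto simp: Psi_def mult.commute)
  also have "\<dots> = (\<Sum>d\<in>{d\<in>?S. prime d}. \<Lambda> d * Psi (t / real d) z) + (\<Sum>d\<in>{d\<in>?S. \<not> prime d}. \<Lambda> d * Psi (t / real d) z)"
    by (subst sum.union_disjoint[symmetric]) (auto intro!: sum.cong)
  also have "(\<Sum>d\<in>{d\<in>?S. prime d}. \<Lambda> d * Psi (t / real d) z) = M"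
    unfolding M_def
  proof (rule sum.mono_neutral_cong_left)
    show "\<forall>p\<in>{p. prime p \<and> p \<le> z} - {d \<in> ?S. prime d}. ln (real p) * Psi (t / real p) z = 0"
    proof
      fix p assume "p \<in> {p. prime p \<and> p \<le> z} - {d \<in> ?S. prime d}"
      then have "real p > t" "p > 0" by (auto simp: smooths_def smooth_prime prime_gt_0_nat)
      then have "t / real p < 1" by (simp add: field_simps)
      then show "ln (real p) * Psi (t / real p) z = 0" by (simp add: Psi_eq_0)
    qed
  qed (auto simp: smooths_def smooth_prime)
  finally have eq: "(\<Sum>m\<in>?S. ln (real m)) = M + (\<Sum>d\<in>{d\<in>?S. \<not> prime d}. \<Lambda> d * Psi (t / real d) z)" .
  have nn: "0 \<le> (\<Sum>d\<in>{d\<in>?S. \<not> prime d}. \<Lambda> d * Psi (t / real d) z)"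
    by (intro sum_nonneg mult_nonneg_nonneg mangoldt_nonneg) auto
  have "(\<Sum>d\<in>{d\<in>?S. \<not> prime d}. \<Lambda> d * Psi (t / real d) z) \<le> (\<Sum>d\<in>{d\<in>?S. \<not> prime d}. t * (\<Lambda> d / real d))"
  proof (rule sum_mono)
    fix d
    have "\<Lambda> d * Psi (t / real d) z \<le> \<Lambda> d * (t / real d)"
      using t by (intro mult_left_mono Psi_le mangoldt_nonneg) auto
    then show "\<Lambda> d * Psi (t / real d) z \<le> t * (\<Lambda> d / real d)" by (simp add: mult.commute)
  qed
  also have "\<dots> \<le> (\<Sum>d | d \<in> {1..?N} \<and> \<not> prime d. t * (\<Lambda> d / real d))"
    using smooths_subset[of t z] t
    by (intro sum_mono2) (auto intro!: mult_nonneg_nonneg divide_nonneg_nonneg mangoldt_nonneg)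
  also have "\<dots> = t * (\<Sum>d | d \<in> {1..?N} \<and> \<not> prime d. \<Lambda> d / real d)" by (simp add: sum_distrib_left)
  also have "\<dots> \<le> t * 2" using t by (intro mult_left_mono sum_nonprime_mangoldt) auto
  finally have le2: "(\<Sum>d\<in>{d\<in>?S. \<not> prime d}. \<Lambda> d * Psi (t / real d) z) \<le> 2 * t" by simp
  have diff: "Psi t z * ln t - (\<Sum>m\<in>?S. ln (real m)) = (\<Sum>m\<in>?S. ln t - ln (real m))"
    by (simp add: sum_subtractf Psi_def)
  have ge0: "0 \<le> ln t - ln (real m)" if "m \<in> {1..?N}" for m
  proof -
    from that have "int m \<le> \<lfloor>t\<rfloor>" by auto
    then have "real m \<le> t" by linarith
    then show ?thesis using that by (simp add: ln_mono)
  qed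
  have "0 \<le> (\<Sum>m\<in>?S. ln t - ln (real m))" using ge0 smooths_subset[of t z] by (intro sum_nonneg) auto
  moreover have "(\<Sum>m\<in>?S. ln t - ln (real m)) \<le> (\<Sum>m=1..?N. ln t - ln (real m))"
    using ge0 smooths_subset[of t z] by (intro sum_mono2) auto
  ultimately show "0 \<le> Psi t z * ln t - M" "Psi t z * ln t - M \<le> 3 * t"
    using eq nn le2 diff sum_ln_quotient[OF t] by linarith+
qed

text \<open>By Mertens' theorem the sum is a Riemann sum for ln z times the integral of rho over
  [u - 1, u], with u = ln t / ln z, and \<open>rho_int_identity\<close> evaluates this as ln t
  rho(u). Partial summation costs 40 and the Riemann sum 1.\<close>

lemma plog_rho_sum:
  assumes z: "z \<ge> 2" and t: "t \<ge> real z"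
  shows "\<bar>(\<Sum>n=Suc 1..z. plog n * rho (ln (t / real n) / ln (real z))) - ln t * rho (ln t / ln (real z))\<bar> \<le> 41"
proof -
  define L where "L = ln (real z)"
  define u where "u = ln t / L"
  define a where "a = (\<lambda>n. u - ln (real n) / L)"
  have L: "L > 0" using z by (simp add: L_def)
  have tpos: "t > 0" "t \<ge> 2" using t z by auto
  have u: "u \<ge> 1" using L t z ln_mono[of "real z" t] by (simp add: u_def L_def field_simps)
  have aeq: "ln (t / real n) / ln (real z) = a n" if "n \<ge> 1" for n
    using that tpos L by (simp add: a_def u_def ln_div L_def diff_divide_distrib)
  have a1: "a 1 = u" "a z = u - 1" using L by (simp_all add: a_def L_def)
  have amono: "a n \<le> a (n - 1)" and adiff: "L * (a (n - 1) - a n) = ln (real n) - ln (real (n - 1))" if "n > 1" for n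
    using L that by (auto simp: a_def field_simps)
  have a0: "0 \<le> a n" if "n \<le> z" "n \<ge> 1" for n
  proof -
    have "ln (real n) \<le> L" unfolding L_def using that by (intro ln_mono) auto
    then have "ln (real n) / L \<le> 1" using L by simp
    then show ?thesis using u by (simp add: a_def)
  qed
  define R where "R = (\<lambda>n. rho (a n))"
  define D where "D = (\<Sum>n=Suc 1..z. (ln (real n) - ln (real (n - 1))) * R n)"
  have "norm (\<Sum>n=Suc 1..z. R n *\<^sub>R (plog n - (ln (real n) - ln (real (n - 1))))) \<le> 2 * 20 * 1"
  proof (rule abel_mono)
    show "R i \<le> R (Suc i)" if "Suc 1 \<le> i" for i
      using amono[of "Suc i"] that by (auto simp: R_def intro!: rho_antimono)
    show "norm (\<Sum>i = Suc 1..k. plog i - (ln (real i) - ln (real (i - 1)))) \<le> 20" if "Suc 1 \<le> k" for k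
      using plog_deviation[of 1 k] that by simp
  qed (use z in \<open>auto simp: R_def rho_nonneg rho_le_1\<close>)
  then have 1: "\<bar>(\<Sum>n=Suc 1..z. plog n * R n) - D\<bar> \<le> 40"
    by (simp add: D_def algebra_simps sum_subtractf sum.distrib)
  have "L * (rho_int u - rho_int (u - 1)) = L * (u * rho u)" using rho_int_identity[OF u] by simp
  then have main: "L * (rho_int u - rho_int (u - 1)) = ln t * rho u" using L by (simp add: u_def)
  have tele: "(\<Sum>n=Suc 1..z. - rho_int (a n) - (- rho_int (a (n - 1)))) = rho_int u - rho_int (u - 1)"
    using telescope_eq[of 1 z "\<lambda>n. - rho_int (a n)"] z a1 by simp
  have "ln t * rho u = (\<Sum>n=Suc 1..z. L * (rho_int (a (n - 1)) - rho_int (a n)))"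
    unfolding main[symmetric] tele[symmetric] by (simp add: sum_distrib_left right_diff_distrib sum_subtractf)
  also have "\<dots> \<le> D" unfolding D_def
  proof (rule sum_mono)
    fix n assume n: "n \<in> {Suc 1..z}"
    have "L * (rho_int (a (n - 1)) - rho_int (a n)) \<le> L * (rho (a n) * (a (n - 1) - a n))"
      using L n a0[of n] amono[of n] by (intro mult_left_mono rho_int_bounds) auto
    also have "\<dots> = (L * (a (n - 1) - a n)) * R n" by (simp add: R_def)
    also have "\<dots> = (ln (real n) - ln (real (n - 1))) * R n" using n by (subst adiff) auto
    finally show "L * (rho_int (a (n - 1)) - rho_int (a n)) \<le> (ln (real n) - ln (real (n - 1))) * R n" .
  qed
  finally have 2: "ln t * rho u \<le> D" .
  have "D - ln t * rho u = (\<Sum>n=Suc 1..z. (ln (real n) - ln (real (n - 1))) * R n - L * (rho_int (a (n - 1)) - rho_int (a n)))"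
    unfolding main[symmetric] tele[symmetric] D_def by (simp add: sum_distrib_left right_diff_distrib sum_subtractf)
  \<comment> \<open>The mesh ln n - ln (n - 1) is at most 1 and R is increasing, so the excess of
    the upper Riemann sum over the integral telescopes.\<close>
  also have "\<dots> \<le> R z - R 1"
  proof (rule telescope_le)
    fix n assume n: "1 < n" "n \<le> z"
    have "L * (rho_int (a (n - 1)) - rho_int (a n)) \<ge> L * (rho (a (n - 1)) * (a (n - 1) - a n))"
      using L n a0[of n] amono[of n] by (intro mult_left_mono rho_int_bounds) auto
    also have "L * (rho (a (n - 1)) * (a (n - 1) - a n)) = (L * (a (n - 1) - a n)) * R (n - 1)"
      by (simp add: R_def)
    also have "\<dots> = (ln (real n) - ln (real (n - 1))) * R (n - 1)" using n by (subst adiff) auto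
    finally have "(ln (real n) - ln (real (n - 1))) * R n - L * (rho_int (a (n - 1)) - rho_int (a n)) \<le>
       (ln (real n) - ln (real (n - 1))) * (R n - R (n - 1))" by (simp add: algebra_simps)
    also have "\<dots> \<le> 1 * (R n - R (n - 1))"
    proof (rule mult_right_mono)
      show "0 \<le> R n - R (n - 1)" using amono[of n] n by (auto simp: R_def intro!: rho_antimono)
      have "ln (real (n - 1) + 1) - ln (real (n - 1)) \<le> 1 / real (n - 1)"
        using n by (intro ln_diff_bounds(2)) auto
      also have "\<dots> \<le> 1" using n by simp
      finally show "ln (real n) - ln (real (n - 1)) \<le> 1" using n by (simp add: of_nat_diff)
    qed
    finally show "(ln (real n) - ln (real (n - 1))) * R n - L * (rho_int (a (n - 1)) - rho_int (a n)) \<le> R n - R (n - 1)"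
      by simp
  qed (use z in auto)
  also have "\<dots> \<le> 1" using rho_le_1[of "a z"] rho_nonneg[of "a 1"] by (simp add: R_def)
  finally have 3: "D \<le> ln t * rho u + 1" by simp
  have "(\<Sum>n=Suc 1..z. plog n * rho (ln (t / real n) / ln (real z))) = (\<Sum>n=Suc 1..z. plog n * R n)"
    by (intro sum.cong refl) (simp add: aeq R_def)
  then show ?thesis using 1 2 3 unfolding L_def[symmetric] u_def[symmetric] by linarith
qed

section \<open>The error of the Dickman approximation\<close>

definition Psi_err :: "real \<Rightarrow> nat \<Rightarrow> real" where
  "Psi_err t z = Psi t z / t - rho (ln t / ln (real z))"

lemma Psi_err_le_1: "t \<ge> 1 \<Longrightarrow> \<bar>Psi_err t z\<bar> \<le> 1"
proof -
  assume "t \<ge> 1"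
  then have "0 \<le> Psi t z / t" "Psi t z / t \<le> 1" using Psi_le[of t z] by auto
  then show ?thesis
    using rho_le_1[of "ln t / ln (real z)"] rho_nonneg[of "ln t / ln (real z)"] unfolding Psi_err_def by linarith
qed

text \<open>In this range rho is 1 and every integer up to t is z-smooth, so only the rounding of t
  remains.\<close>

lemma Psi_err_small:
  assumes "1 \<le> t" "t \<le> real z" "z \<ge> 2" shows "\<bar>Psi_err t z\<bar> \<le> 1 / t"
proof -
  have "ln t / ln (real z) \<le> 1" using assms ln_mono[of t "real z"] by simp
  then have "rho (ln t / ln (real z)) = 1" by (rule rho_eq_1)
  moreover have "Psi t z / t \<le> 1" using Psi_le[of t z] assms by simp
  moreover have "(t - 1) / t \<le> Psi t z / t" using Psi_ge[of t z] assms by (intro divide_right_mono) auto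
  ultimately show ?thesis using assms by (simp add: Psi_err_def diff_divide_distrib)
qed

text \<open>
  \<open>Psi t z / t\<close> and \<open>rho\<close> satisfy the same averaging identity, with weights \<open>ln p / p\<close> on
  \<open>p \<le> z\<close>, up to \<open>O(1)\<close>.  Only the terms with \<open>p \<le> t / z\<close> involve the induction hypothesis; their
  total weight is about \<open>min (ln z) (ln t - ln z)\<close>, which falls short of \<open>ln t\<close> by at least \<open>ln z\<close>, and this
  gap absorbs the \<open>O(1)\<close> uniformly in \<open>t\<close>.
\<close>

theorem Psi_err_bound:
  assumes z: "z \<ge> 2" and t: "t \<ge> real z"
  shows "\<bar>Psi_err t z\<bar> \<le> 104 / ln (real z)"
\<comment> \<open>Below the threshold the claim is weaker than the trivial bound 1; above it, 10 <=
  (ln z)/2, so the constant of Mertens' theorem uses up only half of the gap ln z.\<close>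
proof (cases "ln (real z) < 20")
  case True
  have "1 \<le> 104 / ln (real z)" using True z by (simp add: field_simps)
  moreover have "\<bar>Psi_err t z\<bar> \<le> 1" using Psi_err_le_1[of t z] t z by simp
  ultimately show ?thesis by (rule order_trans[rotated])
next
  case big: False
  define L where "L = ln (real z)"
  have L: "L \<ge> 20" using big by (simp add: L_def)
  \<comment> \<open>Induction over dyadic ranges of t, as t/p <= t/2 for every prime p.\<close>
  have "\<forall>t. real z \<le> t \<and> t \<le> 2 ^ n \<longrightarrow> \<bar>Psi_err t z\<bar> \<le> 104 / L" for n
  proof (induction n)
    case 0
    then show ?case using z by auto
  next
    case (Suc n)
    show ?case
    proof (intro allI impI; elim conjE)
      fix t assume t: "real z \<le> t" "t \<le> 2 ^ Suc n"
      have t2: "t \<ge> 2" using t z by linarith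
      define Y where "Y = nat \<lfloor>t / real z\<rfloor>"
      have Y1: "Y \<ge> 1" using t z by (simp add: Y_def le_nat_floor)
      have Yle: "real Y \<le> t / real z" unfolding Y_def using t2 by (intro of_nat_floor) auto
      define K where "K = min z Y"
      have K1: "K \<ge> 1" using z Y1 by (simp add: K_def)
      have lnt: "ln t \<ge> L" unfolding L_def using t z by (intro ln_mono) auto
      have lnK: "ln (real K) \<le> ln t - L"
      proof -
        have "ln (real K) \<le> ln (t / real z)" using Yle K1 by (intro ln_mono) (auto simp: K_def)
        then show ?thesis using t2 z by (simp add: ln_div L_def)
      qed
      \<comment> \<open>For p <= Y, that is t/p >= z, the induction hypothesis applies. For the
        others only the rounding error p/t is left, and its weighted sum is at most psi(z)/t <=
        8.\<close>
      have IH: "\<bar>Psi_err (t / real p) z\<bar> \<le> (if p \<le> K then 104 / L else 0) + real p / t" if p: "p \<in> {Suc 1..z}" for p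
      proof (cases "p \<le> Y")
        case True
        then have "real p \<le> t / real z" using Yle by linarith
        then have ge: "t / real p \<ge> real z" using p z by (simp add: field_simps)
        have "t / real p \<le> t / 2" using p t2 by (intro divide_left_mono) auto
        moreover have "t / 2 \<le> 2 ^ n" using t by simp
        ultimately have "t / real p \<le> 2 ^ n" by linarith
        with ge have "\<bar>Psi_err (t / real p) z\<bar> \<le> 104 / L" using Suc by blast
        then show ?thesis using True p t2 by (auto simp: K_def intro: add_increasing2)
      next
        case False
        then have "t / real z < real p" by (simp add: Y_def) linarith
        then have "t / real p \<le> real z" using p z by (simp add: field_simps)
        moreover have "t / real p \<ge> 1" using p t by (simp add: field_simps)
        ultimately have "\<bar>Psi_err (t / real p) z\<bar> \<le> real p / t" using Psi_err_small[of "t / real p" z] z by simp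
        then show ?thesis using L by (auto intro: add_increasing)
      qed
      define M where "M = (\<Sum>p | prime p \<and> p \<le> z. ln (real p) * Psi (t / real p) z)"
      have Meq: "M / t = (\<Sum>p=Suc 1..z. plog p * (Psi (t / real p) z / (t / real p)))"
        unfolding M_def sum_divide_distrib
      proof (rule sum.mono_neutral_cong_left)
        show "{p. prime p \<and> p \<le> z} \<subseteq> {Suc 1..z}" using prime_gt_1_nat by (auto simp: Suc_le_eq)
        show "ln (real p) * Psi (t / real p) z / t = plog p * (Psi (t / real p) z / (t / real p))"
          if "p \<in> {p. prime p \<and> p \<le> z}" for p
          using that prime_gt_0_nat[of p] t2 by (simp add: plog_def field_simps)
      qed (auto simp: plog_def)
      have "\<bar>\<Sum>p=Suc 1..z. plog p * Psi_err (t / real p) z\<bar> \<le> (\<Sum>p=Suc 1..z. plog p * ((if p \<le> K then 104 / L else 0) + real p / t))"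
      proof (rule order_trans[OF sum_abs sum_mono])
        fix p assume "p \<in> {Suc 1..z}"
        then show "\<bar>plog p * Psi_err (t / real p) z\<bar> \<le> plog p * ((if p \<le> K then 104 / L else 0) + real p / t)"
          using IH plog_nonneg[of p] by (simp add: abs_mult mult_left_mono)
      qed
      also have "\<dots> = (104 / L) * (\<Sum>p=Suc 1..z. if p \<le> K then plog p else 0) + (\<Sum>p=Suc 1..z. plog p * real p) / t"
        by (simp add: sum_distrib_left sum_divide_distrib flip: sum.distrib) (auto intro!: sum.cong simp: algebra_simps)
      finally have S0: "\<bar>\<Sum>p=Suc 1..z. plog p * Psi_err (t / real p) z\<bar> \<le>
        (104 / L) * (\<Sum>p=Suc 1..z. if p \<le> K then plog p else 0) + (\<Sum>p=Suc 1..z. plog p * real p) / t" .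
      have "(\<Sum>p=Suc 1..z. plog p * real p) / t \<le> 8"
      proof -
        have "(\<Sum>p=Suc 1..z. plog p * real p) \<le> (\<Sum>p=Suc 1..z. \<Lambda> p)"
          by (rule sum_mono) (auto simp: plog_def mangoldt_nonneg)
        also have "\<dots> \<le> psi z" unfolding psi_def by (rule sum_mono2) (auto simp: mangoldt_nonneg)
        also have "\<dots> \<le> 8 * t" using chebyshev_psi[of z] t by linarith
        finally show ?thesis using t2 by (simp add: field_simps)
      qed
      moreover have "(\<Sum>p=Suc 1..z. if p \<le> K then plog p else 0) \<le> ln (real K) + 10"
      proof -
        have "(\<Sum>p=Suc 1..z. if p \<le> K then plog p else 0) = (\<Sum>p | p \<in> {Suc 1..z} \<and> p \<le> K. plog p)"
          by (subst sum.inter_filter) auto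
        also have "\<dots> \<le> (\<Sum>p=1..K. plog p)" by (rule sum_mono2) (auto simp: plog_nonneg)
        finally show ?thesis using mertens_plog[OF K1] by linarith
      qed
      then have "104 / L * (\<Sum>p=Suc 1..z. if p \<le> K then plog p else 0) \<le> 104 / L * (ln (real K) + 10)"
        using L by (intro mult_left_mono) auto
      ultimately have S: "\<bar>\<Sum>p=Suc 1..z. plog p * Psi_err (t / real p) z\<bar> \<le> 104 / L * (ln (real K) + 10) + 8"
        using S0 by linarith
      \<comment> \<open>The gap yields 104 / 2 = 52, which is the sum of the losses 8 (rounding
        terms), 3 (\<open>Psi_log_identity\<close>) and 41 (\<open>plog_rho_sum\<close>); this is
        the origin of 104.\<close>
      have "104 / L * (ln (real K) + 10) \<le> 104 / L * (ln t - L + L / 2)"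
        using L lnK by (intro mult_left_mono) auto
      also have "\<dots> = 104 / L * ln t - 52" using L by (simp add: field_simps)
      finally have S2: "\<bar>\<Sum>p=Suc 1..z. plog p * Psi_err (t / real p) z\<bar> \<le> 104 / L * ln t - 44" using S by linarith
      have "0 \<le> (Psi t z * ln t - M) / t" "(Psi t z * ln t - M) / t \<le> 3"
        using Psi_log_identity[of t z] t2 unfolding M_def by (auto simp: divide_le_eq)
      then have A: "\<bar>Psi t z / t * ln t - M / t\<bar> \<le> 3" by (simp add: diff_divide_distrib)
      have "M / t = (\<Sum>p=Suc 1..z. plog p * Psi_err (t / real p) z) + (\<Sum>p=Suc 1..z. plog p * rho (ln (t / real p) / L))"
        unfolding Meq Psi_err_def L_def by (simp add: algebra_simps flip: sum.distrib)
      then have "\<bar>Psi t z / t * ln t - ln t * rho (ln t / L)\<bar> \<le> 104 / L * ln t"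
        using A S2 plog_rho_sum[OF z t(1)] unfolding L_def[symmetric] by linarith
      then have "\<bar>Psi_err t z * ln t\<bar> \<le> 104 / L * ln t" by (simp add: Psi_err_def L_def algebra_simps)
      then have "\<bar>Psi_err t z\<bar> * ln t \<le> 104 / L * ln t" using lnt L by (simp add: abs_mult)
      then show "\<bar>Psi_err t z\<bar> \<le> 104 / L" using lnt L by (subst (asm) mult_le_cancel_right) auto
    qed
  qed
  moreover obtain n where "t < 2 ^ n" using real_arch_pow[of 2 t] by auto
  ultimately show ?thesis using t unfolding L_def by (meson less_imp_le)
qed

section \<open>Cancellation in sums over the largest prime factor\<close>

lemma smooth_times_prime_inj:
  assumes "prime p" "prime q" "smooth p a" "smooth q b" "p * a = q * b"
  shows "p = q \<and> a = b"
proof -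
  \<comment> \<open>The prime p divides q b, whose prime factors are at most q; by symmetry p =
    q.\<close>
  have le: "p \<le> q" if "prime p" "prime q" "smooth q b" "p * a = q * b" for p q a b :: nat
  proof -
    have "p dvd q * b" using that by (metis dvd_triv_left)
    then have "p dvd q \<or> p dvd b" using that prime_dvd_mult_iff by blast
    then show ?thesis using that primes_dvd_imp_eq[of p q] by (auto simp: smooth_def)
  qed
  have "p = q" using le[of p q b a] le[of q p a b] assms by simp
  then show ?thesis using assms prime_gt_0_nat[of q] by simp
qed

text \<open>Each pair (p, m) yields the y-smooth number p m, whose largest prime factor is p, so
  different pairs yield different numbers.\<close>

lemma sum_Psi_le_Psi: "(\<Sum>p | prime p \<and> p \<le> y. Psi (X / real p) p) \<le> Psi X y"
proof -
  have "(\<Sum>p | prime p \<and> p \<le> y. Psi (X / real p) p) =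
      real (card (Sigma {p. prime p \<and> p \<le> y} (\<lambda>p. smooths (X / real p) p)))"
    by (subst card_SigmaI) (auto simp: Psi_def)
  also have "card (Sigma {p. prime p \<and> p \<le> y} (\<lambda>p. smooths (X / real p) p)) =
      card ((\<lambda>(p,m). p * m) ` (Sigma {p. prime p \<and> p \<le> y} (\<lambda>p. smooths (X / real p) p)))"
    by (rule card_image[symmetric])
       (auto simp: inj_on_def smooths_def dest: smooth_times_prime_inj)
  also have "\<dots> \<le> card (smooths X y)"
  proof (rule card_mono)
    show "(\<lambda>(p,m). p * m) ` (Sigma {p. prime p \<and> p \<le> y} (\<lambda>p. smooths (X / real p) p)) \<subseteq> smooths X y"
    proof clarify
      fix p m assume *: "prime p" "p \<le> y" "m \<in> smooths (X / real p) p"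
      have "smooth y m" using * by (auto simp: smooths_def smooth_def intro: order_trans)
      moreover have "real (p * m) \<le> X" using * prime_gt_0_nat[of p] by (auto simp: smooths_def field_simps)
      ultimately show "p * m \<in> smooths X y" using * by (simp add: smooths_def smooth_mult smooth_prime)
    qed
  qed auto
  finally show ?thesis by (simp add: Psi_def)
qed

lemma ln_Suc_le_double: 
  assumes "n \<ge> 2" shows "ln (real n + 1) \<le> 2 * ln (real n)"
proof -
  have "real n + 1 \<le> 2 * real n" using assms by simp
  also have "\<dots> \<le> real n * real n" using assms by (intro mult_right_mono) auto
  finally have "ln (real n + 1) \<le> ln (real n * real n)" using assms by (intro ln_mono) auto
  then show ?thesis using assms by (simp add: ln_mult)
qed

text \<open>The cutoff \<open>w\<close> is arbitrary and does not enter the bound, so a single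
  estimate serves every b. Only boundedness of \<open>c\<close> and of its Mertens sums is assumed.
  The constant collects 217 (small primes), 4000 (errors of the Dickman approximation) and 4B
  (partial summation).\<close>

lemma smooth_cancellation:
  fixes c :: "nat \<Rightarrow> real" and B X :: real and w :: nat
  assumes X: "X \<ge> 2" and c1: "\<And>n. \<bar>c n\<bar> \<le> 1" and cB: "\<And>N. \<bar>\<Sum>n=1..N. c n * plog n\<bar> \<le> B"
  shows "\<bar>\<Sum>p | prime p \<and> p \<le> w. c p * Psi (X / real p) p\<bar> \<le> (5000 + 4 * B) * X * loglog X / ln X"
proof -
  define D where "D = loglog X"
  have D1: "D \<ge> 1" using X loglog_ge_1[of X] by (simp add: D_def)
  have lnX: "ln X > 0" using X by simp
  have B0: "B \<ge> 0" using cB[of 0] by simp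
  \<comment> \<open>Balances the two losses: exp(3 - D) = e^2/(1 + ln X) for small primes, and 1/ln
    (y + 1) <= D/ln X for large ones.\<close>
  define y where "y = nat \<lfloor>exp (ln X / D)\<rfloor>"
  have y1: "y \<ge> 1" using lnX D1 by (simp add: y_def le_nat_floor)
  have yle: "real y \<le> exp (ln X / D)" unfolding y_def by (intro of_nat_floor) auto
  have lny: "ln (real y) \<le> ln X / D" using ln_mono[OF yle] y1 by simp
  have "exp (ln X / D) < real y + 1" unfolding y_def by linarith
  then have "ln (exp (ln X / D)) \<le> ln (real y + 1)" by (intro ln_mono) auto
  then have lny1: "ln X / D \<le> ln (real y + 1)" by simp
  have inv: "1 / ln (real y + 1) \<le> D / ln X"
    using divide_left_mono[OF lny1, of 1] lnX D1 y1 by (simp add: mult_pos_pos)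
  have lnXD: "ln X / D \<le> ln X" using lnX D1 by (simp add: divide_le_eq)
  have yX: "real y \<le> X" using yle lnXD X by (smt (verit) exp_ln exp_le_cancel_iff)
  define N where "N = nat \<lfloor>X\<rfloor>"
  have N: "N \<ge> 2" "real N \<le> X" "X < real N + 1" using X by (auto simp: N_def le_nat_floor)
  \<comment> \<open>For p > N the quotient X/p is below 1 and the term vanishes.\<close>
  define W where "W = min w N"
  define f where "f = (\<lambda>p. c p * Psi (X / real p) p)"
  have "(\<Sum>p | prime p \<and> p \<le> w. f p) = (\<Sum>p | prime p \<and> p \<le> W. f p)"
  proof (rule sum.mono_neutral_right)
    show "\<forall>p\<in>{p. prime p \<and> p \<le> w} - {p. prime p \<and> p \<le> W}. f p = 0"
    proof
      fix p assume p: "p \<in> {p. prime p \<and> p \<le> w} - {p. prime p \<and> p \<le> W}"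
      then have "p > N" by (auto simp: W_def)
      then have "X < real p" using N by linarith
      then have "X / real p < 1" using X by simp
      then show "f p = 0" by (simp add: f_def Psi_eq_0)
    qed
  qed (auto simp: W_def)
  also have "\<dots> = (\<Sum>p | prime p \<and> p \<le> min W y. f p) + (\<Sum>p | prime p \<and> y < p \<and> p \<le> W. f p)"
    by (subst sum.union_disjoint[symmetric]) (auto intro!: sum.cong)
  finally have split: "(\<Sum>p | prime p \<and> p \<le> w. f p) =
    (\<Sum>p | prime p \<and> p \<le> min W y. f p) + (\<Sum>p | prime p \<and> y < p \<and> p \<le> W. f p)" .
  have fle: "\<bar>f p\<bar> \<le> Psi (X / real p) p" for p
    using c1[of p] mult_right_mono[of "\<bar>c p\<bar>" 1 "Psi (X / real p) p"] by (simp add: f_def abs_mult)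
  have small: "\<bar>\<Sum>p | prime p \<and> p \<le> min W y. f p\<bar> \<le> 217 * X * D / ln X"
  \<comment> \<open>The Dickman estimate requires y >= 2; for y = 1 there are no small
    primes.\<close>
  proof (cases "y = 1")
    case True
    have "{p. prime p \<and> p \<le> min W y} = {}" using True prime_gt_1_nat by (auto simp: not_le)
    then have "(\<Sum>p | prime p \<and> p \<le> min W y. f p) = 0" by (simp only: sum.empty)
    then show ?thesis using X lnX D1 by simp
  next
    case False
    then have y2: "y \<ge> 2" using y1 by simp
    have lny0: "ln (real y) > 0" using y2 by simp
    have "\<bar>\<Sum>p | prime p \<and> p \<le> min W y. f p\<bar> \<le> (\<Sum>p | prime p \<and> p \<le> min W y. Psi (X / real p) p)"
      by (rule order_trans[OF sum_abs sum_mono]) (rule fle)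
    also have "\<dots> \<le> (\<Sum>p | prime p \<and> p \<le> y. Psi (X / real p) p)" by (rule sum_mono2) auto
    also have "\<dots> \<le> Psi X y" by (rule sum_Psi_le_Psi)
    also have "\<dots> = X * (Psi_err X y + rho (ln X / ln (real y)))" using X by (simp add: Psi_err_def)
    also have "\<dots> \<le> X * (208 * D / ln X + 9 * D / ln X)"
    proof (intro mult_left_mono add_mono)
      have "ln X / D \<le> 2 * ln (real y)" using lny1 ln_Suc_le_double[OF y2] by linarith
      then have "ln X \<le> 2 * ln (real y) * D" using D1 by (simp add: field_simps)
      then have "104 / ln (real y) \<le> 208 * D / ln X" using lnX lny0 by (simp add: field_simps)
      then show "Psi_err X y \<le> 208 * D / ln X" using Psi_err_bound[OF y2 yX] by linarith
      \<comment> \<open>The smoothness parameter of the small-prime part is at least D, and the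
        shifts in \<open>loglog\<close> make exp(3 - D) equal to e^2/(1 + ln X).\<close>
      have "D \<le> ln X / ln (real y)" using lny lny0 D1 by (simp add: field_simps)
      then have "rho (ln X / ln (real y)) \<le> rho D" by (rule rho_antimono)
      also have "\<dots> \<le> exp (3 - D)" by (rule rho_decay)
      also have "\<dots> = exp 1 * exp 1 / (1 + ln X)"
        using lnX by (simp add: D_def loglog_def exp_diff flip: exp_add)
      also have "\<dots> \<le> 3 * 3 / (1 + ln X)"
        using exp_le lnX by (intro divide_right_mono mult_mono) auto
      also have "\<dots> \<le> 9 * D / ln X" using lnX D1 by (intro frac_le) auto
      finally show "rho (ln X / ln (real y)) \<le> 9 * D / ln X" .
    qed (use X in auto)
    also have "\<dots> = 217 * X * D / ln X" using lnX by (simp add: field_simps)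
    finally show ?thesis .
  qed
  have large: "\<bar>\<Sum>p | prime p \<and> y < p \<and> p \<le> W. f p\<bar> \<le> (4000 + 4 * B) * X * D / ln X"
  proof (cases "y < W")
    case False
    then have "{p. prime p \<and> y < p \<and> p \<le> W} = {}" by auto
    then have "(\<Sum>p | prime p \<and> y < p \<and> p \<le> W. f p) = 0" by (simp only: sum.empty)
    then show ?thesis using X lnX D1 B0 by simp
  next
    case yW: True
    define r where "r = (\<lambda>p. rho (ln (X / real p) / ln (real p)))"
    define P where "P = {p. prime p \<and> y < p \<and> p \<le> W}"
    have P: "prime p" "real p \<ge> 2" "real p \<le> X" "y < p" "p \<le> W" if "p \<in> P" for p
      using that N prime_ge_2_nat[of p] by (auto simp: P_def W_def)
    \<comment> \<open>The factor 1/p of the main term is written as plog p / ln p, so that the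
      weights of Mertens' theorem appear.\<close>
    have fdec: "f p = X * (r p * (1 / ln (real p) * (c p * plog p))) + c p * (X / real p) * Psi_err (X / real p) p"
      if "p \<in> P" for p
      using P[OF that] by (simp add: f_def Psi_err_def r_def plog_def field_simps)
    have "(\<Sum>p\<in>P. f p) = X * (\<Sum>p\<in>P. r p * (1 / ln (real p) * (c p * plog p))) + (\<Sum>p\<in>P. c p * (X / real p) * Psi_err (X / real p) p)"
      unfolding sum_distrib_left sum.distrib[symmetric] using fdec by (intro sum.cong) auto
    moreover have "\<bar>\<Sum>p\<in>P. c p * (X / real p) * Psi_err (X / real p) p\<bar> \<le> 4000 * X * D / ln X"
    proof -
      have "\<bar>\<Sum>p\<in>P. c p * (X / real p) * Psi_err (X / real p) p\<bar> \<le> (\<Sum>p\<in>P. 104 * X * (plog p / (ln (real p))\<^sup>2) + 1)"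
      proof (rule order_trans[OF sum_abs sum_mono])
        fix p assume "p \<in> P"
        note p = P[OF this]
        have lnp: "ln (real p) > 0" using p by simp
        \<comment> \<open>Which bound holds depends on whether X/p >= p. After multiplication by X/p
          the rounding part p/X is 1 per prime, so it only counts the primes up to X.\<close>
        have "\<bar>Psi_err (X / real p) p\<bar> \<le> 104 / ln (real p) + real p / X"
        proof (cases "X / real p \<ge> real p")
          case True
          then show ?thesis using Psi_err_bound[of p "X / real p"] p X by (intro add_increasing2) auto
        next
          case False
          then have "\<bar>Psi_err (X / real p) p\<bar> \<le> 1 / (X / real p)"
            using p by (intro Psi_err_small) auto
          then show ?thesis using lnp by (intro add_increasing) auto
        qed
        then have "\<bar>c p\<bar> * (X / real p) * \<bar>Psi_err (X / real p) p\<bar> \<le> 1 * (X / real p) * (104 / ln (real p) + real p / X)"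
          using c1[of p] X by (intro mult_mono) auto
        also have "\<dots> = 104 * X * (plog p / (ln (real p))\<^sup>2) + 1"
          using p X lnp by (simp add: plog_def power2_eq_square field_simps)
        finally show "\<bar>c p * (X / real p) * Psi_err (X / real p) p\<bar> \<le> 104 * X * (plog p / (ln (real p))\<^sup>2) + 1"
          using X by (simp add: abs_mult)
      qed
      also have "\<dots> = 104 * X * (\<Sum>p\<in>P. plog p / (ln (real p))\<^sup>2) + real (card P)"
        by (simp add: sum.distrib sum_distrib_left)
      also have "\<dots> \<le> 104 * X * (34 * D / ln X) + 320 * X * D / ln X"
      proof (intro add_mono mult_left_mono)
        have "(\<Sum>p\<in>P. plog p / (ln (real p))\<^sup>2) \<le> (\<Sum>p=Suc y..W. plog p / (ln (real p))\<^sup>2)"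
          by (intro sum_mono2) (auto simp: P_def plog_nonneg)
        also have "\<dots> \<le> 34 / ln (real y + 1)" by (rule sum_prime_recip_ln_tail[OF y1 yW])
        also have "\<dots> \<le> 34 * D / ln X" using inv by simp
        finally show "(\<Sum>p\<in>P. plog p / (ln (real p))\<^sup>2) \<le> 34 * D / ln X" .
        have "card P \<le> card {q. primepow q \<and> q \<le> N}" by (intro card_mono) (auto simp: P_def W_def)
        then have "real (card P) * ln (real N) \<le> real (card {q. primepow q \<and> q \<le> N}) * ln (real N)"
          using N by (intro mult_right_mono) auto
        also have "\<dots> \<le> 160 * real N" using N by (intro card_primepow_le) auto
        also have "\<dots> \<le> 160 * X" using N by simp
        finally have 1: "real (card P) * ln (real N) \<le> 160 * X" .
        have "ln X \<le> ln (real N + 1)" using N X by (intro ln_mono) auto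
        also have "\<dots> \<le> 2 * ln (real N)" by (rule ln_Suc_le_double[OF N(1)])
        finally have "real (card P) * ln X \<le> real (card P) * (2 * ln (real N))" by (intro mult_left_mono) auto
        also have "\<dots> \<le> 320 * X" using 1 by simp
        also have "\<dots> \<le> 320 * X * D" using D1 X by (simp add: mult_le_cancel_left1)
        finally show "real (card P) \<le> 320 * X * D / ln X" using lnX by (simp add: field_simps)
      qed (use X in auto)
      also have "\<dots> \<le> 4000 * X * D / ln X" using X D1 lnX by (simp add: field_simps)
      finally show ?thesis .
    qed
    moreover have "\<bar>X * (\<Sum>p\<in>P. r p * (1 / ln (real p) * (c p * plog p)))\<bar> \<le> 4 * B * X * D / ln X"
    proof -
      \<comment> \<open>Abel summation is applied twice: with the decreasing weight 1/ln p, then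
        with the increasing weight r p <= 1. The bounds are 2B, 2B/ln (y + 1) and 4B/ln (y +
        1).\<close>
      have U: "norm (\<Sum>i=Suc y..k. c i * plog i) \<le> 2 * B" if "Suc y \<le> k" for k
      proof -
        have "(\<Sum>i=1..k. c i * plog i) = (\<Sum>i=1..y. c i * plog i) + (\<Sum>i=Suc y..k. c i * plog i)"
          using that sum.ub_add_nat[of 1 y "\<lambda>i. c i * plog i" "k - y"] by simp
        then show ?thesis using cB[of k] cB[of y] by simp
      qed
      have V: "norm (\<Sum>i=Suc y..k. (1 / ln (real i)) *\<^sub>R (c i * plog i)) \<le> 2 * B * (1 / ln (real (Suc y)))"
        if "Suc y \<le> k" for k
        using that U y1 by (intro abel_antimono) (auto intro!: divide_left_mono)
      have "norm (\<Sum>i=Suc y..W. r i *\<^sub>R ((1 / ln (real i)) *\<^sub>R (c i * plog i))) \<le> 2 * (2 * B * (1 / ln (real (Suc y)))) * 1"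
      proof (rule abel_mono)
        fix i assume i: "Suc y \<le> i" "i < W"
        then have i2: "real i \<ge> 2" "i > 0" using y1 by auto
        have "ln (real i) \<le> ln (real (Suc i))" "ln (real i) > 0" using i2 by auto
        \<comment> \<open>Here ln (X/i)/ln i = ln X / ln i - 1 decreases in i, so composition with
          the decreasing rho is increasing.\<close>
        then have "ln X / ln (real (Suc i)) \<le> ln X / ln (real i)"
            using lnX by (intro divide_left_mono mult_pos_pos) linarith+
        then show "r i \<le> r (Suc i)" unfolding r_def
          using i2 X by (intro rho_antimono) (simp add: ln_div diff_divide_distrib)
      qed (use V yW in \<open>auto simp: r_def rho_nonneg rho_le_1\<close>)
      then have "\<bar>\<Sum>i=Suc y..W. r i * (1 / ln (real i) * (c i * plog i))\<bar> \<le> 4 * B * (1 / ln (real y + 1))"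
        by (simp add: add.commute)
      also have "(\<Sum>i=Suc y..W. r i * (1 / ln (real i) * (c i * plog i))) = (\<Sum>p\<in>P. r p * (1 / ln (real p) * (c p * plog p)))"
        by (rule sum.mono_neutral_right) (auto simp: P_def plog_def)
      finally have "X * \<bar>\<Sum>p\<in>P. r p * (1 / ln (real p) * (c p * plog p))\<bar> \<le> X * (4 * B * (1 / ln (real y + 1)))"
        using X by (intro mult_left_mono) auto
      also have "\<dots> \<le> X * (4 * B * (D / ln X))" using inv B0 X by (intro mult_left_mono) auto
      finally show ?thesis using X by (simp add: abs_mult mult_ac)
    qed
    ultimately have "\<bar>\<Sum>p\<in>P. f p\<bar> \<le> 4 * B * X * D / ln X + 4000 * X * D / ln X" by linarith
    also have "\<dots> = (4000 + 4 * B) * X * D / ln X" by (simp add: field_simps flip: add_divide_distrib)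
    finally show ?thesis by (simp add: P_def)
  qed
  have "\<bar>\<Sum>p | prime p \<and> p \<le> w. f p\<bar> \<le> 217 * X * D / ln X + (4000 + 4 * B) * X * D / ln X"
    using split small large by linarith
  also have "\<dots> = (4217 + 4 * B) * (X * D / ln X)" by (simp add: algebra_simps flip: add_divide_distrib)
  also have "\<dots> \<le> (5000 + 4 * B) * (X * D / ln X)" using X D1 lnX by (intro mult_right_mono) auto
  finally show ?thesis by (simp add: f_def D_def mult.assoc)
qed

section \<open>Numbers with a given number of prime factors\<close>

text \<open>The entries before index k - 1 of the decreasing list are exactly the elements larger
  than q. This replaces the list encoding by a count of larger elements.\<close>

lemma desc_list_nth:
  fixes A :: "nat set"
  assumes "finite A" "k \<ge> 1" "k \<le> card A"
  defines "q \<equiv> rev (sorted_list_of_set A) ! (k - 1)"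
  shows "q \<in> A" "card {a \<in> A. q < a} = k - 1"
proof -
  define ys where "ys = rev (sorted_list_of_set A)"
  have len: "length ys = card A" and set: "set ys = A" and dist: "distinct ys"
    using assms(1) by (auto simp: ys_def)
  have desc: "sorted_wrt (>) ys"
    using strict_sorted_list_of_set[of A] by (simp add: ys_def sorted_wrt_rev)
  have gt: "ys ! i > ys ! j" if "i < j" "j < length ys" for i j
    using sorted_wrt_nth_less[OF desc that] .
  have k: "k - 1 < length ys" using assms len by simp
  show "q \<in> A" using nth_mem[OF k] by (simp add: q_def ys_def[symmetric] set)
  have "{a \<in> A. q < a} = (\<lambda>i. ys ! i) ` {..<k - 1}"
  proof (intro equalityI subsetI)
    fix a assume "a \<in> {a \<in> A. q < a}"
    then obtain i where i: "i < length ys" "a = ys ! i" "q < a" using set by (auto simp: in_set_conv_nth)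
    have "i < k - 1"
    proof (rule ccontr)
      assume "\<not> i < k - 1"
      then have "i = k - 1 \<or> k - 1 < i" by linarith
      then show False using i gt[of "k - 1" i] by (auto simp: q_def ys_def[symmetric])
    qed
    then show "a \<in> (\<lambda>i. ys ! i) ` {..<k - 1}" using i by auto
  next
    fix a assume "a \<in> (\<lambda>i. ys ! i) ` {..<k - 1}"
    then obtain i where i: "i < k - 1" "a = ys ! i" by auto
    then have "ys ! i \<in> set ys" using k by (intro nth_mem) linarith
    then show "a \<in> {a \<in> A. q < a}" using i gt[OF i(1) k] set by (simp add: q_def ys_def[symmetric])
  qed
  moreover have "inj_on (\<lambda>i. ys ! i) {..<k - 1}" using dist k by (auto simp: inj_on_def nth_eq_iff_index_eq)
  ultimately show "card {a \<in> A. q < a} = k - 1" by (simp add: card_image)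
qed

lemma kth_prime_factor_props:
  assumes "k \<ge> 1" "k \<le> card (prime_factors n)"
  shows "kth_prime_factor k n \<in> prime_factors n"
    "card {q \<in> prime_factors n. kth_prime_factor k n < q} = k - 1"
  using desc_list_nth[of "prime_factors n" k] assms
  by (simp_all add: kth_prime_factor_def distinct_prime_factors_desc_def)

text \<open>The number of larger prime factors strictly decreases along the prime factors of n, so
  the value k - 1 singles out one of them.\<close>

lemma kth_prime_factor_eqI:
  assumes "k \<ge> 1" "p \<in> prime_factors n" "card {q \<in> prime_factors n. p < q} = k - 1"
  shows "k \<le> card (prime_factors n)" "kth_prime_factor k n = p"
proof -
  have "card (insert p {q \<in> prime_factors n. p < q}) \<le> card (prime_factors n)"
    using assms by (intro card_mono) auto
  then show k: "k \<le> card (prime_factors n)" using assms by simp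
  have less: "card {q \<in> prime_factors n. b < q} < card {q \<in> prime_factors n. a < q}"
    if "a < b" "b \<in> prime_factors n" for a b
    using that by (intro psubset_card_mono) auto
  show "kth_prime_factor k n = p"
    using less[of p "kth_prime_factor k n"] less[of "kth_prime_factor k n" p]
      kth_prime_factor_props[OF assms(1) k] assms(2,3) by (cases "kth_prime_factor k n" p rule: linorder_cases) auto
qed

text \<open>Peel off one prime at a time; it joins the factor \<open>s\<close> if it is at most z,
  and \<open>b\<close> otherwise.\<close>

lemma rough_smooth_decomposition:
  assumes "n > (0::nat)"
  shows "\<exists>b s. n = b * s \<and> b > 0 \<and> (\<forall>q\<in>prime_factors b. z < q) \<and> smooth z s"
  using assms
proof (induction n rule: less_induct)
  case (less n)
  show ?case
  proof (cases "n = 1")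
    case True
    then show ?thesis by (intro exI[of _ 1] conjI) (simp_all add: smooth_def)
  next
    case False
    then obtain p where p: "prime p" "p dvd n" using prime_factor_nat by blast
    then obtain m where m: "n = p * m" by (elim dvdE)
    have "m > 0" "m < n" using m less.prems prime_gt_1_nat[OF p(1)] by auto
    then obtain b s where bs: "m = b * s" "b > 0" "\<forall>q\<in>prime_factors b. z < q" "smooth z s" using less.IH by blast
    show ?thesis
    proof (cases "p \<le> z")
      case True
      then show ?thesis using bs m p
        by (intro exI[of _ b] exI[of _ "p * s"] conjI) (simp_all add: smooth_mult smooth_prime mult.left_commute)
    next
      case False
      have "prime_factors (p * b) = insert p (prime_factors b)"
        using p bs by (simp add: prime_factors_product prime_prime_factors)
      then have "\<forall>q\<in>prime_factors (p * b). z < q" using bs False by simp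
      then show ?thesis using bs m prime_gt_0_nat[OF p(1)]
        by (intro exI[of _ "p * b"] exI[of _ s] conjI) (simp_all add: mult.assoc)
    qed
  qed
qed

lemma rough_smooth_coprime:
  assumes "b > 0" "\<forall>q\<in>prime_factors b. z < q" "smooth z s"
  shows "coprime b s"
proof (rule ccontr)
  assume "\<not> coprime b s"
  then have "gcd b s \<noteq> 1" by (simp only: coprime_iff_gcd_eq_1 not_False_eq_True)
  then obtain q where "prime q" "q dvd gcd b s" using prime_factor_nat by blast
  then have q: "prime q" "q dvd b" "q dvd s" by auto
  then have "q \<in> prime_factors b" using assms(1) by (simp add: prime_factors_dvd)
  then have "z < q" using assms(2) by blast
  moreover have "q \<le> z" using q assms(3) by (simp add: smooth_def)
  ultimately show False by simp
qed

section \<open>Counting by the number of distinct prime factors\<close>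

definition omega_eq :: "nat \<Rightarrow> real \<Rightarrow> nat set" where
  "omega_eq j x = {b. b > 0 \<and> card (prime_factors b) = j \<and> real b \<le> x}"

lemma finite_omega_eq [simp]: "finite (omega_eq j x)"
  by (rule finite_subset[of _ "{..nat \<lfloor>x\<rfloor>}"]) (auto simp: omega_eq_def le_nat_floor)

lemma omega_eq_0: "x \<ge> 1 \<Longrightarrow> omega_eq 0 x = {1}"
proof -
  assume "x \<ge> 1"
  have "b = 1" if "b > 0" "prime_factors b = {}" for b :: nat
    using that prime_factor_nat[of b] by (auto simp: prime_factors_dvd)
  then show ?thesis using \<open>x \<ge> 1\<close> by (auto simp: omega_eq_def)
qed

text \<open>Splitting off the full power p^e of one prime lowers the number of distinct primes by
  exactly one, hence prime powers rather than primes. As p^e >= 2, the cofactor is at most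
  x/2.\<close>

lemma omega_eq_Suc_subset:
  "omega_eq (Suc j) x \<subseteq> (\<lambda>(b,q). b * q) ` Sigma (omega_eq j (x / 2)) (\<lambda>b. {q. primepow q \<and> real q \<le> x / real b})"
proof
  fix n assume n: "n \<in> omega_eq (Suc j) x"
  then have n0: "n > 0" "real n \<le> x" by (auto simp: omega_eq_def)
  have "prime_factors n \<noteq> {}" using n by (auto simp: omega_eq_def)
  then obtain p where p: "p \<in> prime_factors n" by blast
  then have pp: "prime p" "p dvd n" by auto
  obtain b where b: "n = p ^ multiplicity p n * b" "\<not> p dvd b"
    using multiplicity_decompose'[of n p] n0 pp prime_gt_1_nat[OF pp(1)] by (metis dvd_1_iff_1 less_not_refl nat_dvd_1_iff_1 not_gr0)
  define e where "e = multiplicity p n"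
  have e: "e > 0" using pp n0 by (simp add: e_def prime_multiplicity_gt_zero_iff)
  have b0: "b > 0" using b n0 by (auto intro: Nat.gr0I)
  have "prime_factors n = prime_factors (p ^ e) \<union> prime_factors b"
    using b b0 pp prime_gt_0_nat[of p] by (subst b(1), subst prime_factors_product) (auto simp: e_def)
  also have "prime_factors (p ^ e) = {p}" using pp e by (simp add: prime_factors_power prime_prime_factors)
  finally have "prime_factors n = insert p (prime_factors b)" by simp
  moreover have "p \<notin> prime_factors b" using b(2) by auto
  ultimately have "card (prime_factors n) = Suc (card (prime_factors b))" by simp
  then have cb: "card (prime_factors b) = j" using n by (simp add: omega_eq_def)
  have p2: "p ^ e \<ge> 2" using prime_ge_2_nat[OF pp(1)] self_le_power[of p e] e by linarith
  have "real n = real (p ^ e * b)" unfolding e_def using b(1) by (rule arg_cong)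
  then have nb: "real n = real b * real (p ^ e)" by (simp add: mult.commute)
  have "real b * 2 \<le> real b * real (p ^ e)" using p2 by (intro mult_left_mono) (metis of_nat_le_iff of_nat_numeral, simp)
  then have "real b \<le> x / 2" using nb n0 by simp
  moreover have "real (p ^ e) \<le> x / real b" using nb n0 b0 by (simp add: field_simps)
  ultimately show "n \<in> (\<lambda>(b,q). b * q) ` Sigma (omega_eq j (x / 2)) (\<lambda>b. {q. primepow q \<and> real q \<le> x / real b})"
    using b0 cb pp e nb by (intro image_eqI[of _ _ "(b, p ^ e)"]) (auto simp: omega_eq_def simp flip: of_nat_mult of_nat_power)
qed

lemma finite_primepow_real [simp]: "finite {q. primepow q \<and> real q \<le> x}"
  by (rule finite_subset[of _ "{..nat \<lfloor>x\<rfloor>}"]) (auto simp: le_nat_floor)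

text \<open>The weight is what a bound (x/b)/ln (x/b) leaves after x is taken out; b <= x/2 keeps
  the logarithm at least ln 2.\<close>

definition omega_sum :: "nat \<Rightarrow> real \<Rightarrow> real" where
  "omega_sum j x = (\<Sum>b\<in>omega_eq j (x / 2). 1 / (real b * ln (x / real b)))"

lemma omega_eq_half:
  assumes "b \<in> omega_eq j (x / 2)" shows "x / real b \<ge> 2" "real b \<ge> 1" "x / real b \<le> x" "real b \<le> x"
proof -
  show 1: "x / real b \<ge> 2" "real b \<ge> 1" using assms by (auto simp: omega_eq_def field_simps)
  have "real b \<le> x / 2" using assms by (simp add: omega_eq_def)
  then show "real b \<le> x" using 1 by linarith
  then have "0 \<le> x" by linarith
  then show "x / real b \<le> x" using divide_left_mono[of 1 "real b" x] 1 by simp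
qed

text \<open>Write the next b as b q with a prime power q. At X = x/b,
  \<open>sum_primepow_recip_ln\<close> sums over q and returns the same weight 1/(b ln (x/b)), so
  each step costs just one factor 2000 loglog x.\<close>

lemma omega_sum_bound:
  assumes "x \<ge> 2" shows "omega_sum j x \<le> (2000 * loglog x) ^ j / ln x"
proof (induction j)
  case 0
  then show ?case using assms by (simp add: omega_sum_def omega_eq_0)
next
  case (Suc j)
  let ?S = "Sigma (omega_eq j (x / 2)) (\<lambda>b. {q. primepow q \<and> real q \<le> x / real b / 2})"
  let ?h = "\<lambda>n. 1 / (real n * ln (x / real n))"
  have LL: "loglog x \<ge> 1" using assms by (intro loglog_ge_1) auto
  have hpos: "?h (b * q) \<ge> 0" if "(b, q) \<in> ?S" for b q
  proof -
    have "real b \<ge> 1" "real q > 0" "real q \<le> x / real b / 2"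
      using that omega_eq_half primepow_gt_0_nat by auto
    then have "real (b * q) \<le> x / 2" by (simp add: field_simps)
    moreover have "real (b * q) > 0" using \<open>real b \<ge> 1\<close> \<open>real q > 0\<close> by simp
    ultimately have "x / real (b * q) \<ge> 1" using assms by (simp add: le_divide_eq)
    then show ?thesis by simp
  qed
  have sub: "omega_eq (Suc j) (x / 2) \<subseteq> (\<lambda>(b,q). b * q) ` ?S"
  proof -
    have "omega_eq j (x / 2 / 2) \<subseteq> omega_eq j (x / 2)" using assms by (auto simp: omega_eq_def)
    then have "(\<lambda>(b,q). b * q) ` Sigma (omega_eq j (x / 2 / 2)) (\<lambda>b. {q. primepow q \<and> real q \<le> x / 2 / real b}) \<subseteq> (\<lambda>(b,q). b * q) ` ?S"
      by (intro image_mono Sigma_mono) (auto simp: mult.commute)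
    then show ?thesis using omega_eq_Suc_subset[of j "x / 2"] by (rule subset_trans[rotated])
  qed
  have "omega_sum (Suc j) x \<le> sum ?h ((\<lambda>(b,q). b * q) ` ?S)"
    unfolding omega_sum_def using sub hpos by (intro sum_mono2 finite_imageI finite_SigmaI) auto
  also have "\<dots> \<le> (\<Sum>(b,q)\<in>?S. ?h (b * q))"
    using sum_image_le[where f = "\<lambda>(b,q). b * q" and I = ?S and g = ?h] hpos
    by (auto simp: case_prod_unfold comp_def)
  also have "\<dots> = (\<Sum>b\<in>omega_eq j (x / 2). \<Sum>q | primepow q \<and> real q \<le> x / real b / 2. ?h (b * q))"
    by (rule sum.Sigma[symmetric]) auto
  also have "\<dots> \<le> (\<Sum>b\<in>omega_eq j (x / 2). 2000 * loglog x * (1 / (real b * ln (x / real b))))"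
  proof (rule sum_mono)
    fix b assume b: "b \<in> omega_eq j (x / 2)"
    note xb = omega_eq_half[OF b]
    have "(\<Sum>q | primepow q \<and> real q \<le> x / real b / 2. ?h (b * q)) =
        1 / real b * (\<Sum>q | primepow q \<and> real q \<le> x / real b / 2. 1 / (real q * ln (x / real b / real q)))"
      by (simp add: sum_distrib_left mult.assoc)
    also have "\<dots> \<le> 1 / real b * (2000 * loglog (x / real b) / ln (x / real b))"
      using xb by (intro mult_left_mono sum_primepow_recip_ln) auto
    also have "\<dots> \<le> 1 / real b * (2000 * loglog x / ln (x / real b))"
      using xb assms by (intro mult_left_mono divide_right_mono loglog_mono) auto
    finally show "(\<Sum>q | primepow q \<and> real q \<le> x / real b / 2. ?h (b * q)) \<le> 2000 * loglog x * (1 / (real b * ln (x / real b)))"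
      by simp
  qed
  also have "\<dots> = 2000 * loglog x * omega_sum j x" by (simp add: omega_sum_def sum_distrib_left)
  also have "\<dots> \<le> 2000 * loglog x * ((2000 * loglog x) ^ j / ln x)" using Suc LL by (intro mult_left_mono) auto
  finally show ?case by simp
qed

lemma card_primepow_real:
  assumes "X \<ge> 2" shows "real (card {q. primepow q \<and> real q \<le> X}) \<le> 320 * X / ln X"
proof -
  define N where "N = nat \<lfloor>X\<rfloor>"
  have N: "N \<ge> 2" "real N \<le> X" "X < real N + 1" using assms by (auto simp: N_def le_nat_floor)
  let ?c = "real (card {q. primepow q \<and> real q \<le> X})"
  have "{q. primepow q \<and> real q \<le> X} = {q. primepow q \<and> q \<le> N}" using N by (auto simp: N_def le_nat_floor)
  then have 1: "?c * ln (real N) \<le> 160 * real N" using card_primepow_le[of N] N by simp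
  have "ln X \<le> ln (real N + 1)" using N assms by (intro ln_mono) auto
  also have "\<dots> \<le> 2 * ln (real N)" by (rule ln_Suc_le_double[OF N(1)])
  finally have "?c * ln X \<le> ?c * (2 * ln (real N))" by (intro mult_left_mono) auto
  also have "\<dots> = 2 * (?c * ln (real N))" by simp
  also have "\<dots> \<le> 320 * X" using 1 N by linarith
  finally show ?thesis using assms by (simp add: field_simps)
qed

text \<open>A Landau-type bound: fix the cofactor b and count the last prime power by Chebyshev's
  bound. It disposes of the n with fewer than k prime factors.\<close>

lemma card_omega_eq:
  assumes "x \<ge> 2"
  shows "real (card (omega_eq (Suc j) x)) \<le> 320 * x * (2000 * loglog x) ^ j / ln x"
proof -
  let ?S = "Sigma (omega_eq j (x / 2)) (\<lambda>b. {q. primepow q \<and> real q \<le> x / real b})"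
  have "card (omega_eq (Suc j) x) \<le> card ((\<lambda>(b,q). b * q) ` ?S)"
    using omega_eq_Suc_subset by (intro card_mono finite_imageI finite_SigmaI) auto
  also have "\<dots> \<le> card ?S" by (intro card_image_le finite_SigmaI) auto
  also have "\<dots> = (\<Sum>b\<in>omega_eq j (x / 2). card {q. primepow q \<and> real q \<le> x / real b})"
    by (intro card_SigmaI) auto
  finally have "real (card (omega_eq (Suc j) x)) \<le> (\<Sum>b\<in>omega_eq j (x / 2). real (card {q. primepow q \<and> real q \<le> x / real b}))"
    by (metis of_nat_le_iff of_nat_sum)
  also have "\<dots> \<le> (\<Sum>b\<in>omega_eq j (x / 2). 320 * x * (1 / (real b * ln (x / real b))))"
  proof (rule sum_mono)
    fix b assume "b \<in> omega_eq j (x / 2)"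
    then show "real (card {q. primepow q \<and> real q \<le> x / real b}) \<le> 320 * x * (1 / (real b * ln (x / real b)))"
      using card_primepow_real[of "x / real b"] omega_eq_half by simp
  qed
  also have "\<dots> = 320 * x * omega_sum j x" by (simp add: omega_sum_def sum_distrib_left)
  also have "\<dots> \<le> 320 * x * ((2000 * loglog x) ^ j / ln x)"
    using assms by (intro mult_left_mono omega_sum_bound) auto
  finally show ?thesis by simp
qed

section \<open>The factorization n = b p m and the sum over b\<close>

lemma initial_segment:
  assumes "finite F" "\<forall>q\<in>F. q > (0::nat)"
  shows "\<exists>w. {p. p \<le> N \<and> (\<forall>q\<in>F. p < q)} = {..w}"
  using assms
proof (induction F)
  case empty
  then show ?case by auto
next
  case (insert q F)
  then obtain w where w: "{p. p \<le> N \<and> (\<forall>q\<in>F. p < q)} = {..w}" by auto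
  have "{p. p \<le> N \<and> (\<forall>q'\<in>insert q F. p < q')} = {p. p \<le> N \<and> (\<forall>q\<in>F. p < q)} \<inter> {..<q}" by auto
  also have "\<dots> = {..min w (q - 1)}" unfolding w using insert.prems by auto
  finally show ?case by blast
qed


lemma kth_prime_factor_sum:
  fixes c :: "nat \<Rightarrow> real"
  assumes k: "k \<ge> 1"
  shows "(\<Sum>n | n \<in> {1..nat \<lfloor>x\<rfloor>} \<and> k \<le> card (prime_factors n). c (kth_prime_factor k n)) =
    (\<Sum>b\<in>omega_eq (k - 1) (x / 2). \<Sum>p | prime p \<and> p \<le> nat \<lfloor>x\<rfloor> \<and> (\<forall>q\<in>prime_factors b. p < q). c p * Psi (x / real b / real p) p)"
proof -
  define P where "P = (\<lambda>b. {p. prime p \<and> p \<le> nat \<lfloor>x\<rfloor> \<and> (\<forall>q\<in>prime_factors b. p < q)})"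
  have fP: "finite (P b)" for b by (simp add: P_def)
  define T where "T = Sigma (omega_eq (k - 1) (x / 2)) (\<lambda>b. Sigma (P b) (\<lambda>p. smooths (x / real b / real p) p))"
  define A where "A = {n \<in> {1..nat \<lfloor>x\<rfloor>}. k \<le> card (prime_factors n)}"
  define \<phi> :: "nat \<times> nat \<times> nat \<Rightarrow> nat" where "\<phi> = (\<lambda>(b,p,m). b * (p * m))"
  have T: "b > 0" "card (prime_factors b) = k - 1" "prime p" "\<forall>q\<in>prime_factors b. p < q" "smooth p m" "m > 0"
      "real (b * (p * m)) \<le> x" if "(b,p,m) \<in> T" for b p m
  proof -
    show 0: "b > 0" "card (prime_factors b) = k - 1" "prime p" "\<forall>q\<in>prime_factors b. p < q" "smooth p m" "m > 0"
      using that by (auto simp: T_def P_def omega_eq_def smooths_def smooth_def)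
    have "real m \<le> x / real b / real p" using that by (auto simp: T_def smooths_def)
    then show "real (b * (p * m)) \<le> x" using 0 prime_gt_0_nat[OF 0(3)] by (simp add: field_simps)
  qed
  have kth: "kth_prime_factor k (\<phi> t) = fst (snd t) \<and> \<phi> t \<in> A" if "t \<in> T" for t
  proof -
    obtain b p m where t: "t = (b,p,m)" by (cases t)
    note * = T[OF that[unfolded t]]
    define n where "n = b * (p * m)"
    have p0: "p > 0" using * prime_gt_0_nat by blast
    have pf: "prime_factors n = prime_factors b \<union> insert p (prime_factors m)"
      using * p0 by (simp add: n_def prime_factors_product prime_prime_factors)
    have le: "\<forall>q\<in>prime_factors m. q \<le> p" using * by (auto simp: smooth_def)
    \<comment> \<open>The primes of m are at most p, so those of n above p are the k - 1 primes of
      b, which makes p the k-th.\<close>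
    have "{q \<in> prime_factors n. p < q} = prime_factors b" using pf le * by auto
    then have "k \<le> card (prime_factors n)" "kth_prime_factor k n = p"
      using kth_prime_factor_eqI[OF k, of p n] * pf by auto
    moreover have "n \<ge> 1" using * p0 by (simp add: n_def Suc_le_eq)
    moreover have "n \<le> nat \<lfloor>x\<rfloor>" using * by (simp add: n_def le_nat_floor)
    ultimately show ?thesis by (simp add: t \<phi>_def n_def A_def)
  qed
  have inj: "inj_on \<phi> T"
  proof (rule inj_onI)
    fix s t assume st: "s \<in> T" "t \<in> T" "\<phi> s = \<phi> t"
    obtain b p m where s: "s = (b,p,m)" by (cases s)
    obtain b' p' m' where t: "t = (b',p',m')" by (cases t)
    have p: "p = p'" using kth[OF st(1)] kth[OF st(2)] st(3) by (simp add: s t)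
    note 1 = T[OF st(1)[unfolded s]] and 2 = T[OF st(2)[unfolded t]]
    have p0: "p > 0" using 1 prime_gt_0_nat by blast
    \<comment> \<open>With p = p' known, b is coprime to m' because its primes exceed p while those
      of m' do not; likewise for b' and m. Hence b and b' divide each other.\<close>
    have eq: "b * m = b' * m'" using st(3) p p0 by (simp add: s t \<phi>_def mult.left_commute)
    have "coprime b m'" "coprime b' m" using 1 2 p by (auto intro: rough_smooth_coprime)
    moreover have "b dvd b' * m'" "b' dvd b * m" using eq by (metis dvd_triv_left)+
    ultimately have "b dvd b'" "b' dvd b" by (auto simp: coprime_dvd_mult_left_iff)
    then have "b = b'" by (rule dvd_antisym)
    then show "s = t" using eq p 1 by (simp add: s t)
  qed
  have "\<phi> ` T = A"
  proof
    show "\<phi> ` T \<subseteq> A" using kth by auto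
    show "A \<subseteq> \<phi> ` T"
    proof
      fix n assume n: "n \<in> A"
      then have n': "n > 0" "k \<le> card (prime_factors n)" "n \<le> nat \<lfloor>x\<rfloor>" by (auto simp: A_def)
      then have nx: "real n \<le> x" by linarith
      define p where "p = kth_prime_factor k n"
      note pp = kth_prime_factor_props[OF k n'(2), folded p_def]
      have p: "prime p" "p dvd n" using pp(1) by auto
      obtain b s where bs: "n = b * s" "b > 0" "\<forall>q\<in>prime_factors b. p < q" "smooth p s"
        using rough_smooth_decomposition[OF n'(1)] by blast
      have "\<not> p dvd b" using bs p by (auto simp: prime_factors_dvd)
      then have "p dvd s" using p bs by (simp add: prime_dvd_mult_iff)
      then obtain m where m: "s = p * m" by (elim dvdE)
      have sm: "smooth p m" "m > 0" using bs m by (auto simp: smooth_mult smooth_def)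
      have "prime_factors n = prime_factors b \<union> prime_factors s"
        using bs by (simp add: prime_factors_product smooth_def)
      moreover have "\<forall>q\<in>prime_factors s. q \<le> p" using bs by (auto simp: smooth_def)
      ultimately have "{q \<in> prime_factors n. p < q} = prime_factors b" using bs by auto
      then have cb: "card (prime_factors b) = k - 1" using pp by simp
      have p2: "real p \<ge> 2" using prime_ge_2_nat[OF p(1)] by simp
      have nb: "real n = real b * (real p * real m)" using bs m by simp
      \<comment> \<open>As p >= 2, every b that occurs is at most x/2, so the range of b loses
        nothing.\<close>
      have "real b * 2 \<le> real b * (real p * real m)"
        using p2 sm(2) mult_mono[of 2 "real p" 1 "real m"] by (intro mult_left_mono) auto
      then have "real b \<le> x / 2" using nb nx by simp
      moreover have "real m \<le> x / real b / real p" using nb nx p2 bs by (simp add: field_simps)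
      moreover have "p \<le> nat \<lfloor>x\<rfloor>" using p n' dvd_imp_le[of p n] by linarith
      ultimately have "(b,p,m) \<in> T" using bs cb p sm by (simp add: T_def P_def omega_eq_def smooths_def)
      then show "n \<in> \<phi> ` T" using bs m by (intro image_eqI[of _ _ "(b,p,m)"]) (auto simp: \<phi>_def)
    qed
  qed
  with inj have "bij_betw \<phi> T A" by (simp add: bij_betw_def)
  then have "(\<Sum>n\<in>A. c (kth_prime_factor k n)) = (\<Sum>t\<in>T. c (kth_prime_factor k (\<phi> t)))"
    by (rule sum.reindex_bij_betw[symmetric])
  also have "\<dots> = (\<Sum>(b,p,m)\<in>T. c p)" using kth by (intro sum.cong) (auto simp: case_prod_unfold)
  also have "\<dots> = (\<Sum>b\<in>omega_eq (k - 1) (x / 2). \<Sum>(p,m)\<in>Sigma (P b) (\<lambda>p. smooths (x / real b / real p) p). c p)"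
    unfolding T_def using fP by (subst sum.Sigma) (auto simp: case_prod_unfold)
  also have "\<dots> = (\<Sum>b\<in>omega_eq (k - 1) (x / 2). \<Sum>p\<in>P b. \<Sum>m\<in>smooths (x / real b / real p) p. c p)"
    using fP by (intro sum.cong refl sum.Sigma[symmetric]) auto
  also have "\<dots> = (\<Sum>b\<in>omega_eq (k - 1) (x / 2). \<Sum>p\<in>P b. c p * Psi (x / real b / real p) p)"
    by (simp add: Psi_def mult.commute)
  finally show ?thesis unfolding A_def P_def by simp
qed

text \<open>Numbers with at least k prime factors are handled by \<open>smooth_cancellation\<close>
  at X = x/b followed by \<open>omega_sum_bound\<close>. The remaining n, where the value defaults
  to 1, are few by \<open>card_omega_eq\<close> and are bounded trivially.\<close>

theorem kth_prime_factor_cancellation: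
  fixes c :: "nat \<Rightarrow> real" and B :: real
  assumes k: "k \<ge> 1" and c1: "\<And>n. \<bar>c n\<bar> \<le> 1" and cB: "\<And>N. \<bar>\<Sum>n=1..N. c n * plog n\<bar> \<le> B"
  shows "\<exists>K. \<forall>x\<ge>2. \<bar>\<Sum>n=1..nat \<lfloor>x\<rfloor>. c (kth_prime_factor k n)\<bar> \<le> K * (x * loglog x ^ k / ln x)"
proof -
  define C where "C = 5000 + 4 * B"
  have C0: "C \<ge> 0" using cB[of 0] by (simp add: C_def)
  define K where "K = C * 2000 ^ (k - 1) + (1 + real k * (320 * 2000 ^ k))"
  have "\<bar>\<Sum>n=1..nat \<lfloor>x\<rfloor>. c (kth_prime_factor k n)\<bar> \<le> K * (x * loglog x ^ k / ln x)" if x: "x \<ge> 2" for x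
  proof -
    define L where "L = loglog x"
    have L1: "L \<ge> 1" using x by (auto simp: L_def intro: loglog_ge_1)
    have lnx: "ln x > 0" using x by simp
    define N where "N = nat \<lfloor>x\<rfloor>"
    define A where "A = {n. n \<in> {1..N} \<and> k \<le> card (prime_factors n)}"
    define A' where "A' = {n \<in> {1..N}. card (prime_factors n) < k}"
    define M where "M = x * L ^ k / ln x"
    have split: "(\<Sum>n=1..N. c (kth_prime_factor k n)) = (\<Sum>n\<in>A. c (kth_prime_factor k n)) + (\<Sum>n\<in>A'. c (kth_prime_factor k n))"
      by (subst sum.union_disjoint[symmetric]) (auto simp: A_def A'_def intro!: sum.cong)
    have "\<bar>\<Sum>n\<in>A. c (kth_prime_factor k n)\<bar> \<le> (\<Sum>b\<in>omega_eq (k - 1) (x / 2). C * x * L * (1 / (real b * ln (x / real b))))"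
      unfolding A_def N_def kth_prime_factor_sum[OF k]
    proof (rule order_trans[OF sum_abs sum_mono])
      fix b assume b: "b \<in> omega_eq (k - 1) (x / 2)"
      note xb = omega_eq_half[OF b]
      have "\<forall>q\<in>prime_factors b. q > 0" by (auto intro: prime_gt_0_nat)
      \<comment> \<open>Lying below every prime of b means p <= w for some w, so the condition is a
        cutoff as in \<open>smooth_cancellation\<close>; for b = 1 it is the bound by the integer
        part of x.\<close>
      then obtain w where w: "{p. p \<le> nat \<lfloor>x\<rfloor> \<and> (\<forall>q\<in>prime_factors b. p < q)} = {..w}"
        using initial_segment[of "prime_factors b" "nat \<lfloor>x\<rfloor>"] by auto
      have "{p. prime p \<and> p \<le> nat \<lfloor>x\<rfloor> \<and> (\<forall>q\<in>prime_factors b. p < q)} =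
         Collect prime \<inter> {p. p \<le> nat \<lfloor>x\<rfloor> \<and> (\<forall>q\<in>prime_factors b. p < q)}" by blast
      also have "\<dots> = {p. prime p \<and> p \<le> w}" unfolding w by auto
      finally have eq: "{p. prime p \<and> p \<le> nat \<lfloor>x\<rfloor> \<and> (\<forall>q\<in>prime_factors b. p < q)} = {p. prime p \<and> p \<le> w}" .
      have "\<bar>\<Sum>p | prime p \<and> p \<le> nat \<lfloor>x\<rfloor> \<and> (\<forall>q\<in>prime_factors b. p < q). c p * Psi (x / real b / real p) p\<bar>
          \<le> C * (x / real b) * loglog (x / real b) / ln (x / real b)"
        unfolding eq C_def by (rule smooth_cancellation[OF xb(1) c1 cB])
      also have "\<dots> \<le> C * (x / real b) * L / ln (x / real b)"
        unfolding L_def using xb x C0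
        by (intro divide_right_mono mult_left_mono loglog_mono) auto
      finally show "\<bar>\<Sum>p | prime p \<and> p \<le> nat \<lfloor>x\<rfloor> \<and> (\<forall>q\<in>prime_factors b. p < q). c p * Psi (x / real b / real p) p\<bar>
          \<le> C * x * L * (1 / (real b * ln (x / real b)))" by simp
    qed
    also have "\<dots> = C * x * L * omega_sum (k - 1) x" by (simp add: omega_sum_def sum_distrib_left)
    also have "\<dots> \<le> C * x * L * ((2000 * L) ^ (k - 1) / ln x)"
      unfolding L_def using x C0 L1[unfolded L_def] by (intro mult_left_mono omega_sum_bound) auto
    also have "\<dots> = C * 2000 ^ (k - 1) * (x * (L * L ^ (k - 1)) / ln x)" by (simp add: power_mult_distrib)
    also have "L * L ^ (k - 1) = L ^ k" using k by (simp flip: power_Suc)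
    finally have 1: "\<bar>\<Sum>n\<in>A. c (kth_prime_factor k n)\<bar> \<le> C * 2000 ^ (k - 1) * M" by (simp add: M_def)
    \<comment> \<open>Absorbs the single number n = 1, which has no prime factor, into the error
      term.\<close>
    have M1: "M \<ge> 1"
    proof -
      have "ln x \<le> x * 1" using ln_le_minus_one[of x] x by simp
      also have "\<dots> \<le> x * L ^ k" using x L1 by (intro mult_left_mono one_le_power) auto
      finally show ?thesis using lnx by (simp add: M_def)
    qed
    have cA': "\<bar>\<Sum>n\<in>A'. c (kth_prime_factor k n)\<bar> \<le> real (card A')"
      using sum_mono[of A' "\<lambda>n. \<bar>c (kth_prime_factor k n)\<bar>" "\<lambda>_. 1"] c1
      by (intro order_trans[OF sum_abs]) simp
    have "A' \<subseteq> (\<Union>j<k. omega_eq j x)"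
    proof
      fix n assume "n \<in> A'"
      then have "n > 0" "n \<le> N" "card (prime_factors n) < k" by (auto simp: A'_def)
      moreover then have "real n \<le> x" using x by (simp add: N_def) linarith
      ultimately show "n \<in> (\<Union>j<k. omega_eq j x)" by (auto simp: omega_eq_def)
    qed
    then have "card A' \<le> (\<Sum>j<k. card (omega_eq j x))"
      using card_mono[of "\<Union>j<k. omega_eq j x" A'] card_UN_le[of "{..<k}" "\<lambda>j. omega_eq j x"] by simp
    then have "real (card A') \<le> (\<Sum>j<k. real (card (omega_eq j x)))" by (metis of_nat_le_iff of_nat_sum)
    with cA' have "\<bar>\<Sum>n\<in>A'. c (kth_prime_factor k n)\<bar> \<le> (\<Sum>j<k. real (card (omega_eq j x)))" by linarith
    also have "\<dots> = (\<Sum>j<Suc (k-1). real (card (omega_eq j x)))" using k by simp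
    also have "\<dots> = real (card (omega_eq 0 x)) + (\<Sum>j<k-1. real (card (omega_eq (Suc j) x)))"
      by (rule sum.lessThan_Suc_shift)
    also have "\<dots> \<le> 1 + (\<Sum>j<k-1. 320 * 2000 ^ k * M)"
    proof (intro add_mono sum_mono)
      fix j assume j: "j \<in> {..<k-1}"
      have "real (card (omega_eq (Suc j) x)) \<le> 320 * x * (2000 * L) ^ j / ln x"
        unfolding L_def by (rule card_omega_eq[OF x])
      also have "\<dots> \<le> 320 * x * (2000 * L) ^ k / ln x"
        using x L1 lnx j by (intro divide_right_mono mult_left_mono power_increasing) auto
      finally show "real (card (omega_eq (Suc j) x)) \<le> 320 * 2000 ^ k * M" by (simp add: M_def power_mult_distrib mult_ac)
    qed (use x in \<open>auto simp: omega_eq_0\<close>)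
    also have "\<dots> = 1 + real (k - 1) * (320 * 2000 ^ k * M)" by simp
    also have "\<dots> \<le> M + real k * (320 * 2000 ^ k * M)" using M1 by (intro add_mono mult_right_mono) auto
    finally have 2: "\<bar>\<Sum>n\<in>A'. c (kth_prime_factor k n)\<bar> \<le> M + real k * (320 * 2000 ^ k * M)" by simp
    have "\<bar>\<Sum>n=1..N. c (kth_prime_factor k n)\<bar> \<le> C * 2000 ^ (k - 1) * M + (M + real k * (320 * 2000 ^ k * M))"
      using split 1 2 by linarith
    also have "\<dots> = K * M" by (simp add: K_def algebra_simps)
    finally show ?thesis by (simp add: N_def M_def L_def)
  qed
  then show ?thesis by blast
qed

section \<open>Dirichlet characters\<close>

definition dchars :: "nat \<Rightarrow> (nat \<Rightarrow> complex) set" where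
  "dchars l = {\<xi>. (\<forall>m n. \<xi> (m * n) = \<xi> m * \<xi> n) \<and> (\<forall>m n. [m = n] (mod l) \<longrightarrow> \<xi> m = \<xi> n) \<and>
     (\<forall>n. \<xi> n \<noteq> 0 \<longleftrightarrow> coprime n l)}"

text \<open>Characters of a subgroup of the units modulo \<open>l\<close>, the subgroup being given as a union \<open>H\<close> of residue classes.\<close>

definition pchar :: "nat \<Rightarrow> nat set \<Rightarrow> (nat \<Rightarrow> complex) \<Rightarrow> bool" where
  "pchar l H \<xi> \<longleftrightarrow> 1 \<in> H \<and> (\<forall>m\<in>H. coprime m l \<and> \<xi> m \<noteq> 0) \<and>
     (\<forall>m\<in>H. \<forall>n\<in>H. m * n \<in> H \<and> \<xi> (m * n) = \<xi> m * \<xi> n) \<and>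
     (\<forall>m\<in>H. \<forall>n. [m = n] (mod l) \<longrightarrow> n \<in> H \<and> \<xi> m = \<xi> n)"

lemma pchar_power:
  assumes "pchar l H \<xi>" "m \<in> H" shows "m ^ i \<in> H \<and> \<xi> (m ^ i) = \<xi> m ^ i"
proof (induction i)
  case 0
  have "\<xi> 1 * \<xi> 1 = \<xi> 1" "\<xi> 1 \<noteq> 0" "1 \<in> H" using assms(1) unfolding pchar_def by (metis mult_1)+
  then show ?case by simp
next
  case (Suc i)
  then show ?case using assms unfolding pchar_def by simp
qed

text \<open>By Euler's theorem m^(totient l - 1) is an inverse of m modulo l and lies in H.\<close>

lemma pchar_div:
  assumes l: "l > 0" and H: "pchar l H \<xi>" "m \<in> H" "m * n \<in> H" shows "n \<in> H"
proof -
  have "m ^ (totient l - 1) * (m * n) \<in> H" using H pchar_power[OF H(1,2)] unfolding pchar_def by blast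
  moreover have "m ^ (totient l - 1) * (m * n) = m ^ totient l * n"
    using l by (simp add: mult.assoc[symmetric] flip: power_Suc2)
  moreover have "[m ^ totient l * n = 1 * n] (mod l)"
    using H unfolding pchar_def by (intro cong_mult euler_theorem) auto
  ultimately show ?thesis using H(1) unfolding pchar_def by (metis mult_1)
qed

text \<open>The exponent d = \<open>LEAST d. d > 0 \<and> a ^ d \<in> H\<close> is the order of a
  modulo H, so c^d = \<xi>(a^d) is the only constraint on the value c at a. Leaving c free serves
  both the existence of extensions and the separation of elements.\<close>

lemma pchar_extend:
  assumes l: "l > 0" and H: "pchar l H \<xi>" and a: "coprime a l"
    and c: "c ^ (LEAST d. d > 0 \<and> a ^ d \<in> H) = \<xi> (a ^ (LEAST d. d > 0 \<and> a ^ d \<in> H))"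
  shows "\<exists>H' \<xi>'. pchar l H' \<xi>' \<and> H \<subseteq> H' \<and> a \<in> H' \<and> (\<forall>m\<in>H. \<xi>' m = \<xi> m) \<and> \<xi>' a = c"
proof -
  define d where "d = (LEAST d. d > 0 \<and> a ^ d \<in> H)"
  have H1: "1 \<in> H" and Hc: "\<And>m n. m \<in> H \<Longrightarrow> [m = n] (mod l) \<Longrightarrow> n \<in> H \<and> \<xi> m = \<xi> n"
    and Hm: "\<And>m n. m \<in> H \<Longrightarrow> n \<in> H \<Longrightarrow> m * n \<in> H \<and> \<xi> (m * n) = \<xi> m * \<xi> n"
    and Hn: "\<And>m. m \<in> H \<Longrightarrow> coprime m l \<and> \<xi> m \<noteq> 0"
    using H unfolding pchar_def by blast+
  have "[1 = a ^ totient l] (mod l)" using euler_theorem[OF a] by (rule cong_sym)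
  then have "totient l > 0 \<and> a ^ totient l \<in> H" using Hc[OF H1] l by simp
  then have "d > 0 \<and> a ^ d \<in> H" unfolding d_def by (rule LeastI)
  then have d: "d > 0" "a ^ d \<in> H" by auto
  have dmin: "d \<le> r" if "r > 0" "a ^ r \<in> H" for r unfolding d_def using that by (intro Least_le) auto
  have cd: "c ^ d = \<xi> (a ^ d)" using c by (simp add: d_def)
  \<comment> \<open>The exponents j with a^j in H are multiples of d; otherwise j mod d would
    contradict minimality.\<close>
  have apow: "\<xi> (a ^ j) = c ^ j" if j: "a ^ j \<in> H" for j
  proof -
    have eq: "a ^ j = (a ^ d) ^ (j div d) * a ^ (j mod d)" by (simp flip: power_mult power_add)
    have dq: "(a ^ d) ^ (j div d) \<in> H" "\<xi> ((a ^ d) ^ (j div d)) = \<xi> (a ^ d) ^ (j div d)"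
      using pchar_power[OF H d(2)] by auto
    then have "a ^ (j mod d) \<in> H" using pchar_div[OF l H] j eq by metis
    then have "j mod d = 0" using dmin[of "j mod d"] mod_less_divisor[OF d(1), of j] by linarith
    then have "d * (j div d) = j" by (simp add: mod_eq_0_iff_dvd)
    then have "a ^ j = (a ^ d) ^ (j div d)" "c ^ j = (c ^ d) ^ (j div d)" by (simp_all flip: power_mult)
    then show ?thesis using dq(2) cd by simp
  qed
  \<comment> \<open>Independence of the representation h a^i: cancelling a^i puts a^(i' - i) into H,
    where \<open>apow\<close> gives its value.\<close>
  have wd: "\<xi> h * c ^ i = \<xi> h' * c ^ i'"
    if h: "h \<in> H" "h' \<in> H" "[h * a ^ i = h' * a ^ i'] (mod l)" "i \<le> i'" for h h' i i'
  proof -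
    have "[h * a ^ i = (h' * a ^ (i' - i)) * a ^ i] (mod l)" using h by (simp add: mult.assoc flip: power_add)
    then have "[h = h' * a ^ (i' - i)] (mod l)" using a by (subst (asm) cong_mult_rcancel_nat) auto
    then have "h' * a ^ (i' - i) \<in> H" "\<xi> h = \<xi> (h' * a ^ (i' - i))" using Hc h by blast+
    moreover from this have "a ^ (i' - i) \<in> H" using pchar_div[OF l H h(2)] by blast
    ultimately have "\<xi> h = \<xi> h' * c ^ (i' - i)" using Hm[OF h(2)] apow by metis
    then show ?thesis using h(4) by (simp add: mult.assoc flip: power_add)
  qed
  define H' where "H' = {m. \<exists>h i. h \<in> H \<and> [m = h * a ^ i] (mod l)}"
  have H'I: "m \<in> H'" if "h \<in> H" "[m = h * a ^ i] (mod l)" for m h i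
    using that unfolding H'_def by blast
  define \<xi>' where "\<xi>' = (\<lambda>m. SOME z. \<exists>h i. h \<in> H \<and> [m = h * a ^ i] (mod l) \<and> z = \<xi> h * c ^ i)"
  have \<xi>': "\<xi>' m = \<xi> h * c ^ i" if h: "h \<in> H" "[m = h * a ^ i] (mod l)" for m h i
    unfolding \<xi>'_def
  proof (rule some_equality)
    show "\<exists>h' i'. h' \<in> H \<and> [m = h' * a ^ i'] (mod l) \<and> \<xi> h * c ^ i = \<xi> h' * c ^ i'" using h by blast
    fix z assume "\<exists>h i. h \<in> H \<and> [m = h * a ^ i] (mod l) \<and> z = \<xi> h * c ^ i"
    then obtain h' i' where h': "h' \<in> H" "[m = h' * a ^ i'] (mod l)" "z = \<xi> h' * c ^ i'" by blast
    have "[h * a ^ i = h' * a ^ i'] (mod l)" using h h' cong_sym cong_trans by blast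
    then show "z = \<xi> h * c ^ i" using wd[of h h' i i'] wd[of h' h i' i] h h' cong_sym by (cases "i \<le> i'") auto
  qed
  have c0: "c \<noteq> 0" using cd Hn[OF d(2)] d(1) by (metis zero_power)
  have "pchar l H' \<xi>'"
    unfolding pchar_def
  proof (intro conjI ballI allI impI)
    show "1 \<in> H'" using H'I[of 1 1 0] H1 by simp
  next
    fix m assume "m \<in> H'"
    then obtain h i where h: "h \<in> H" "[m = h * a ^ i] (mod l)" by (auto simp: H'_def)
    have "coprime (h * a ^ i) l" using Hn[OF h(1)] a by simp
    then show "coprime m l" using h(2) by (metis cong_imp_coprime cong_sym)
    show "\<xi>' m \<noteq> 0" using \<xi>'[OF h] Hn[OF h(1)] c0 by simp
    show "n \<in> H'" "\<xi>' m = \<xi>' n" if "[m = n] (mod l)" for n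
    proof -
      have n: "[n = h * a ^ i] (mod l)" using that h(2) cong_sym cong_trans by blast
      then show "n \<in> H'" using h by (auto simp: H'_def)
      show "\<xi>' m = \<xi>' n" using \<xi>'[OF h(1) n] \<xi>'[OF h] by simp
    qed
    fix n assume "n \<in> H'"
    then obtain h' i' where h': "h' \<in> H" "[n = h' * a ^ i'] (mod l)" by (auto simp: H'_def)
    have "[m * n = (h * a ^ i) * (h' * a ^ i')] (mod l)" using h h' by (intro cong_mult)
    then have mn: "[m * n = (h * h') * a ^ (i + i')] (mod l)" by (simp add: power_add mult_ac)
    then show "m * n \<in> H'" using Hm[OF h(1) h'(1)] by (auto simp: H'_def)
    show "\<xi>' (m * n) = \<xi>' m * \<xi>' n"
      using \<xi>'[OF h] \<xi>'[OF h'] \<xi>'[OF _ mn] Hm[OF h(1) h'(1)] by (simp add: power_add)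
  qed
  moreover have "m \<in> H'" "\<xi>' m = \<xi> m" if "m \<in> H" for m
    using that \<xi>'[of m m 0] H'I[of m m 0] by simp_all
  moreover have "a \<in> H'" "\<xi>' a = c"
    using H1 \<xi>'[of 1 a 1] H'I[of 1 a 1] pchar_power[OF H H1, of 0] by simp_all
  ultimately show ?thesis by blast
qed

lemma ex_complex_root: 
  assumes "d > 0" shows "\<exists>c::complex. c ^ d = z"
proof (cases "z = 0")
  case False
  have "exp (Ln z / of_nat d) ^ d = z" using assms False by (simp flip: exp_of_nat_mult)
  then show ?thesis by blast
qed (use assms in \<open>auto intro: exI[of _ 0]\<close>)

text \<open>Each extension removes at least one residue from the complement of H, and the required
  value exists because complex d-th roots do.\<close>

lemma pchar_total:
  assumes l: "l > 0" and H: "pchar l H \<xi>"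
  shows "\<exists>\<xi>'\<in>dchars l. \<forall>m\<in>H. \<xi>' m = \<xi> m"
  using H
proof (induction "card {n. n < l \<and> coprime n l \<and> n \<notin> H}" arbitrary: H \<xi> rule: less_induct)
  case less
  show ?case
  proof (cases "{n. n < l \<and> coprime n l \<and> n \<notin> H} = {}")
    case True
    have H: "n \<in> H \<longleftrightarrow> coprime n l" for n
    proof
      assume "coprime n l"
      then have "n mod l \<in> H" using True l by auto
      moreover have "[n mod l = n] (mod l)" by simp
      ultimately show "n \<in> H" using less.prems unfolding pchar_def by blast
    qed (use less.prems in \<open>auto simp: pchar_def\<close>)
    define \<xi>' where "\<xi>' = (\<lambda>n. if coprime n l then \<xi> n else 0)"
    have "\<xi>' \<in> dchars l"
      unfolding dchars_def
    proof (intro CollectI conjI allI impI)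
      fix m n
      show "\<xi>' (m * n) = \<xi>' m * \<xi>' n" using less.prems unfolding pchar_def \<xi>'_def by (auto simp: H)
      show "\<xi>' m = \<xi>' n" if "[m = n] (mod l)"
        using less.prems that cong_imp_coprime[OF that] cong_imp_coprime[OF cong_sym[OF that]]
        unfolding pchar_def \<xi>'_def by (auto simp: H)
      show "(\<xi>' n \<noteq> 0) = coprime n l" using less.prems unfolding pchar_def \<xi>'_def by (simp add: H)
    qed
    then show ?thesis by (intro bexI[of _ \<xi>']) (auto simp: \<xi>'_def H)
  next
    case False
    then obtain a where a: "a < l" "coprime a l" "a \<notin> H" by auto
    define d where "d = (LEAST d. d > 0 \<and> a ^ d \<in> H)"
    have "\<exists>d. d > 0 \<and> a ^ d \<in> H"
    proof -
      have "[1 = a ^ totient l] (mod l)" using euler_theorem[OF a(2)] by (rule cong_sym)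
      then show ?thesis using less.prems l unfolding pchar_def by (intro exI[of _ "totient l"]) auto
    qed
    then have "d > 0" unfolding d_def by (metis (mono_tags, lifting) LeastI_ex)
    then obtain c where "c ^ d = \<xi> (a ^ d)" using ex_complex_root by blast
    then obtain H' \<xi>' where H': "pchar l H' \<xi>'" "H \<subseteq> H'" "a \<in> H'" "\<forall>m\<in>H. \<xi>' m = \<xi> m"
      using pchar_extend[OF l less.prems a(2), of c] unfolding d_def by blast
    have "card {n. n < l \<and> coprime n l \<and> n \<notin> H'} < card {n. n < l \<and> coprime n l \<and> n \<notin> H}"
      using H' a by (intro psubset_card_mono) auto
    then obtain \<xi>'' where "\<xi>'' \<in> dchars l" "\<forall>m\<in>H'. \<xi>'' m = \<xi>' m" using less.hyps H'(1) by blast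
    then show ?thesis using H' by (intro bexI[of _ \<xi>'']) auto
  qed
qed

text \<open>Extend the trivial character on the class of 1. There d is the order of a, at least 2,
  so a primitive d-th root of unity is an admissible value at a different from 1.\<close>

lemma dchars_separate:
  assumes l: "l > 0" and a: "coprime a l" "\<not> [a = 1] (mod l)"
  shows "\<exists>\<xi>\<in>dchars l. \<xi> a \<noteq> 1"
proof -
  define H where "H = {n. [n = 1] (mod l)}"
  define d where "d = (LEAST d. d > 0 \<and> a ^ d \<in> H)"
  have H: "pchar l H (\<lambda>_. 1)"
    unfolding pchar_def H_def
  proof (intro conjI ballI allI impI; (simp only: mem_Collect_eq)?)
    fix m assume m: "[m = 1] (mod l)"
    show "coprime m l" using cong_imp_coprime[OF cong_sym[OF m]] by simp
    show "[m * n = 1] (mod l)" if "[n = 1] (mod l)" for n using cong_mult[OF m that] by simp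
    show "[n = 1] (mod l)" if "[m = n] (mod l)" for n using m that cong_sym cong_trans by blast
  qed auto
  have "\<exists>d. d > 0 \<and> a ^ d \<in> H"
    using euler_theorem[OF a(1)] l by (intro exI[of _ "totient l"]) (auto simp: H_def)
  then have d: "d > 0" "a ^ d \<in> H" unfolding d_def by (metis (mono_tags, lifting) LeastI_ex)+
  have "d \<noteq> 1" using d a by (auto simp: H_def)
  then have d2: "d \<ge> 2" using d by simp
  define c where "c = cis (2 * pi / real d)"
  have "c ^ d = cis (real d * (2 * pi / real d))" unfolding c_def by (rule Complex.DeMoivre)
  then have cd: "c ^ d = 1" using d by simp
  have "c \<noteq> 1"
  proof
    assume "c = 1"
    then have "cos (2 * pi / real d) = 1" by (metis c_def cis.simps(1) one_complex.simps(1))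
    moreover have "cos (2 * pi / real d) < cos 0"
      using d2 pi_gt_zero by (intro cos_monotone_0_pi) (auto simp: field_simps)
    ultimately show False by simp
  qed
  obtain H' \<xi>' where H': "pchar l H' \<xi>'" "a \<in> H'" "\<xi>' a = c"
    using pchar_extend[OF l H a(1), of c] cd unfolding d_def by blast
  obtain \<eta> where "\<eta> \<in> dchars l" "\<forall>m\<in>H'. \<eta> m = \<xi>' m" using pchar_total[OF l H'(1)] by blast
  then show ?thesis using H' \<open>c \<noteq> 1\<close> by (intro bexI[of _ \<eta>]) auto
qed

section \<open>Orthogonality of characters\<close>

definition chi0 :: "nat \<Rightarrow> nat \<Rightarrow> complex" where "chi0 l n = (if coprime n l then 1 else 0)"

context
  fixes l :: nat
  assumes l: "l \<ge> 2"
begin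

lemma dchar_mult: "\<xi> \<in> dchars l \<Longrightarrow> \<xi> (m * n) = \<xi> m * \<xi> n"
  and dchar_cong: "\<xi> \<in> dchars l \<Longrightarrow> [m = n] (mod l) \<Longrightarrow> \<xi> m = \<xi> n"
  and dchar_nonzero: "\<xi> \<in> dchars l \<Longrightarrow> \<xi> n \<noteq> 0 \<longleftrightarrow> coprime n l"
  unfolding dchars_def by auto

lemma dchar_1: assumes "\<xi> \<in> dchars l" shows "\<xi> 1 = 1"
  using dchar_mult[OF assms, of 1 1] dchar_nonzero[OF assms, of 1] by simp

lemma dchar_power: assumes "\<xi> \<in> dchars l" shows "\<xi> (m ^ i) = \<xi> m ^ i"
  using dchar_1[OF assms] by (induction i) (simp_all add: dchar_mult[OF assms])

lemma dchar_root: assumes "\<xi> \<in> dchars l" "coprime n l" shows "\<xi> n ^ totient l = 1"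
  using dchar_cong[OF assms(1) euler_theorem[OF assms(2)]] dchar_1[OF assms(1)] dchar_power[OF assms(1)] by simp

lemma dchar_norm: assumes "\<xi> \<in> dchars l" "coprime n l" shows "norm (\<xi> n) = 1"
proof -
  have "norm (\<xi> n) ^ totient l = 1" using dchar_root[OF assms] by (simp flip: norm_power)
  then show ?thesis using l power_eq_imp_eq_base[of "norm (\<xi> n)" "totient l" 1] by simp
qed

lemma dchar_norm_le: assumes "\<xi> \<in> dchars l" shows "norm (\<xi> n) \<le> 1"
  using dchar_norm[OF assms, of n] dchar_nonzero[OF assms, of n] by (cases "coprime n l") auto

lemma dchar_cnj: "\<xi> \<in> dchars l \<Longrightarrow> (\<lambda>n. cnj (\<xi> n)) \<in> dchars l"
  unfolding dchars_def by auto

lemma dchar_times: "\<xi> \<in> dchars l \<Longrightarrow> \<psi> \<in> dchars l \<Longrightarrow> (\<lambda>n. \<xi> n * \<psi> n) \<in> dchars l"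
proof -
  assume A: "\<xi> \<in> dchars l" and B: "\<psi> \<in> dchars l"
  show ?thesis
    unfolding dchars_def
  proof (intro CollectI conjI allI impI)
    show "\<xi> m * \<psi> m = \<xi> n * \<psi> n" if "[m = n] (mod l)" for m n
      using dchar_cong[OF A that] dchar_cong[OF B that] by simp
  qed (use dchar_nonzero[OF A] dchar_nonzero[OF B] in \<open>auto simp: dchar_mult[OF A] dchar_mult[OF B]\<close>)
qed

lemma dchar_cnj_cancel:
  assumes "\<xi> \<in> dchars l" "\<psi> \<in> dchars l" shows "\<psi> n * (cnj (\<psi> n) * \<xi> n) = \<xi> n"
proof (cases "coprime n l")
  case True
  then have "\<psi> n * cnj (\<psi> n) = 1" using dchar_norm[OF assms(2)] by (simp add: complex_norm_square[symmetric])
  then show ?thesis by (simp flip: mult.assoc)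
qed (use dchar_nonzero assms in auto)

text \<open>A character is determined by its l values on residues, each of which is 0 or a root of
  unity of order dividing totient l.\<close>

lemma finite_dchars: "finite (dchars l)"
proof -
  define V where "V = insert 0 {z::complex. z ^ totient l = 1}"
  have "finite V" using finite_roots_unity[of "totient l"] l by (simp add: V_def Suc_le_eq)
  then have "finite {xs. set xs \<subseteq> V \<and> length xs = l}" by (rule finite_lists_length_eq)
  moreover have "dchars l \<subseteq> (\<lambda>xs n. xs ! (n mod l)) ` {xs. set xs \<subseteq> V \<and> length xs = l}"
  proof
    fix \<xi> assume \<xi>: "\<xi> \<in> dchars l"
    have "\<xi> n \<in> V" for n using dchar_root[OF \<xi>, of n] dchar_nonzero[OF \<xi>, of n] by (auto simp: V_def)
    moreover have "\<xi> = (\<lambda>n. map \<xi> [0..<l] ! (n mod l))"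
    proof
      fix n show "\<xi> n = map \<xi> [0..<l] ! (n mod l)" using l dchar_cong[OF \<xi>, of n "n mod l"] by simp
    qed
    ultimately show "\<xi> \<in> (\<lambda>xs n. xs ! (n mod l)) ` {xs. set xs \<subseteq> V \<and> length xs = l}"
      by (intro image_eqI[of _ _ "map \<xi> [0..<l]"]) auto
  qed
  ultimately show ?thesis using finite_surj by blast
qed

lemma chi0: "chi0 l \<in> dchars l"
  unfolding dchars_def chi0_def by (auto dest: cong_imp_coprime cong_sym)

text \<open>Multiplication by a character \<psi> with \<psi>(a) \<noteq> 1 permutes the characters
  and multiplies the sum by \<psi>(a).\<close>

lemma sum_dchars_eq_0:
  assumes "\<not> [a = 1] (mod l)" shows "(\<Sum>\<xi>\<in>dchars l. \<xi> a) = 0"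
proof (cases "coprime a l")
  case True
  then obtain \<psi> where \<psi>: "\<psi> \<in> dchars l" "\<psi> a \<noteq> 1" using dchars_separate[of l a] assms l by auto
  have "(\<Sum>\<xi>\<in>dchars l. \<xi> a) = (\<Sum>\<xi>\<in>dchars l. \<psi> a * \<xi> a)"
  proof (rule sum.reindex_bij_witness[where i = "\<lambda>\<xi> n. \<psi> n * \<xi> n" and j = "\<lambda>\<xi> n. cnj (\<psi> n) * \<xi> n"])
    fix \<xi> assume \<xi>: "\<xi> \<in> dchars l"
    show "(\<lambda>n. \<psi> n * (cnj (\<psi> n) * \<xi> n)) = \<xi>" "\<psi> a * (cnj (\<psi> a) * \<xi> a) = \<xi> a"
      using dchar_cnj_cancel[OF \<xi> \<psi>(1)] by auto
    show "(\<lambda>n. cnj (\<psi> n) * (\<psi> n * \<xi> n)) = \<xi>"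
      using dchar_cnj_cancel[OF \<xi> dchar_cnj[OF \<psi>(1)]] by auto
    show "(\<lambda>n. cnj (\<psi> n) * \<xi> n) \<in> dchars l" by (rule dchar_times[OF dchar_cnj[OF \<psi>(1)] \<xi>])
    show "(\<lambda>n. \<psi> n * \<xi> n) \<in> dchars l" by (rule dchar_times[OF \<psi>(1) \<xi>])
  qed
  also have "\<dots> = \<psi> a * (\<Sum>\<xi>\<in>dchars l. \<xi> a)" by (simp add: sum_distrib_left)
  finally show ?thesis using \<psi>(2) by simp
next
  case False
  then show ?thesis using dchar_nonzero by (intro sum.neutral) auto
qed

text \<open>Multiplication by some a coprime to l with \<xi>(a) \<noteq> 1 permutes the residues and
  multiplies the sum by \<xi>(a).\<close>

lemma sum_dchar_period:
  assumes \<xi>: "\<xi> \<in> dchars l" "\<xi> \<noteq> chi0 l" shows "(\<Sum>n<l. \<xi> n) = 0"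
proof -
  obtain a where "\<xi> a \<noteq> chi0 l a" using \<xi>(2) by auto
  then have a: "coprime a l" "\<xi> a \<noteq> 1" using dchar_nonzero[OF \<xi>(1), of a] by (auto simp: chi0_def split: if_splits)
  have inj: "inj_on (\<lambda>n. (a * n) mod l) {..<l}"
  proof (rule inj_onI)
    fix m n assume *: "m \<in> {..<l}" "n \<in> {..<l}" "(a * m) mod l = (a * n) mod l"
    then have "[a * m = a * n] (mod l)" by (simp add: Cong.cong_def)
    then have "[m = n] (mod l)" using cong_mult_lcancel_nat[OF a(1)] by blast
    then show "m = n" using * by (simp add: Cong.cong_def)
  qed
  have "(\<lambda>n. (a * n) mod l) ` {..<l} = {..<l}"
    using l by (intro endo_inj_surj inj) auto
  then have "bij_betw (\<lambda>n. (a * n) mod l) {..<l} {..<l}" using inj by (simp add: bij_betw_def)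
  then have "(\<Sum>n<l. \<xi> n) = (\<Sum>n<l. \<xi> ((a * n) mod l))" by (rule sum.reindex_bij_betw[symmetric])
  also have "\<dots> = (\<Sum>n<l. \<xi> a * \<xi> n)"
  proof (rule sum.cong[OF refl])
    fix n show "\<xi> ((a * n) mod l) = \<xi> a * \<xi> n"
      using dchar_cong[OF \<xi>(1), of "(a * n) mod l" "a * n"] dchar_mult[OF \<xi>(1)] by simp
  qed
  also have "\<dots> = \<xi> a * (\<Sum>n<l. \<xi> n)" by (simp add: sum_distrib_left)
  finally show ?thesis using a(2) by simp
qed

text \<open>Count the sum of \<xi>(a) over all characters and residues twice: summed over a first,
  only the principal character survives; summed over characters first, only a = 1 does.\<close>

lemma card_dchars: "card (dchars l) = totient l"
proof -
  have "(\<Sum>\<xi>\<in>dchars l. \<Sum>a<l. \<xi> a) = (\<Sum>\<xi>\<in>{chi0 l}. \<Sum>a<l. \<xi> a)"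
    using finite_dchars chi0 sum_dchar_period by (intro sum.mono_neutral_right) auto
  also have "\<dots> = of_nat (card {a. a < l \<and> coprime a l})"
    by (simp add: chi0_def sum.If_cases Int_def lessThan_def conj_commute)
  also have "{a. a < l \<and> coprime a l} = totatives l"
    using l by (auto simp: totatives_def Suc_le_eq intro!: Nat.gr0I order_neq_le_trans)
  finally have 1: "(\<Sum>\<xi>\<in>dchars l. \<Sum>a<l. \<xi> a) = of_nat (totient l)" by (simp add: totient_def)
  have "(\<Sum>\<xi>\<in>dchars l. \<Sum>a<l. \<xi> a) = (\<Sum>a<l. \<Sum>\<xi>\<in>dchars l. \<xi> a)" by (rule sum.swap)
  also have "\<dots> = (\<Sum>a\<in>{1}. \<Sum>\<xi>\<in>dchars l. \<xi> a)"
  proof (intro sum.mono_neutral_right ballI)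
    fix a assume "a \<in> {..<l} - {1}"
    then have "\<not> [a = 1] (mod l)" using l by (auto simp: Cong.cong_def)
    then show "(\<Sum>\<xi>\<in>dchars l. \<xi> a) = 0" by (rule sum_dchars_eq_0)
  qed (use l in auto)
  also have "\<dots> = (\<Sum>\<xi>\<in>dchars l. 1)"
    using sum.cong[OF refl dchar_1, of "dchars l"] by simp
  also have "\<dots> = of_nat (card (dchars l))" by simp
  finally show ?thesis using 1 by (metis of_nat_eq_iff)
qed

text \<open>An inverse j' of j takes the role of conjugation: \<open>\<xi> j'\<close> is the
  conjugate of \<open>\<xi> j\<close>.\<close>

lemma sum_dchars:
  assumes j: "[j * j' = 1] (mod l)"
  shows "(\<Sum>\<xi>\<in>dchars l. \<xi> j' * \<xi> n) = (if [n = j] (mod l) then of_nat (totient l) else 0)"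
proof -
  have cop: "coprime j' l" using j cong_imp_coprime[OF cong_sym[OF j]] by simp
  have iff: "[j' * n = 1] (mod l) \<longleftrightarrow> [n = j] (mod l)"
  proof -
    have "[j' * n = 1] (mod l) \<longleftrightarrow> [j' * n = j' * j] (mod l)"
      using j by (metis cong_sym cong_trans mult.commute)
    then show ?thesis using cop by (simp add: cong_mult_lcancel_nat)
  qed
  have "(\<Sum>\<xi>\<in>dchars l. \<xi> j' * \<xi> n) = (\<Sum>\<xi>\<in>dchars l. \<xi> (j' * n))" by (simp add: dchar_mult)
  also have "\<dots> = (if [n = j] (mod l) then of_nat (totient l) else 0)"
  proof (cases "[n = j] (mod l)")
    case True
    then have "\<xi> (j' * n) = 1" if "\<xi> \<in> dchars l" for \<xi>
      using iff dchar_cong[OF that] dchar_1[OF that] by metis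
    then have "(\<Sum>\<xi>\<in>dchars l. \<xi> (j' * n)) = (\<Sum>\<xi>\<in>dchars l. 1)" by (intro sum.cong) auto
    then show ?thesis using True by (simp add: card_dchars)
  next
    case False
    then show ?thesis using iff sum_dchars_eq_0 by simp
  qed
  finally show ?thesis .
qed

end

section \<open>Dirichlet series at 1\<close>

definition mu :: "nat \<Rightarrow> real" where
  "mu n = (if squarefree n then (-1) ^ card (prime_factors n) else 0)"

lemma abs_mu_le: "\<bar>mu n\<bar> \<le> 1"
  by (auto simp: mu_def power_abs)

lemma mu_prime_mult:
  assumes "prime p" "\<not> p dvd d" shows "mu (p * d) = - mu d"
proof -
  have d0: "d > 0" using assms by (auto intro: Nat.gr0I)
  have cop: "coprime p d" using assms by (simp add: prime_imp_coprime)
  have "squarefree (p * d) \<longleftrightarrow> squarefree d"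
    using squarefree_mult_coprime[OF cop] squarefree_prime[OF assms(1)] squarefree_multD[of p d] by auto
  moreover have "prime_factors (p * d) = insert p (prime_factors d)"
    using assms d0 prime_gt_0_nat[of p] by (simp add: prime_factors_product prime_prime_factors)
  moreover have "p \<notin> prime_factors d" using assms by auto
  ultimately show ?thesis by (simp add: mu_def)
qed

text \<open>Fix a prime p dividing n. The divisors d prime to p cancel against p d, and the divisors
  divisible by p^2 contribute 0.\<close>

lemma sum_mu_divisors:
  assumes "n > 0" shows "(\<Sum>d | d dvd n. mu d) = (if n = 1 then 1 else 0)"
proof (cases "n = 1")
  case True
  then have "{d. d dvd n} = {1}" by auto
  then show ?thesis using True by (simp add: mu_def)
next
  case False
  then obtain p where p: "prime p" "p dvd n" using prime_factor_nat by blast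
  have p0: "p > 0" using p prime_gt_0_nat by blast
  define A where "A = {d. d dvd n \<and> \<not> p dvd d}"
  define B where "B = {d. d dvd n \<and> p dvd d}"
  have fin: "finite A" "finite B" using assms by (auto simp: A_def B_def)
  have "sum mu B = sum mu ((*) p ` A)"
  proof (rule sum.mono_neutral_right)
    show "(*) p ` A \<subseteq> B"
      using p by (auto simp: A_def B_def intro!: divides_mult prime_imp_coprime)
    show "\<forall>d\<in>B - (*) p ` A. mu d = 0"
    proof
      fix d assume d: "d \<in> B - (*) p ` A"
      then obtain e where e: "d = p * e" "d dvd n" by (auto simp: B_def)
      then have "e dvd n" using dvd_trans[of e d n] by simp
      have "p dvd e"
      proof (rule ccontr)
        assume "\<not> p dvd e"
        then have "e \<in> A" using \<open>e dvd n\<close> by (simp add: A_def)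
        then show False using d e by auto
      qed
      then have "p ^ 2 dvd d" using e by (auto simp: power2_eq_square)
      then have "\<not> squarefree d" using p prime_gt_1_nat[OF p(1)] by (auto simp: squarefree_def)
      then show "mu d = 0" by (simp add: mu_def)
    qed
  qed (use fin in auto)
  also have "\<dots> = (\<Sum>d\<in>A. mu (p * d))" using p0 by (subst sum.reindex) (auto simp: inj_on_def)
  also have "\<dots> = - sum mu A" using p by (simp add: mu_prime_mult A_def sum_negf)
  finally have "sum mu A + sum mu B = 0" by simp
  moreover have "(\<Sum>d | d dvd n. mu d) = sum mu A + sum mu B"
    using fin by (subst sum.union_disjoint[symmetric]) (auto simp: A_def B_def intro!: sum.cong)
  ultimately show ?thesis using False by simp
qed

text \<open>Moebius inversion of ln = \<Sum> \<Lambda> gives \<Lambda>(n) as the sum of \<mu>(d) ln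
  (n/d). The part with ln n vanishes: for n > 1 by \<open>sum_mu_divisors\<close>, for n = 1 because
  ln 1 = 0.\<close>

lemma sum_mu_ln:
  assumes n: "n > 0" shows "(\<Sum>d | d dvd n. mu d * ln (real d)) = - \<Lambda> n"
proof -
  have fin: "finite {d. d dvd n}" using n by simp
  have pos: "d > 0" if "d dvd n" for d using that n by (auto intro: Nat.gr0I)
  have "(\<Sum>d | d dvd n. mu d * ln (real (n div d))) = (\<Sum>d | d dvd n. \<Sum>e | e dvd n div d. mu d * \<Lambda> e)"
  proof (rule sum.cong[OF refl])
    fix d assume "d \<in> {d. d dvd n}"
    then have "n div d \<noteq> 0" using n by (auto elim: dvdE)
    then show "mu d * ln (real (n div d)) = (\<Sum>e | e dvd n div d. mu d * \<Lambda> e)"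
      using mangoldt_sum[of "n div d", where 'a = real] by (simp flip: sum_distrib_left)
  qed
  also have "\<dots> = (\<Sum>(d,e)\<in>Sigma {d. d dvd n} (\<lambda>d. {e. e dvd n div d}). mu d * \<Lambda> e)"
    using n by (intro sum.Sigma) (auto elim!: dvdE)
  also have "Sigma {d. d dvd n} (\<lambda>d. {e. e dvd n div d}) = {(d,e). d * e dvd n}"
    using pos by (auto simp: dvd_div_iff_mult mult.commute dest: dvd_mult_left dvd_mult_right)
  also have "(\<Sum>(d,e)\<in>{(d,e). d * e dvd n}. mu d * \<Lambda> e) = (\<Sum>(e,d)\<in>{(d,e). d * e dvd n}. mu d * \<Lambda> e)"
    by (rule sum.reindex_bij_witness[where i = prod.swap and j = prod.swap]) (auto simp: mult.commute)
  also have "{(d,e). d * e dvd n} = Sigma {d. d dvd n} (\<lambda>d. {e. e dvd n div d})"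
    using pos by (auto simp: dvd_div_iff_mult mult.commute dest: dvd_mult_left dvd_mult_right)
  also have "(\<Sum>(e,d)\<in>\<dots>. mu d * \<Lambda> e) = (\<Sum>e | e dvd n. \<Sum>d | d dvd n div e. mu d * \<Lambda> e)"
    using n by (intro sum.Sigma[symmetric]) (auto elim!: dvdE)
  also have "\<dots> = (\<Sum>e | e dvd n. if e = n then \<Lambda> e else 0)"
  proof (rule sum.cong[OF refl])
    fix e assume "e \<in> {d. d dvd n}"
    then obtain f where f: "n = e * f" by (auto elim: dvdE)
    then have "e > 0" "f > 0" using n by auto
    then have "(\<Sum>d | d dvd n div e. mu d) = (if e = n then 1 else 0)" using sum_mu_divisors[of f] f by auto
    then show "(\<Sum>d | d dvd n div e. mu d * \<Lambda> e) = (if e = n then \<Lambda> e else 0)" by (simp flip: sum_distrib_right)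
  qed
  also have "\<dots> = \<Lambda> n" using fin by simp
  finally have 1: "(\<Sum>d | d dvd n. mu d * ln (real (n div d))) = \<Lambda> n" .
  have "(\<Sum>d | d dvd n. mu d * ln (real d)) + (\<Sum>d | d dvd n. mu d * ln (real (n div d))) = (\<Sum>d | d dvd n. mu d * ln (real n))"
    unfolding sum.distrib[symmetric]
  proof (rule sum.cong[OF refl])
    fix d assume "d \<in> {d. d dvd n}"
    then obtain f where f: "n = d * f" by (auto elim: dvdE)
    then have "d > 0" "f > 0" using n by auto
    then show "mu d * ln (real d) + mu d * ln (real (n div d)) = mu d * ln (real n)"
      using f by (simp add: ln_mult algebra_simps)
  qed
  also have "\<dots> = (\<Sum>d | d dvd n. mu d) * ln (real n)" by (simp add: sum_distrib_right)
  also have "\<dots> = 0" using sum_mu_divisors[OF n] by simp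
  finally show ?thesis using 1 by simp
qed

section \<open>The value L(1, \<xi>) and the twisted Mangoldt sums\<close>

definition Lpart :: "(nat \<Rightarrow> complex) \<Rightarrow> nat \<Rightarrow> complex" where "Lpart \<xi> N = (\<Sum>n=1..N. \<xi> n / of_nat n)"
text \<open>For \<open>chi0 l\<close> the partial sums diverge and \<open>lim\<close> has no
  meaning, so statements about this value assume \<xi> \<noteq> chi0 l.\<close>

definition Lval :: "(nat \<Rightarrow> complex) \<Rightarrow> complex" where "Lval \<xi> = lim (Lpart \<xi>)"
text \<open>Partial sums of the Dirichlet series of -L'/L at 1.\<close>

definition Mpart :: "(nat \<Rightarrow> complex) \<Rightarrow> nat \<Rightarrow> complex" where "Mpart \<xi> N = (\<Sum>n=1..N. \<xi> n * of_real (\<Lambda> n / real n))"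

lemma dchar_convolution:
  assumes "l \<ge> 2" "\<xi> \<in> dchars l"
  shows "(\<Sum>n=1..N. \<xi> n / of_nat n * (\<Sum>d | d dvd n. F d (n div d))) =
    (\<Sum>d=1..N. \<xi> d / of_nat d * (\<Sum>m=1..N div d. \<xi> m / of_nat m * F d m))"
proof -
  have "(\<Sum>n=1..N. \<xi> n / of_nat n * (\<Sum>d | d dvd n. F d (n div d))) =
     (\<Sum>n=1..N. \<Sum>d | d dvd n. \<xi> d / of_nat d * (\<xi> (n div d) / of_nat (n div d) * F d (n div d)))"
    unfolding sum_distrib_left
  proof (intro sum.cong refl)
    fix n d assume "n \<in> {1..N}" "d \<in> {d. d dvd n}"
    then obtain m where m: "n = d * m" "d > 0" "m > 0" by (auto elim!: dvdE)
    then show "\<xi> n / of_nat n * F d (n div d) = \<xi> d / of_nat d * (\<xi> (n div d) / of_nat (n div d) * F d (n div d))"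
      by (simp add: dchar_mult[OF assms])
  qed
  also have "\<dots> = (\<Sum>d=1..N. \<Sum>m=1..N div d. \<xi> d / of_nat d * (\<xi> m / of_nat m * F d m))"
    by (rule sum_divisors_swap)
  finally show ?thesis by (simp add: sum_distrib_left)
qed

lemma Lpart_scaled: "(\<Sum>m=1..M. \<xi> m / of_nat m * K) = Lpart \<xi> M * K"
  by (simp add: Lpart_def sum_distrib_right)

lemma div_Suc_bound:
  assumes "d \<ge> 1" "N \<ge> 1" shows "1 / (real (N div d) + 1) \<le> real d / real N"
proof -
  have "N < d * (N div d + 1)" using assms dividend_less_times_div[of d N] by simp
  then have "real N < real (d * (N div d + 1))" by (simp only: of_nat_less_iff)
  then show ?thesis using assms by (simp add: field_simps)
qed

context
  fixes l :: nat and \<xi> :: "nat \<Rightarrow> complex"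
  assumes l: "l \<ge> 2" and xi: "\<xi> \<in> dchars l" and ne: "\<xi> \<noteq> chi0 l"
begin

lemma dchar_sum_periodic: "(\<Sum>n<M + l. \<xi> n) = (\<Sum>n<M. \<xi> n)"
proof (induction M)
  case 0
  then show ?case using sum_dchar_period[OF l xi ne] by simp
next
  case (Suc M)
  then show ?case using dchar_cong[OF l xi, of "M + l" M] by (simp add: Cong.cong_def)
qed

lemma norm_dchar_sum: "norm (\<Sum>n<N. \<xi> n) \<le> real l"
proof (induction N rule: less_induct)
  case (less N)
  show ?case
  proof (cases "N < l")
    case True
    have "norm (\<Sum>n<N. \<xi> n) \<le> (\<Sum>n<N. 1)" by (intro norm_sum[THEN order_trans] sum_mono dchar_norm_le[OF l xi])
    then show ?thesis using True by simp
  next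
    case False
    then show ?thesis using less[of "N - l"] dchar_sum_periodic[of "N - l"] l by simp
  qed
qed

lemma norm_dchar_interval: "norm (\<Sum>n=m..k. \<xi> n) \<le> 2 * real l"
proof (cases "m \<le> k")
  case True
  have "{..<Suc k} = {..<m} \<union> {m..k}" using True by auto
  then have "(\<Sum>n<Suc k. \<xi> n) = (\<Sum>n\<in>{..<m} \<union> {m..k}. \<xi> n)" by (simp only:)
  also have "\<dots> = (\<Sum>n<m. \<xi> n) + (\<Sum>n=m..k. \<xi> n)" by (rule sum.union_disjoint) auto
  finally have "(\<Sum>n<Suc k. \<xi> n) = (\<Sum>n<m. \<xi> n) + (\<Sum>n=m..k. \<xi> n)" .
  then have "(\<Sum>n=m..k. \<xi> n) = (\<Sum>n<Suc k. \<xi> n) - (\<Sum>n<m. \<xi> n)" by simp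
  then have "norm (\<Sum>n=m..k. \<xi> n) \<le> norm (\<Sum>n<Suc k. \<xi> n) + norm (\<Sum>n<m. \<xi> n)"
    by (simp only: norm_triangle_ineq4)
  then show ?thesis using norm_dchar_sum[of "Suc k"] norm_dchar_sum[of m] by linarith
qed auto

lemma dchar_abel:
  assumes "\<And>i. m \<le> i \<Longrightarrow> i < n \<Longrightarrow> f (Suc i) \<le> f i" "\<And>i. m \<le> i \<Longrightarrow> 0 \<le> f i"
  shows "norm (\<Sum>i=m..n. f i *\<^sub>R \<xi> i) \<le> 2 * real l * f m"
proof (cases "m \<le> n")
  case True
  then show ?thesis using assms by (intro abel_antimono norm_dchar_interval) auto
next
  case False
  then show ?thesis using assms(2)[of m] by simp
qed

lemma Lpart_diff: "m \<le> n \<Longrightarrow> norm (Lpart \<xi> n - Lpart \<xi> m) \<le> 2 * real l / (real m + 1)"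
proof -
  assume "m \<le> n"
  then have "Lpart \<xi> n = Lpart \<xi> m + (\<Sum>i=Suc m..n. \<xi> i / of_nat i)"
    unfolding Lpart_def using sum.ub_add_nat[of 1 m "\<lambda>i. \<xi> i / of_nat i" "n - m"] by simp
  then have "Lpart \<xi> n - Lpart \<xi> m = (\<Sum>i=Suc m..n. (1 / real i) *\<^sub>R \<xi> i)"
    by (simp add: scaleR_conv_of_real)
  also have "norm \<dots> \<le> 2 * real l * (1 / real (Suc m))"
    by (intro dchar_abel) (auto intro!: divide_left_mono)
  finally show ?thesis by (simp add: add.commute)
qed

lemma Lpart_tendsto: "Lpart \<xi> \<longlonglongrightarrow> Lval \<xi>"
proof -
  have "Cauchy (Lpart \<xi>)"
  proof (rule CauchyI)
    fix e :: real assume e: "e > 0"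
    obtain M :: nat where M: "2 * real l / e < real M" using reals_Archimedean2 by blast
    have "2 * real l < e * (real M + 1)" using M e by (simp add: field_simps)
    then have M': "2 * real l / (real M + 1) < e" by (simp add: pos_divide_less_eq)
    have *: "norm (Lpart \<xi> n - Lpart \<xi> m) < e" if "M \<le> m" "m \<le> n" for m n
    proof -
      have "norm (Lpart \<xi> n - Lpart \<xi> m) \<le> 2 * real l / (real m + 1)" by (rule Lpart_diff[OF that(2)])
      also have "\<dots> \<le> 2 * real l / (real M + 1)" using that by (intro divide_left_mono) auto
      finally show ?thesis using M' by linarith
    qed
    show "\<exists>M. \<forall>m\<ge>M. \<forall>n\<ge>M. norm (Lpart \<xi> m - Lpart \<xi> n) < e"
    proof (intro exI[of _ M] allI impI)
      fix m n assume "M \<le> m" "M \<le> n"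
      then show "norm (Lpart \<xi> m - Lpart \<xi> n) < e" using *[of m n] *[of n m]
        by (cases "m \<le> n") (auto simp: norm_minus_commute)
    qed
  qed
  then have "convergent (Lpart \<xi>)" by (rule Cauchy_convergent)
  then show ?thesis unfolding Lval_def by (simp add: convergent_LIMSEQ_iff)
qed

lemma Lpart_Lval: "norm (Lpart \<xi> m - Lval \<xi>) \<le> 2 * real l / (real m + 1)"
proof (rule Lim_norm_ubound[of sequentially])
  show "(\<lambda>n. Lpart \<xi> m - Lpart \<xi> n) \<longlonglongrightarrow> Lpart \<xi> m - Lval \<xi>"
    by (intro tendsto_intros Lpart_tendsto)
  show "\<forall>\<^sub>F n in sequentially. norm (Lpart \<xi> m - Lpart \<xi> n) \<le> 2 * real l / (real m + 1)"
    using Lpart_diff[of m] by (intro eventually_sequentiallyI[of m]) (simp add: norm_minus_commute)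
qed auto

lemma Lval_cnj: "Lval (\<lambda>n. cnj (\<xi> n)) = cnj (Lval \<xi>)"
proof -
  have "(\<lambda>N. cnj (Lpart \<xi> N)) \<longlonglongrightarrow> cnj (Lval \<xi>)" by (intro tendsto_intros Lpart_tendsto)
  moreover have "(\<lambda>N. cnj (Lpart \<xi> N)) = Lpart (\<lambda>n. cnj (\<xi> n))" by (auto simp: Lpart_def)
  ultimately show ?thesis unfolding Lval_def[of "\<lambda>n. cnj (\<xi> n)"] by (auto intro: limI)
qed

text \<open>The weight ln n / n decreases only once n exceeds e, so n = 1 and n = 2 are bounded
  separately and Abel summation starts at 3.\<close>

lemma dchar_sum_ln_bounded: "\<exists>C. \<forall>N. norm (\<Sum>n=1..N. \<xi> n / of_nat n * of_real (ln (real n))) \<le> C"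
proof -
  have tail: "norm (\<Sum>n=3..N. \<xi> n / of_nat n * of_real (ln (real n))) \<le> 2 * real l * (ln 3 / 3)" for N
  proof -
    have "norm (\<Sum>n=3..N. (ln (real n) / real n) *\<^sub>R \<xi> n) \<le> 2 * real l * (ln (real 3) / real 3)"
    proof (rule dchar_abel)
      fix i :: nat assume i: "3 \<le> i"
      have "exp 1 \<le> real i" using exp_le i by linarith
      then have "1 \<le> ln (real i)" using i by (simp add: ln_ge_iff)
      have "real i * (ln (real i + 1) - ln (real i)) \<le> real i * (1 / real i)"
        using i by (intro mult_left_mono ln_diff_bounds(2)) auto
      also have "\<dots> \<le> ln (real i)" using i \<open>1 \<le> ln (real i)\<close> by simp
      finally have "real i * ln (real i + 1) \<le> (real i + 1) * ln (real i)" by (simp add: algebra_simps)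
      then show "ln (real (Suc i)) / real (Suc i) \<le> ln (real i) / real i" using i by (simp add: field_simps)
    qed auto
    then show ?thesis by (simp add: scaleR_conv_of_real mult_ac)
  qed
  have "norm (\<Sum>n=1..N. \<xi> n / of_nat n * of_real (ln (real n))) \<le> 2 + 2 * real l * (ln 3 / 3)" for N
  proof -
    have sub: "(\<Sum>n=1..N. \<xi> n / of_nat n * of_real (ln (real n))) =
      (\<Sum>n\<in>{1..N} \<inter> {1,2}. \<xi> n / of_nat n * of_real (ln (real n))) + (\<Sum>n=3..N. \<xi> n / of_nat n * of_real (ln (real n)))"
      by (subst sum.union_disjoint[symmetric]) (auto intro!: sum.cong)
    have "norm (\<Sum>n\<in>{1..N} \<inter> {1,2}. \<xi> n / of_nat n * of_real (ln (real n))) \<le> (\<Sum>n\<in>{1..N} \<inter> {1,2::nat}. 1)"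
    proof (rule norm_sum[THEN order_trans], rule sum_mono)
      fix n :: nat assume "n \<in> {1..N} \<inter> {1,2}"
      then have n: "n \<ge> 1" by auto
      then have "ln (real n) \<le> real n" using ln_le_minus_one[of "real n"] by simp
      then have "norm (\<xi> n) * (\<bar>ln (real n)\<bar> / real n) \<le> 1 * 1"
        using n dchar_norm_le[OF l xi, of n] by (intro mult_mono) auto
      then show "norm (\<xi> n / of_nat n * of_real (ln (real n))) \<le> 1" by (simp add: norm_mult norm_divide)
    qed
    also have "\<dots> \<le> real (card {1,2::nat})" by (simp only: sum_constant mult_1_right of_nat_le_iff) (intro card_mono, auto)
    finally have "norm (\<Sum>n\<in>{1..N} \<inter> {1,2}. \<xi> n / of_nat n * of_real (ln (real n))) \<le> 2" by simp
    then show ?thesis unfolding sub using norm_triangle_le[OF add_mono] tail[of N] by blast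
  qed
  then show ?thesis by blast
qed

text \<open>Expanding ln by \<Lambda> turns the bounded sum of \<xi>(n) ln n / n into the sum of
  \<xi>(d) \<Lambda>(d)/d times \<open>Lpart\<close> at N/d. Replacing that factor by its limit
  costs O(d/N) for each d, in total O(psi(N)/N) = O(1); then divide by the limit.\<close>

lemma Mpart_bounded:
  assumes "Lval \<xi> \<noteq> 0" shows "\<exists>C. \<forall>N\<ge>1. norm (Mpart \<xi> N) \<le> C"
proof -
  obtain C where C: "\<And>N. norm (\<Sum>n=1..N. \<xi> n / of_nat n * of_real (ln (real n))) \<le> C"
    using dchar_sum_ln_bounded by blast
  have "norm (Mpart \<xi> N) \<le> (C + 16 * real l) / norm (Lval \<xi>)" if N: "N \<ge> 1" for N
  proof -
    have "(\<Sum>n=1..N. \<xi> n / of_nat n * of_real (ln (real n))) = (\<Sum>n=1..N. \<xi> n / of_nat n * (\<Sum>d | d dvd n. of_real (\<Lambda> d)))"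
      using mangoldt_sum[where 'a = complex] by (intro sum.cong refl) auto
    also have "\<dots> = (\<Sum>d=1..N. \<xi> d / of_nat d * (\<Sum>m=1..N div d. \<xi> m / of_nat m * of_real (\<Lambda> d)))"
      by (rule dchar_convolution[OF l xi])
    also have "\<dots> = (\<Sum>d=1..N. \<xi> d * of_real (\<Lambda> d / real d) * Lpart \<xi> (N div d))"
      unfolding Lpart_scaled by (intro sum.cong refl) (simp add: mult_ac)
    finally have "(\<Sum>n=1..N. \<xi> n / of_nat n * of_real (ln (real n))) - Mpart \<xi> N * Lval \<xi> =
       (\<Sum>d=1..N. \<xi> d * of_real (\<Lambda> d / real d) * (Lpart \<xi> (N div d) - Lval \<xi>))"
      by (simp add: Mpart_def sum_distrib_right right_diff_distrib sum_subtractf)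
    also have "norm \<dots> \<le> (\<Sum>d=1..N. 2 * real l / real N * \<Lambda> d)"
    proof (rule norm_sum[THEN order_trans], rule sum_mono)
      fix d assume d: "d \<in> {1..N}"
      have "norm (Lpart \<xi> (N div d) - Lval \<xi>) \<le> 2 * real l * (1 / (real (N div d) + 1))" using Lpart_Lval[of "N div d"] by simp
      also have "\<dots> \<le> 2 * real l * (real d / real N)" using d N by (intro mult_left_mono div_Suc_bound) auto
      finally have "norm (\<xi> d) * (\<Lambda> d / real d) * norm (Lpart \<xi> (N div d) - Lval \<xi>) \<le> 1 * (\<Lambda> d / real d) * (2 * real l * (real d / real N))"
        using dchar_norm_le[OF l xi, of d] by (intro mult_mono mult_nonneg_nonneg divide_nonneg_nonneg mangoldt_nonneg) auto
      also have "\<dots> = 2 * real l / real N * \<Lambda> d" using d by simp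
      finally show "norm (\<xi> d * of_real (\<Lambda> d / real d) * (Lpart \<xi> (N div d) - Lval \<xi>)) \<le> 2 * real l / real N * \<Lambda> d"
        by (simp add: norm_mult norm_divide mangoldt_nonneg del: of_real_mangoldt)
    qed
    also have "\<dots> = 2 * real l / real N * psi N" by (simp add: psi_def sum_distrib_left)
    also have "\<dots> \<le> 2 * real l / real N * (8 * real N)" by (intro mult_left_mono chebyshev_psi) auto
    also have "\<dots> = 16 * real l" using N by simp
    finally have 1: "norm ((\<Sum>n=1..N. \<xi> n / of_nat n * of_real (ln (real n))) - Mpart \<xi> N * Lval \<xi>) \<le> 16 * real l" .
    have "norm (Mpart \<xi> N * Lval \<xi>) \<le> norm (\<Sum>n=1..N. \<xi> n / of_nat n * of_real (ln (real n))) +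
       norm ((\<Sum>n=1..N. \<xi> n / of_nat n * of_real (ln (real n))) - Mpart \<xi> N * Lval \<xi>)"
      using norm_triangle_ineq2[of "Mpart \<xi> N * Lval \<xi>" "\<Sum>n=1..N. \<xi> n / of_nat n * of_real (ln (real n))"]
        norm_minus_commute[of "Mpart \<xi> N * Lval \<xi>" "\<Sum>n=1..N. \<xi> n / of_nat n * of_real (ln (real n))"] by linarith
    then have "norm (Mpart \<xi> N) * norm (Lval \<xi>) \<le> C + 16 * real l" using 1 C[of N] by (simp add: norm_mult)
    then show ?thesis using assms by (simp add: field_simps)
  qed
  then show ?thesis by blast
qed

text \<open>The divisor sum of \<mu>(d) ln (N/d) is \<Lambda>(n), plus ln N for n = 1. If the limit
  is 0, \<open>Lpart\<close> at N/d is itself O(d/N), and what remains is 1/N times the sum of ln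
  (N/d), which is at most 1.\<close>

lemma Mpart_zero:
  assumes "Lval \<xi> = 0" "N \<ge> 1" shows "norm (Mpart \<xi> N + of_real (ln (real N))) \<le> 2 * real l"
proof -
  have "Mpart \<xi> N + of_real (ln (real N)) =
    (\<Sum>n=1..N. \<xi> n / of_nat n * (\<Sum>d | d dvd n. of_real (mu d * (ln (real N) - ln (real d)))))"
  proof -
    have "(\<Sum>n=1..N. \<xi> n / of_nat n * (\<Sum>d | d dvd n. of_real (mu d * (ln (real N) - ln (real d))))) =
      (\<Sum>n=1..N. \<xi> n * of_real (\<Lambda> n / real n) + (if n = 1 then of_real (ln (real N)) else 0))"
    proof (rule sum.cong[OF refl])
      fix n assume n: "n \<in> {1..N}"
      have "(\<Sum>d | d dvd n. mu d * (ln (real N) - ln (real d))) = (\<Sum>d | d dvd n. mu d) * ln (real N) + \<Lambda> n"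
        using sum_mu_ln[of n] n by (simp add: right_diff_distrib sum_subtractf sum_distrib_right)
      then have *: "(\<Sum>d | d dvd n. complex_of_real (mu d * (ln (real N) - ln (real d)))) =
          of_real ((if n = 1 then 1 else 0) * ln (real N) + \<Lambda> n)"
        using sum_mu_divisors[of n] n by (simp only: of_real_sum[symmetric]) simp
      show "\<xi> n / of_nat n * (\<Sum>d | d dvd n. of_real (mu d * (ln (real N) - ln (real d)))) =
         \<xi> n * of_real (\<Lambda> n / real n) + (if n = 1 then of_real (ln (real N)) else 0)"
        unfolding * using dchar_1[OF l xi] by simp
    qed
    also have "\<dots> = Mpart \<xi> N + of_real (ln (real N))"
      using assms(2) by (simp add: sum.distrib Mpart_def)
    finally show ?thesis by simp
  qed
  also have "\<dots> = (\<Sum>d=1..N. \<xi> d / of_nat d * (\<Sum>m=1..N div d. \<xi> m / of_nat m * of_real (mu d * (ln (real N) - ln (real d)))))"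
    by (rule dchar_convolution[OF l xi])
  also have "\<dots> = (\<Sum>d=1..N. \<xi> d * of_real (mu d * ((ln (real N) - ln (real d)) / real d)) * Lpart \<xi> (N div d))"
    unfolding Lpart_scaled by (intro sum.cong refl) (simp add: mult_ac)
  also have "norm \<dots> \<le> (\<Sum>d=1..N. 2 * real l / real N * (ln (real N) - ln (real d)))"
  proof (rule norm_sum[THEN order_trans], rule sum_mono)
    fix d assume d: "d \<in> {1..N}"
    have ln: "0 \<le> ln (real N) - ln (real d)" using d by (simp add: ln_mono)
    have "norm (Lpart \<xi> (N div d)) \<le> 2 * real l * (1 / (real (N div d) + 1))" using Lpart_Lval[of "N div d"] assms by simp
    also have "\<dots> \<le> 2 * real l * (real d / real N)" using d assms by (intro mult_left_mono div_Suc_bound) auto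
    finally have "norm (\<xi> d) * (\<bar>mu d\<bar> * ((ln (real N) - ln (real d)) / real d)) * norm (Lpart \<xi> (N div d))
       \<le> 1 * (1 * ((ln (real N) - ln (real d)) / real d)) * (2 * real l * (real d / real N))"
      using dchar_norm_le[OF l xi, of d] abs_mu_le[of d] ln by (intro mult_mono) auto
    also have "\<dots> = 2 * real l / real N * (ln (real N) - ln (real d))" using d by simp
    finally show "norm (\<xi> d * of_real (mu d * ((ln (real N) - ln (real d)) / real d)) * Lpart \<xi> (N div d))
        \<le> 2 * real l / real N * (ln (real N) - ln (real d))"
      using ln by (simp add: norm_mult abs_mult del: of_real_mult of_real_divide)
  qed
  also have "\<dots> = 2 * real l / real N * (\<Sum>d=1..N. ln (real N) - ln (real d))" by (simp add: sum_distrib_left)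
  also have "\<dots> \<le> 2 * real l / real N * real N"
    using sum_ln_quotient[of "real N"] assms by (intro mult_left_mono) auto
  also have "\<dots> = 2 * real l" using assms by simp
  finally show ?thesis .
qed

end

section \<open>Nonvanishing of L(1, \<xi>) for real characters\<close>

lemma harmonic_ge: "ln (real N + 1) \<le> (\<Sum>n=1..N. 1 / real n)"
proof (induction N)
  case (Suc N)
  then show ?case using ln_diff_bounds(2)[of "Suc N"] by (simp add: add.commute)
qed auto

definition sqrt_sum :: "nat \<Rightarrow> real" where "sqrt_sum K = (\<Sum>m=1..K. 1 / sqrt (real m))"

lemma sqrt_diff: "2 * (sqrt (real K + 1) - sqrt (real K)) * (sqrt (real K + 1) + sqrt (real K)) = 2"
  by (simp add: algebra_simps)

lemma sqrt_sum_step: "1 / sqrt (real K + 1) \<le> 2 * (sqrt (real K + 1) - sqrt (real K))"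
  and sqrt_sum_step': "K \<ge> 1 \<Longrightarrow> 2 * (sqrt (real K + 1) - sqrt (real K)) \<le> 1 / sqrt (real K)"
proof -
  have p: "sqrt (real K + 1) > 0" "sqrt (real K) \<le> sqrt (real K + 1)" "sqrt (real K) \<ge> 0" by auto
  have pp: "sqrt (real K + 1) + sqrt (real K) > 0" by (rule add_pos_nonneg[OF p(1,3)])
  have eq: "2 * (sqrt (real K + 1) - sqrt (real K)) = 2 / (sqrt (real K + 1) + sqrt (real K))"
    using sqrt_diff[of K] p by (subst eq_divide_eq) (simp add: add_pos_nonneg less_imp_neq[symmetric])
  have "2 / (2 * sqrt (real K + 1)) \<le> 2 / (sqrt (real K + 1) + sqrt (real K))"
    using p pp by (intro divide_left_mono mult_pos_pos) linarith+
  then show "1 / sqrt (real K + 1) \<le> 2 * (sqrt (real K + 1) - sqrt (real K))" unfolding eq by simp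
  show "2 * (sqrt (real K + 1) - sqrt (real K)) \<le> 1 / sqrt (real K)" if "K \<ge> 1"
  proof -
    have "2 / (sqrt (real K + 1) + sqrt (real K)) \<le> 2 / (2 * sqrt (real K))"
      using p pp that by (intro divide_left_mono mult_pos_pos) auto
    then show ?thesis unfolding eq by simp
  qed
qed

lemma sqrt_sum_error_step: "sqrt_sum (Suc K) - 2 * sqrt (real (Suc K)) \<le> sqrt_sum K - 2 * sqrt (real K)"
  using sqrt_sum_step[of K] by (simp add: sqrt_sum_def add.commute)

text \<open>Along K = N^2 div d the error therefore increases with d; with its bounds -2 and 0 this
  makes it a weight for Abel summation.\<close>

lemma sqrt_sum_error_antimono: "K \<le> K' \<Longrightarrow> sqrt_sum K' - 2 * sqrt (real K') \<le> sqrt_sum K - 2 * sqrt (real K)"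
  by (rule lift_Suc_antimono_le[where f = "\<lambda>K. sqrt_sum K - 2 * sqrt (real K)"]) (rule sqrt_sum_error_step)

lemma sqrt_sum_bounds: "sqrt_sum K \<le> 2 * sqrt (real K)" "2 * sqrt (real K) - 2 \<le> sqrt_sum K"
proof -
  show "sqrt_sum K \<le> 2 * sqrt (real K)" using sqrt_sum_error_antimono[of 0 K] by (simp add: sqrt_sum_def)
  have "2 * sqrt (real K + 1) - 2 \<le> sqrt_sum K"
  proof (induction K)
    case (Suc K)
    then show ?case using sqrt_sum_step'[of "Suc K"] by (simp add: sqrt_sum_def add_ac)
  qed (simp add: sqrt_sum_def)
  moreover have "sqrt (real K) \<le> sqrt (real K + 1)" by simp
  ultimately show "2 * sqrt (real K) - 2 \<le> sqrt_sum K" by linarith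
qed

lemma sqrt_sum_mono: "K \<le> K' \<Longrightarrow> sqrt_sum K \<le> sqrt_sum K'"
  unfolding sqrt_sum_def by (rule sum_mono2) auto

lemma divisor_sum_prime_power_mult:
  fixes x :: "nat \<Rightarrow> real"
  assumes mult: "\<And>m n. x (m * n) = x m * x n" and p: "prime p" "\<not> p dvd m" "m > 0"
  shows "(\<Sum>d | d dvd p ^ e * m. x d) = (\<Sum>i\<le>e. x (p ^ i)) * (\<Sum>d | d dvd m. x d)"
proof -
  have p0: "p > 0" using p prime_gt_0_nat by blast
  have "bij_betw (\<lambda>(i,d). p ^ i * d) ({..e} \<times> {d. d dvd m}) {d. d dvd p ^ e * m}"
  proof (rule bij_betw_imageI)
    show "inj_on (\<lambda>(i,d). p ^ i * d) ({..e} \<times> {d. d dvd m})"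
    proof (rule inj_onI, clarify)
      fix i d j d' assume *: "d dvd m" "d' dvd m" "p ^ i * d = p ^ j * d'"
      have nd: "\<not> p dvd d" "\<not> p dvd d'" using * p dvd_trans by blast+
      have aux: "\<not> a < b" if "\<not> p dvd u" "p ^ a * u = p ^ b * v" for a b u v
      proof
        assume "a < b"
        then have "p ^ b = p ^ a * (p * p ^ (b - a - 1))" by (simp flip: power_Suc power_add)
        then have "u = p * (p ^ (b - a - 1) * v)" using that(2) p0 by (simp add: mult.assoc)
        then show False using that(1) by simp
      qed
      have "i = j" using aux[OF nd(1) *(3)] aux[OF nd(2) *(3)[symmetric]] by simp
      then show "i = j \<and> d = d'" using * p0 by simp
    qed
    show "(\<lambda>(i,d). p ^ i * d) ` ({..e} \<times> {d. d dvd m}) = {d. d dvd p ^ e * m}"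
    proof (intro equalityI subsetI)
      fix D assume "D \<in> {d. d dvd p ^ e * m}"
      then have D: "D dvd p ^ e * m" by simp
      then have D0: "D \<noteq> 0" using p0 p(3) by (auto intro: Nat.gr0I)
      obtain d where d: "D = p ^ multiplicity p D * d" "\<not> p dvd d"
        using multiplicity_decompose'[of D p] D0 prime_gt_1_nat[OF p(1)] by (metis nat_dvd_1_iff_1 less_not_refl)
      define i where "i = multiplicity p D"
      have "p ^ i dvd p ^ e * m" "d dvd p ^ e * m" using d D by (metis i_def dvd_mult_left, metis dvd_mult_right)
      moreover have "coprime (p ^ i) m" "coprime d (p ^ e)"
        using p d prime_imp_coprime[OF p(1) p(2)] prime_imp_coprime[OF p(1) d(2)] by (auto simp: coprime_commute)
      ultimately have "p ^ i dvd p ^ e" "d dvd m"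
        by (simp_all add: coprime_dvd_mult_left_iff coprime_dvd_mult_right_iff)
      then have "i \<le> e" using prime_gt_1_nat[OF p(1)] by (simp add: power_dvd_imp_le)
      then show "D \<in> (\<lambda>(i,d). p ^ i * d) ` ({..e} \<times> {d. d dvd m})"
        using \<open>d dvd m\<close> d(1) by (intro image_eqI[of _ _ "(i,d)"]) (auto simp: i_def)
    qed (auto intro!: mult_dvd_mono le_imp_power_dvd)
  qed
  then have "(\<Sum>d | d dvd p ^ e * m. x d) = (\<Sum>(i,d)\<in>{..e} \<times> {d. d dvd m}. x (p ^ i * d))"
    by (subst sum.reindex_bij_betw[symmetric]) (auto simp: case_prod_unfold)
  also have "\<dots> = (\<Sum>i\<le>e. \<Sum>d | d dvd m. x (p ^ i) * x d)"
    by (simp add: mult sum.cartesian_product)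
  finally show ?thesis by (simp add: sum_product)
qed

lemma sum_sign_powers:
  fixes y :: real
  assumes "y = 0 \<or> \<bar>y\<bar> = 1"
  shows "0 \<le> (\<Sum>i\<le>e. y ^ i)" "even e \<Longrightarrow> 1 \<le> (\<Sum>i\<le>e. y ^ i)"
proof -
  have neg: "(\<Sum>i\<le>e. (-1::real) ^ i) = (if even e then 1 else 0)" by (induction e) auto
  have zero: "(\<Sum>i\<le>e. (0::real) ^ i) = 1" by (induction e) auto
  have "y = 0 \<or> y = 1 \<or> y = -1" using assms by (auto simp: abs_if split: if_splits)
  then show "0 \<le> (\<Sum>i\<le>e. y ^ i)" "even e \<Longrightarrow> 1 \<le> (\<Sum>i\<le>e. y ^ i)" using neg zero by auto
qed

text \<open>Multiplicativity reduces the claim to prime powers, where y = x(p) is 0, 1 or -1 and the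
  sum of y^i for i <= e is 1, e + 1, or 1 or 0 by the parity of e. In a square all exponents are
  even.\<close>

lemma divisor_sum_nonneg:
  fixes x :: "nat \<Rightarrow> real"
  assumes mult: "\<And>m n. x (m * n) = x m * x n" and one: "x 1 = 1" and sign: "\<And>n. x n = 0 \<or> \<bar>x n\<bar> = 1" and n: "n > 0"
  shows "0 \<le> (\<Sum>d | d dvd n. x d)" "1 \<le> (\<Sum>d | d dvd n ^ 2. x d)"
proof -
  have pow: "x (p ^ i) = x p ^ i" for p i using one by (induction i) (simp_all add: mult)
  have "0 \<le> (\<Sum>d | d dvd n. x d) \<and> 1 \<le> (\<Sum>d | d dvd n ^ 2. x d)" using n
  proof (induction n rule: less_induct)
    case (less n)
    show ?case
    proof (cases "n = 1")
      case True
      then have "{d. d dvd n} = {1}" "{d. d dvd n ^ 2} = {1}" by auto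
      then show ?thesis using one by simp
    next
      case False
      then obtain p where p: "prime p" "p dvd n" using prime_factor_nat by blast
      obtain m where m: "n = p ^ multiplicity p n * m" "\<not> p dvd m"
        using multiplicity_decompose'[of n p] less.prems prime_gt_1_nat[OF p(1)] by (metis nat_dvd_1_iff_1 less_not_refl)
      define e where "e = multiplicity p n"
      have ne: "n = p ^ e * m" unfolding e_def by (rule m(1))
      have e: "e > 0" using p less.prems by (simp add: e_def prime_multiplicity_gt_zero_iff)
      have m0: "m > 0" using ne less.prems by (auto intro: Nat.gr0I)
      have "p ^ e \<ge> 2" using prime_ge_2_nat[OF p(1)] self_le_power[of p e] e by linarith
      then have "m < n" using ne m0 by simp
      then have IH: "0 \<le> (\<Sum>d | d dvd m. x d)" "1 \<le> (\<Sum>d | d dvd m ^ 2. x d)" using less.IH m0 by auto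
      have 1: "(\<Sum>d | d dvd n. x d) = (\<Sum>i\<le>e. x p ^ i) * (\<Sum>d | d dvd m. x d)"
        unfolding ne using divisor_sum_prime_power_mult[OF mult p(1) m(2) m0] by (simp add: pow)
      have "n ^ 2 = p ^ (2 * e) * m ^ 2" unfolding ne by (simp add: power_mult_distrib mult.commute flip: power_mult)
      moreover have "\<not> p dvd m ^ 2" using m(2) p(1) prime_dvd_power by blast
      ultimately have 2: "(\<Sum>d | d dvd n ^ 2. x d) = (\<Sum>i\<le>2 * e. x p ^ i) * (\<Sum>d | d dvd m ^ 2. x d)"
        using divisor_sum_prime_power_mult[OF mult p(1), of "m ^ 2" "2 * e"] m0 by (simp add: pow)
      have "1 * 1 \<le> (\<Sum>i\<le>2 * e. x p ^ i) * (\<Sum>d | d dvd m ^ 2. x d)"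
        using sum_sign_powers(2)[OF sign[of p], of "2 * e"] IH by (intro mult_mono) auto
      then show ?thesis unfolding 1 2 using sum_sign_powers(1)[OF sign[of p], of e] IH by simp
    qed
  qed
  then show "0 \<le> (\<Sum>d | d dvd n. x d)" "1 \<le> (\<Sum>d | d dvd n ^ 2. x d)" by auto
qed

text \<open>
  The divisor sums \<open>r(n) = \<Sum>d | n. \<xi>(d)\<close> are nonnegative, and at least 1 at squares, so
  \<open>\<Sum>n\<le>N\<^sup>2. r(n) / \<surd>n\<close> exceeds \<open>ln N\<close>; summed over \<open>d\<close> first, it is \<open>2 N L(1, \<xi>) + O(1)\<close>.
\<close>

lemma real_dchar_nonvanishing:
  assumes l: "l \<ge> 2" and xi: "\<xi> \<in> dchars l" and ne: "\<xi> \<noteq> chi0 l" and real: "\<And>n. cnj (\<xi> n) = \<xi> n"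
  shows "Lval \<xi> \<noteq> 0"
proof
  assume L0: "Lval \<xi> = 0"
  define x where "x = (\<lambda>n. Re (\<xi> n))"
  have xi_eq: "\<xi> n = of_real (x n)" for n using real[of n] by (simp add: x_def complex_eq_iff)
  have mult: "x (m * n) = x m * x n" for m n
    using dchar_mult[OF l xi, of m n] by (simp add: xi_eq flip: of_real_mult)
  have one: "x 1 = 1" using dchar_1[OF l xi] by (simp add: x_def)
  have sign: "x n = 0 \<or> \<bar>x n\<bar> = 1" for n
    using dchar_norm[OF l xi, of n] dchar_nonzero[OF l xi, of n] by (auto simp: xi_eq)
  have xle: "\<bar>x n\<bar> \<le> 1" for n using sign[of n] by auto
  have abel: "\<bar>\<Sum>i=m..n. f i * x i\<bar> \<le> 2 * real l * f m"
    if "\<And>i. m \<le> i \<Longrightarrow> i < n \<Longrightarrow> f (Suc i) \<le> f i" "\<And>i. m \<le> i \<Longrightarrow> 0 \<le> f i" for f m n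
  proof -
    have "(\<Sum>i=m..n. f i * x i) = Re (\<Sum>i=m..n. f i *\<^sub>R \<xi> i)" by (simp add: x_def)
    also have "\<bar>\<dots>\<bar> \<le> norm (\<Sum>i=m..n. f i *\<^sub>R \<xi> i)" by (rule abs_Re_le_cmod)
    also have "\<dots> \<le> 2 * real l * f m" using that by (rule dchar_abel[OF l xi ne])
    finally show ?thesis .
  qed
  define r where "r = (\<lambda>n. \<Sum>d | d dvd n. x d)"
  \<comment> \<open>With n = d m the sum over d is split at N. The losses are 4l for d > N, 12l for
    the error of \<open>sqrt_sum\<close>, and 4l + 2 for its main term.\<close>
  have upper: "(\<Sum>n=1..N\<^sup>2. r n / sqrt (real n)) \<le> 20 * real l + 2" if N: "N \<ge> 1" for N :: nat
  proof -
    define K where "K = (\<lambda>d. N\<^sup>2 div d)"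
    have Kanti: "K (Suc d) \<le> K d" if "d \<ge> 1" for d using that by (simp add: K_def div_le_mono2)
    have "(\<Sum>n=1..N\<^sup>2. r n / sqrt (real n)) = (\<Sum>n=1..N\<^sup>2. \<Sum>d | d dvd n. x d / sqrt (real d) * (1 / sqrt (real (n div d))))"
    proof (rule sum.cong[OF refl])
      fix n assume n: "n \<in> {1..N\<^sup>2}"
      show "r n / sqrt (real n) = (\<Sum>d | d dvd n. x d / sqrt (real d) * (1 / sqrt (real (n div d))))"
        unfolding r_def sum_divide_distrib
      proof (rule sum.cong[OF refl])
        fix d assume "d \<in> {d. d dvd n}"
        then obtain f where f: "n = d * f" by (auto elim: dvdE)
        then have "d > 0" using n by (auto intro: Nat.gr0I)
        then show "x d / sqrt (real n) = x d / sqrt (real d) * (1 / sqrt (real (n div d)))"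
          using f by (simp add: real_sqrt_mult)
      qed
    qed
    also have "\<dots> = (\<Sum>d=1..N\<^sup>2. \<Sum>m=1..K d. x d / sqrt (real d) * (1 / sqrt (real m)))"
      unfolding K_def by (rule sum_divisors_swap)
    also have "\<dots> = (\<Sum>d=1..N\<^sup>2. x d / sqrt (real d) * sqrt_sum (K d))"
      by (simp add: sqrt_sum_def sum_distrib_left)
    also have "\<dots> = (\<Sum>d=1..N. x d / sqrt (real d) * sqrt_sum (K d)) + (\<Sum>d=Suc N..N\<^sup>2. x d / sqrt (real d) * sqrt_sum (K d))"
      using N sum.ub_add_nat[of 1 N "\<lambda>d. x d / sqrt (real d) * sqrt_sum (K d)" "N\<^sup>2 - N"] by (simp add: power2_eq_square)
    finally have eq: "(\<Sum>n=1..N\<^sup>2. r n / sqrt (real n)) =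
       (\<Sum>d=1..N. x d / sqrt (real d) * sqrt_sum (K d)) + (\<Sum>d=Suc N..N\<^sup>2. x d / sqrt (real d) * sqrt_sum (K d))" .
    \<comment> \<open>For d > N the weight decreases in d and is at most 2 at d = N + 1, so Abel
      summation applies directly.\<close>
    have "\<bar>\<Sum>d=Suc N..N\<^sup>2. (sqrt_sum (K d) / sqrt (real d)) * x d\<bar> \<le> 2 * real l * (sqrt_sum (K (Suc N)) / sqrt (real (Suc N)))"
    proof (rule abel)
      fix d assume d: "Suc N \<le> d"
      show "0 \<le> sqrt_sum (K d) / sqrt (real d)" by (auto simp: sqrt_sum_def intro!: sum_nonneg divide_nonneg_nonneg)
      show "sqrt_sum (K (Suc d)) / sqrt (real (Suc d)) \<le> sqrt_sum (K d) / sqrt (real d)"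
        using d Kanti[of d] by (intro frac_le sqrt_sum_mono) (auto simp: sqrt_sum_def intro!: sum_nonneg)
    qed
    also have "\<dots> \<le> 2 * real l * 2"
    proof (rule mult_left_mono)
      have "N\<^sup>2 < (N + 1) * Suc N" by (simp add: power2_eq_square)
      then have "K (Suc N) \<le> N" unfolding K_def using less_mult_imp_div_less[of "N\<^sup>2" "N + 1" "Suc N"] by simp
      then have "sqrt_sum (K (Suc N)) \<le> 2 * sqrt (real (Suc N))"
        using sqrt_sum_bounds(1)[of "K (Suc N)"] by (meson order_trans le_SucI mult_left_mono of_nat_le_iff real_sqrt_le_iff zero_le_numeral)
      then show "sqrt_sum (K (Suc N)) / sqrt (real (Suc N)) \<le> 2" by (simp add: divide_le_eq)
    qed auto
    finally have p2: "\<bar>\<Sum>d=Suc N..N\<^sup>2. x d / sqrt (real d) * sqrt_sum (K d)\<bar> \<le> 4 * real l" by (simp add: mult.commute)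
    \<comment> \<open>For d <= N the weight itself is too large at small d; only its deviation from
      2 sqrt K, shifted by 2 into [0, 2], is summed by parts.\<close>
    define h where "h = (\<lambda>d. sqrt_sum (K d) - 2 * sqrt (real (K d)))"
    have U: "\<bar>\<Sum>d=1..k. x d / sqrt (real d)\<bar> \<le> 2 * real l" for k
    proof -
      have "\<bar>\<Sum>d=1..k. (1 / sqrt (real d)) * x d\<bar> \<le> 2 * real l * (1 / sqrt (real 1))"
        by (rule abel) (auto intro!: divide_left_mono mult_pos_pos)
      then show ?thesis by simp
    qed
    have a: "\<bar>\<Sum>d=1..N. x d / sqrt (real d) * h d\<bar> \<le> 12 * real l"
    proof -
      have "norm (\<Sum>d=1..N. (h d + 2) *\<^sub>R (x d / sqrt (real d))) \<le> 2 * (2 * real l) * 2"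
      proof (rule abel_mono)
        fix d :: nat assume "1 \<le> d"
        then show "h d + 2 \<le> h (Suc d) + 2" using sqrt_sum_error_antimono[OF Kanti[of d]] by (simp add: h_def)
      next
        show "0 \<le> h 1 + 2" using sqrt_sum_bounds(2)[of "K 1"] by (simp add: h_def)
        show "h N + 2 \<le> 2" using sqrt_sum_bounds(1)[of "K N"] by (simp add: h_def)
      qed (use N U in auto)
      moreover have "(\<Sum>d=1..N. x d / sqrt (real d) * h d) =
          (\<Sum>d=1..N. (h d + 2) *\<^sub>R (x d / sqrt (real d))) - 2 * (\<Sum>d=1..N. x d / sqrt (real d))"
        unfolding sum_distrib_left sum_subtractf[symmetric]
        by (intro sum.cong refl) (simp add: algebra_simps add_divide_distrib)
      ultimately show ?thesis using U[of N] by simp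
    qed
    have b: "\<bar>\<Sum>d=1..N. x d / sqrt (real d) * (2 * sqrt (real (K d)))\<bar> \<le> 4 * real l + 2"
    proof -
      \<comment> \<open>The assumption of a zero enters here: the truncated series is O(1/N), so the
        main term, 2N times it, stays bounded.\<close>
      have "norm (of_real (\<Sum>d=1..N. x d / real d) :: complex) \<le> 2 * real l / (real N + 1)"
        using Lpart_Lval[OF l xi ne, of N] L0 by (simp add: Lpart_def xi_eq)
      then have "\<bar>\<Sum>d=1..N. x d / real d\<bar> \<le> 2 * real l / (real N + 1)" by (simp only: norm_of_real)
      also have "\<dots> \<le> 2 * real l / real N" using N by (intro divide_left_mono) auto
      finally have 1: "\<bar>2 * real N * (\<Sum>d=1..N. x d / real d)\<bar> \<le> 4 * real l" using N by (simp add: abs_mult field_simps)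
      have "\<bar>\<Sum>d=1..N. x d / sqrt (real d) * (2 * (sqrt (real (K d)) - real N / sqrt (real d)))\<bar> \<le> (\<Sum>d=1..N. 2 / real N)"
      proof (rule order_trans[OF sum_abs sum_mono])
        fix d assume d: "d \<in> {1..N}"
        define A where "A = real N / sqrt (real d)"
        have d0: "sqrt (real d) > 0" using d by simp
        have A0: "A > 0" using d N by (simp add: A_def)
        have A2: "A * A = real (N\<^sup>2) / real d" using d by (simp add: A_def power2_eq_square)
        have K1: "real (K d) \<le> A * A" unfolding A2 K_def by (rule of_nat_div_le_of_nat)
        have "N\<^sup>2 < d * (K d + 1)" unfolding K_def using d dividend_less_times_div[of d "N\<^sup>2"] by simp
        then have "real (N\<^sup>2) < real (d * (K d + 1))" by (simp only: of_nat_less_iff)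
        then have K2: "A * A < real (K d) + 1" unfolding A2 using d by (simp add: field_simps)
        have sK: "sqrt (real (K d)) \<le> A" using K1 A0 by (intro real_le_lsqrt) (auto simp: power2_eq_square)
        \<comment> \<open>Difference of squares: rounding A^2 = N^2/d down changes it by at most 1,
          hence the root by at most 1/A.\<close>
        have "(A - sqrt (real (K d))) * A \<le> (A - sqrt (real (K d))) * (A + sqrt (real (K d)))"
          using sK by (intro mult_left_mono) auto
        also have "\<dots> = A * A - real (K d)" by (simp add: algebra_simps)
        also have "\<dots> \<le> 1" using K2 by simp
        finally have "A - sqrt (real (K d)) \<le> 1 / A" using A0 by (simp add: pos_le_divide_eq)
        then have dev: "\<bar>sqrt (real (K d)) - A\<bar> \<le> sqrt (real d) / real N" using sK by (simp add: A_def)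
        have "\<bar>x d / sqrt (real d) * (2 * (sqrt (real (K d)) - A))\<bar> = \<bar>x d\<bar> / sqrt (real d) * (2 * \<bar>sqrt (real (K d)) - A\<bar>)"
          by (simp add: abs_mult del: right_diff_distrib_numeral)
        also have "\<dots> \<le> 1 / sqrt (real d) * (2 * (sqrt (real d) / real N))"
          using dev xle[of d] d0 by (intro mult_mono divide_right_mono mult_left_mono) auto
        also have "\<dots> = 2 / real N" using d0 by simp
        finally show "\<bar>x d / sqrt (real d) * (2 * (sqrt (real (K d)) - real N / sqrt (real d)))\<bar> \<le> 2 / real N"
          by (simp add: A_def)
      qed
      also have "\<dots> = 2" using N by simp
      finally have 2: "\<bar>\<Sum>d=1..N. x d / sqrt (real d) * (2 * (sqrt (real (K d)) - real N / sqrt (real d)))\<bar> \<le> 2" .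
      have "(\<Sum>d=1..N. x d / sqrt (real d) * (2 * sqrt (real (K d)))) =
        (\<Sum>d=1..N. x d / sqrt (real d) * (2 * (sqrt (real (K d)) - real N / sqrt (real d)))) + 2 * real N * (\<Sum>d=1..N. x d / real d)"
        unfolding sum_distrib_left sum.distrib[symmetric]
      proof (intro sum.cong refl)
        fix d assume "d \<in> {1..N}"
        have "real N / sqrt (real d) / sqrt (real d) = real N / real d" by simp
        then show "x d / sqrt (real d) * (2 * sqrt (real (K d))) =
          x d / sqrt (real d) * (2 * (sqrt (real (K d)) - real N / sqrt (real d))) + 2 * real N * (x d / real d)"
          by (simp add: algebra_simps)
      qed
      then show ?thesis using 1 2 by linarith
    qed
    have "(\<Sum>d=1..N. x d / sqrt (real d) * sqrt_sum (K d)) =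
       (\<Sum>d=1..N. x d / sqrt (real d) * h d) + (\<Sum>d=1..N. x d / sqrt (real d) * (2 * sqrt (real (K d))))"
      unfolding sum.distrib[symmetric] h_def by (intro sum.cong refl) (simp add: algebra_simps)
    then show ?thesis using eq a b p2 by linarith
  qed
  have lower: "ln (real N + 1) \<le> (\<Sum>n=1..N\<^sup>2. r n / sqrt (real n))" if N: "N \<ge> 1" for N :: nat
  proof -
    have rnn: "r n \<ge> 0" "r (n\<^sup>2) \<ge> 1" if "n > 0" for n
      unfolding r_def by (rule divisor_sum_nonneg[OF mult one sign that])+
    have "ln (real N + 1) \<le> (\<Sum>s=1..N. 1 / real s)" by (rule harmonic_ge)
    also have "\<dots> \<le> (\<Sum>s=1..N. r (s\<^sup>2) / sqrt (real (s\<^sup>2)))"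
      using rnn by (intro sum_mono) (auto simp: divide_right_mono)
    also have "\<dots> = (\<Sum>n\<in>(\<lambda>s. s\<^sup>2) ` {1..N}. r n / sqrt (real n))"
      by (subst sum.reindex) (auto simp: inj_on_def)
    also have "\<dots> \<le> (\<Sum>n=1..N\<^sup>2. r n / sqrt (real n))"
      using rnn by (intro sum_mono2) (auto simp: power_mono Suc_le_eq)
    finally show ?thesis .
  qed
  \<comment> \<open>Makes the lower bound ln (N + 1) at least 20l + 3, above the upper bound 20l +
    2.\<close>
  define N where "N = nat \<lceil>exp (20 * real l + 3)\<rceil>"
  have "exp (20 * real l + 3) \<le> real N + 1" unfolding N_def by linarith
  then have "20 * real l + 3 \<le> ln (real N + 1)" by (simp add: ln_ge_iff)
  moreover have "N \<ge> 1" unfolding N_def using exp_gt_zero[of "20 * real l + 3"] by (simp add: Suc_le_eq)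
  ultimately show False using lower[of N] upper[of N] by linarith
qed

section \<open>Primes in progressions and the main theorem\<close>

text \<open>Mertens' theorem minus the n sharing a factor with l: nonprime n account for at most 2,
  and the primes among them divide l, a fixed finite set. In total 8 + 2 + K.\<close>

lemma Mpart_chi0:
  assumes l: "l \<ge> 2" shows "\<exists>C. \<forall>N\<ge>1. norm (Mpart (chi0 l) N - of_real (ln (real N))) \<le> C"
proof -
  define K where "K = (\<Sum>p\<in>prime_factors l. ln (real p) / real p)"
  have "norm (Mpart (chi0 l) N - of_real (ln (real N))) \<le> 10 + K" if N: "N \<ge> 1" for N
  proof -
    define R where "R = (\<Sum>n | n \<in> {1..N} \<and> \<not> coprime n l. \<Lambda> n / real n)"
    have "Mpart (chi0 l) N = of_real (\<Sum>n=1..N. if coprime n l then \<Lambda> n / real n else 0)"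
      unfolding Mpart_def of_real_sum by (intro sum.cong refl) (simp add: chi0_def)
    also have "(\<Sum>n=1..N. if coprime n l then \<Lambda> n / real n else 0) = (\<Sum>n=1..N. \<Lambda> n / real n - (if \<not> coprime n l then \<Lambda> n / real n else 0))"
      by (intro sum.cong) auto
    also have "\<dots> = (\<Sum>n=1..N. \<Lambda> n / real n) - R"
      unfolding R_def by (simp only: sum_subtractf sum.inter_filter[symmetric] finite_atLeastAtMost)
    finally have eq: "Mpart (chi0 l) N - of_real (ln (real N)) = of_real ((\<Sum>n=1..N. \<Lambda> n / real n) - R - ln (real N))"
      by (simp only: of_real_diff)
    have nn: "0 \<le> \<Lambda> n / real n" for n by (simp add: mangoldt_nonneg)
    have "0 \<le> R" unfolding R_def by (intro sum_nonneg nn)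
    moreover have "R \<le> 2 + K"
    proof -
      have "R \<le> (\<Sum>n\<in>{n. n \<in> {1..N} \<and> \<not> prime n} \<union> prime_factors l. \<Lambda> n / real n)"
        unfolding R_def
      proof (rule sum_mono2)
        show "{n. n \<in> {1..N} \<and> \<not> coprime n l} \<subseteq> {n. n \<in> {1..N} \<and> \<not> prime n} \<union> prime_factors l"
          using l by (auto simp: prime_factors_dvd dest: prime_imp_coprime)
      qed (use nn in auto)
      also have "\<dots> \<le> (\<Sum>n | n \<in> {1..N} \<and> \<not> prime n. \<Lambda> n / real n) + (\<Sum>n\<in>prime_factors l. \<Lambda> n / real n)"
        using nn by (subst sum.union_inter[symmetric]) (auto intro!: sum_nonneg)
      also have "(\<Sum>n\<in>prime_factors l. \<Lambda> n / real n) = K"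
        unfolding K_def by (intro sum.cong refl) (simp add: in_prime_factors_imp_prime)
      finally show ?thesis using sum_nonprime_mangoldt[of N] by linarith
    qed
    ultimately show ?thesis using mertens_mangoldt[OF N] unfolding eq norm_of_real by linarith
  qed
  then show ?thesis by blast
qed

text \<open>
  The sum of \<open>Mpart \<eta> N\<close> over all characters is nonnegative, while the principal character
  contributes \<open>ln N\<close> and each character with \<open>L(1, \<eta>) = 0\<close> contributes \<open>- ln N\<close>.  Hence at most one
  character has a zero, and it equals its conjugate.
\<close>

lemma Lval_nonzero:
  assumes l: "l \<ge> 2" and xi: "\<xi> \<in> dchars l" "\<xi> \<noteq> chi0 l" shows "Lval \<xi> \<noteq> 0"
proof
  assume zero: "Lval \<xi> = 0"
  define Z where "Z = {\<eta> \<in> dchars l. \<eta> \<noteq> chi0 l \<and> Lval \<eta> = 0}"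
  \<comment> \<open>The coefficient of ln N in \<open>Mpart \<eta> N\<close>.\<close>
  define e where "e = (\<lambda>\<eta>. if \<eta> = chi0 l then 1 else if \<eta> \<in> Z then -1 else (0::real))"
  have fin: "finite (dchars l)" by (rule finite_dchars[OF l])
  have "\<exists>C. \<forall>N\<ge>1. norm (Mpart \<eta> N - of_real (e \<eta> * ln (real N))) \<le> C" if "\<eta> \<in> dchars l" for \<eta>
    using Mpart_chi0[OF l] Mpart_bounded[OF l that] Mpart_zero[OF l that] that
    by (auto simp: e_def Z_def)
  then obtain C where C: "\<And>\<eta> N. \<eta> \<in> dchars l \<Longrightarrow> N \<ge> 1 \<Longrightarrow> norm (Mpart \<eta> N - of_real (e \<eta> * ln (real N))) \<le> C \<eta>"
    by metis
  define T where "T = (\<Sum>\<eta>\<in>dchars l. C \<eta>)"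
  have "card Z \<le> 1"
  proof (rule ccontr)
    assume "\<not> card Z \<le> 1"
    then have cZ: "real (card Z) \<ge> 2" by simp
    have "(\<Sum>\<eta>\<in>dchars l. e \<eta>) = (\<Sum>\<eta>\<in>insert (chi0 l) Z. e \<eta>)"
      using fin chi0[OF l] by (intro sum.mono_neutral_right) (auto simp: e_def Z_def)
    also have "\<dots> = 1 + (\<Sum>\<eta>\<in>Z. e \<eta>)"
      using fin by (subst sum.insert) (auto simp: e_def Z_def)
    also have "(\<Sum>\<eta>\<in>Z. e \<eta>) = (\<Sum>\<eta>\<in>Z. -1)" by (intro sum.cong) (auto simp: e_def Z_def)
    \<comment> \<open>The coefficients sum to 1 - card Z, which is at most -1 if there are two
      zeros.\<close>
    finally have se: "(\<Sum>\<eta>\<in>dchars l. e \<eta>) \<le> -1" using cZ by simp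
    have lnT: "ln (real N) \<le> T" if N: "N \<ge> 1" for N
    proof -
      \<comment> \<open>The factor \<open>\<eta> 1\<close>, equal to 1, is inserted to match
        \<open>sum_dchars\<close> with j = j' = 1; orthogonality then leaves a nonnegative sum over
        n congruent to 1.\<close>
      have "(\<Sum>\<eta>\<in>dchars l. Mpart \<eta> N) = (\<Sum>n=1..N. \<Sum>\<eta>\<in>dchars l. \<eta> 1 * \<eta> n * of_real (\<Lambda> n / real n))"
        unfolding Mpart_def by (subst sum.swap) (intro sum.cong refl, simp add: dchar_1[OF l, simplified])
      also have "\<dots> = (\<Sum>n=1..N. of_real (if [n = 1] (mod l) then real (totient l) * (\<Lambda> n / real n) else 0))"
      proof (rule sum.cong[OF refl])
        fix n
        have "(\<Sum>\<eta>\<in>dchars l. \<eta> 1 * \<eta> n) = (if [n = 1] (mod l) then of_nat (totient l) else 0)"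
          by (rule sum_dchars[OF l]) simp
        then show "(\<Sum>\<eta>\<in>dchars l. \<eta> 1 * \<eta> n * of_real (\<Lambda> n / real n)) =
           of_real (if [n = 1] (mod l) then real (totient l) * (\<Lambda> n / real n) else 0)"
          unfolding sum_distrib_right[symmetric] by simp
      qed
      finally have "Re (\<Sum>\<eta>\<in>dchars l. Mpart \<eta> N) = (\<Sum>n=1..N. if [n = 1] (mod l) then real (totient l) * (\<Lambda> n / real n) else 0)"
        by (simp only: of_real_sum[symmetric] Re_complex_of_real)
      also have "\<dots> \<ge> 0" by (intro sum_nonneg) (auto intro!: mult_nonneg_nonneg divide_nonneg_nonneg mangoldt_nonneg)
      finally have re: "0 \<le> Re (\<Sum>\<eta>\<in>dchars l. Mpart \<eta> N)" .
      have "norm ((\<Sum>\<eta>\<in>dchars l. Mpart \<eta> N) - of_real ((\<Sum>\<eta>\<in>dchars l. e \<eta>) * ln (real N))) =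
        norm (\<Sum>\<eta>\<in>dchars l. Mpart \<eta> N - of_real (e \<eta> * ln (real N)))"
        by (simp add: sum_subtractf sum_distrib_right)
      also have "\<dots> \<le> T" unfolding T_def by (rule norm_sum[THEN order_trans], rule sum_mono) (rule C[OF _ N])
      finally have "norm ((\<Sum>\<eta>\<in>dchars l. Mpart \<eta> N) - of_real ((\<Sum>\<eta>\<in>dchars l. e \<eta>) * ln (real N))) \<le> T" .
      then have "Re ((\<Sum>\<eta>\<in>dchars l. Mpart \<eta> N) - of_real ((\<Sum>\<eta>\<in>dchars l. e \<eta>) * ln (real N))) \<le> T"
        using complex_Re_le_cmod order_trans by blast
      then have "Re (\<Sum>\<eta>\<in>dchars l. Mpart \<eta> N) - (\<Sum>\<eta>\<in>dchars l. e \<eta>) * ln (real N) \<le> T" by (simp only: minus_complex.simps Re_complex_of_real)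
      moreover have "(\<Sum>\<eta>\<in>dchars l. e \<eta>) * ln (real N) \<le> -1 * ln (real N)" using N by (intro mult_right_mono se) auto
      ultimately show ?thesis using re by linarith
    qed
    define M where "M = nat \<lceil>exp (T + 1)\<rceil>"
    have M1: "M \<ge> 1" using exp_gt_zero[of "T + 1"] by (simp add: M_def Suc_le_eq)
    have "exp (T + 1) \<le> real M" unfolding M_def by linarith
    then have "ln (exp (T + 1)) \<le> ln (real M)" by (intro ln_mono) auto
    also have "\<dots> \<le> T" by (rule lnT[OF M1])
    finally show False by simp
  qed
  moreover have Z: "\<xi> \<in> Z" using xi zero by (simp add: Z_def)
  moreover have "(\<lambda>n. cnj (\<xi> n)) \<in> Z"
  proof -
    have "(\<lambda>n. cnj (\<xi> n)) \<noteq> chi0 l"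
    proof
      assume *: "(\<lambda>n. cnj (\<xi> n)) = chi0 l"
      have "\<xi> n = chi0 l n" for n
      proof -
        have "\<xi> n = cnj (cnj (\<xi> n))" by simp
        also have "cnj (\<xi> n) = chi0 l n" using * by (rule fun_cong)
        also have "cnj (chi0 l n) = chi0 l n" by (simp add: chi0_def)
        finally show ?thesis .
      qed
      then show False using xi(2) by blast
    qed
    then show ?thesis using dchar_cnj[OF l xi(1)] Lval_cnj[OF l xi] zero by (simp add: Z_def)
  qed
  moreover have "finite Z" using fin by (simp add: Z_def)
  \<comment> \<open>Both \<xi> and its conjugate lie in the set Z of at most one element, so \<xi>
    is real.\<close>
  ultimately have "(\<lambda>n. cnj (\<xi> n)) = \<xi>" using card_le_Suc0_iff_eq[of Z] by simp
  then have "cnj (\<xi> n) = \<xi> n" for n by metis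
  then show False using real_dchar_nonvanishing[OF l xi] zero by blast
qed

text \<open>The sum of \<open>\<eta> j' * Mpart \<eta> N\<close> over the characters isolates the
  class of j, and by nonvanishing only the principal character has a ln N term. Passing from
  \<Lambda> to primes costs at most 2.\<close>

theorem mertens_progression:
  assumes l: "l \<ge> 2" and j: "coprime j l"
  shows "\<exists>C. \<forall>N\<ge>1. \<bar>(\<Sum>n=1..N. if [n = j] (mod l) then plog n else 0) - ln (real N) / real (totient l)\<bar> \<le> C"
proof -
  have fin: "finite (dchars l)" by (rule finite_dchars[OF l])
  have tot: "real (totient l) > 0" using l by simp
  obtain j' where j': "[j * j' = 1] (mod l)" using cong_solve_coprime_nat[OF j] by auto
  have cj': "coprime j' l" using j' cong_imp_coprime[OF cong_sym[OF j']] by simp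
  define e where "e = (\<lambda>\<eta>. if \<eta> = chi0 l then 1 else (0::real))"
  have "\<exists>C. \<forall>N\<ge>1. norm (Mpart \<eta> N - of_real (e \<eta> * ln (real N))) \<le> C" if "\<eta> \<in> dchars l" for \<eta>
    using Mpart_chi0[OF l] Mpart_bounded[OF l that] Lval_nonzero[OF l that] by (auto simp: e_def)
  then obtain C where C: "\<And>\<eta> N. \<eta> \<in> dchars l \<Longrightarrow> N \<ge> 1 \<Longrightarrow> norm (Mpart \<eta> N - of_real (e \<eta> * ln (real N))) \<le> C \<eta>"
    by metis
  define T where "T = (\<Sum>\<eta>\<in>dchars l. C \<eta>)"
  have main: "\<bar>(\<Sum>n=1..N. if [n = j] (mod l) then plog n else 0) - ln (real N) / real (totient l)\<bar> \<le> T / real (totient l) + 2"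
    if N: "N \<ge> 1" for N
  proof -
    define S where "S = (\<Sum>n=1..N. if [n = j] (mod l) then \<Lambda> n / real n else 0)"
    have "(\<Sum>\<eta>\<in>dchars l. \<eta> j' * Mpart \<eta> N) = (\<Sum>n=1..N. \<Sum>\<eta>\<in>dchars l. \<eta> j' * \<eta> n * of_real (\<Lambda> n / real n))"
      unfolding Mpart_def sum_distrib_left by (subst sum.swap) (simp add: mult_ac)
    also have "\<dots> = (\<Sum>n=1..N. of_real (real (totient l) * (if [n = j] (mod l) then \<Lambda> n / real n else 0)))"
    proof (rule sum.cong[OF refl])
      fix n
      have "(\<Sum>\<eta>\<in>dchars l. \<eta> j' * \<eta> n) = (if [n = j] (mod l) then of_nat (totient l) else 0)"
        by (rule sum_dchars[OF l j'])
      then show "(\<Sum>\<eta>\<in>dchars l. \<eta> j' * \<eta> n * of_real (\<Lambda> n / real n)) =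
         of_real (real (totient l) * (if [n = j] (mod l) then \<Lambda> n / real n else 0))"
        unfolding sum_distrib_right[symmetric] by simp
    qed
    finally have sum_eq: "(\<Sum>\<eta>\<in>dchars l. \<eta> j' * Mpart \<eta> N) = of_real (real (totient l) * S)"
      by (simp add: S_def sum_distrib_left)
    have "(\<Sum>\<eta>\<in>dchars l. \<eta> j' * of_real (e \<eta> * ln (real N))) = (\<Sum>\<eta>\<in>{chi0 l}. \<eta> j' * of_real (e \<eta> * ln (real N)))"
      using fin chi0[OF l] by (intro sum.mono_neutral_right) (auto simp: e_def)
    also have "\<dots> = of_real (ln (real N))" using cj' by (simp add: e_def chi0_def)
    finally have "of_real (real (totient l) * S - ln (real N)) = (\<Sum>\<eta>\<in>dchars l. \<eta> j' * (Mpart \<eta> N - of_real (e \<eta> * ln (real N))))"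
      using sum_eq by (simp add: right_diff_distrib sum_subtractf)
    also have "norm \<dots> \<le> T"
      unfolding T_def
    proof (rule norm_sum[THEN order_trans], rule sum_mono)
      fix \<eta> assume \<eta>: "\<eta> \<in> dchars l"
      have "norm (\<eta> j') * norm (Mpart \<eta> N - of_real (e \<eta> * ln (real N))) \<le> 1 * C \<eta>"
        using dchar_norm_le[OF l \<eta>, of j'] C[OF \<eta> N] by (intro mult_mono) auto
      then show "norm (\<eta> j' * (Mpart \<eta> N - of_real (e \<eta> * ln (real N)))) \<le> C \<eta>" by (simp add: norm_mult)
    qed
    finally have "\<bar>real (totient l) * S - ln (real N)\<bar> \<le> T" by (simp only: norm_of_real)
    then have "\<bar>real (totient l) * S - ln (real N)\<bar> / real (totient l) \<le> T / real (totient l)" by (intro divide_right_mono) auto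
    moreover have "\<bar>real (totient l) * S - ln (real N)\<bar> / real (totient l) = \<bar>S - ln (real N) / real (totient l)\<bar>"
    proof -
      have "S - ln (real N) / real (totient l) = (real (totient l) * S - ln (real N)) / real (totient l)"
        using tot by (simp add: diff_divide_distrib)
      then show ?thesis by simp
    qed
    ultimately have 1: "\<bar>S - ln (real N) / real (totient l)\<bar> \<le> T / real (totient l)" by simp
    have "S - (\<Sum>n=1..N. if [n = j] (mod l) then plog n else 0) = (\<Sum>n=1..N. if [n = j] (mod l) \<and> \<not> prime n then \<Lambda> n / real n else 0)"
      unfolding S_def sum_subtractf[symmetric] by (intro sum.cong refl) (auto simp: plog_def)
    moreover have "0 \<le> (\<Sum>n=1..N. if [n = j] (mod l) \<and> \<not> prime n then \<Lambda> n / real n else 0)"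
      by (intro sum_nonneg) (simp add: mangoldt_nonneg)
    moreover have "(\<Sum>n=1..N. if [n = j] (mod l) \<and> \<not> prime n then \<Lambda> n / real n else 0) \<le> (\<Sum>n=1..N. if \<not> prime n then \<Lambda> n / real n else 0)"
      by (intro sum_mono) (simp add: mangoldt_nonneg)
    moreover have "(\<Sum>n=1..N. if \<not> prime n then \<Lambda> n / real n else 0) \<le> 2"
      using sum_nonprime_mangoldt[of N] by (simp only: sum.inter_filter[symmetric] finite_atLeastAtMost)
    ultimately show ?thesis using 1 by linarith
  qed
  then show ?thesis by blast
qed

section \<open>From Mertens' theorem to residue counts\<close>

lemma residue_count_error:
  assumes k: "k \<ge> 1" and l: "l \<ge> 2" and j: "coprime j l"
  shows "\<exists>K. \<forall>x\<ge>2. \<bar>real (residue_count (kth_prime_factor k) l j x) - x / real (totient l)\<bar> \<le> K * (x * loglog x ^ k / ln x)"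
proof -
  define \<phi> where "\<phi> = real (totient l)"
  have \<phi>: "\<phi> \<ge> 1" using l by (simp add: \<phi>_def Suc_le_eq)
  \<comment> \<open>Summed over the reduced classes j this is 0 at every n coprime to l. The ln N
    terms of the two Mertens theorems cancel in its \<open>plog\<close> sums, which leaves C +
    10.\<close>
  define c where "c = (\<lambda>n. (if [n = j] (mod l) then 1 else 0) - 1 / \<phi>)"
  have c1: "\<bar>c n\<bar> \<le> 1" for n
  proof -
    have "0 \<le> 1 / \<phi>" "1 / \<phi> \<le> 1" using \<phi> by auto
    then show ?thesis unfolding c_def by (auto simp: abs_if)
  qed
  obtain C where C: "\<And>N. N \<ge> 1 \<Longrightarrow> \<bar>(\<Sum>n=1..N. if [n = j] (mod l) then plog n else 0) - ln (real N) / \<phi>\<bar> \<le> C"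
    using mertens_progression[OF l j] unfolding \<phi>_def by blast
  have cB: "\<bar>\<Sum>n=1..N. c n * plog n\<bar> \<le> C + 10" for N
  proof (cases "N \<ge> 1")
    case True
    have "(\<Sum>n=1..N. c n * plog n) = (\<Sum>n=1..N. if [n = j] (mod l) then plog n else 0) - 1 / \<phi> * (\<Sum>n=1..N. plog n)"
      unfolding sum_distrib_left sum_subtractf[symmetric] by (intro sum.cong) (auto simp: c_def algebra_simps)
    moreover have "\<bar>1 / \<phi> * ((\<Sum>n=1..N. plog n) - ln (real N))\<bar> \<le> 1 * 10"
      unfolding abs_mult using mertens_plog[OF True] \<phi> by (intro mult_mono) auto
    then have "\<bar>1 / \<phi> * (\<Sum>n=1..N. plog n) - ln (real N) / \<phi>\<bar> \<le> 10" by (simp add: right_diff_distrib)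
    ultimately show ?thesis using C[OF True] by linarith
  next
    case False
    \<comment> \<open>The sum is empty, and the case N = 1 shows C >= 0.\<close>
    then show ?thesis using C[of 1] by simp
  qed
  obtain K where K: "\<And>x. x \<ge> 2 \<Longrightarrow> \<bar>\<Sum>n=1..nat \<lfloor>x\<rfloor>. c (kth_prime_factor k n)\<bar> \<le> K * (x * loglog x ^ k / ln x)"
    using kth_prime_factor_cancellation[OF k c1 cB] by blast
  have "\<bar>real (residue_count (kth_prime_factor k) l j x) - x / \<phi>\<bar> \<le> (K + 1) * (x * loglog x ^ k / ln x)" if x: "x \<ge> 2" for x
  proof -
    define N where "N = nat \<lfloor>x\<rfloor>"
    have N: "real N \<le> x" "x < real N + 1" using x unfolding N_def by linarith+
    have "{n. 1 \<le> n \<and> real n \<le> x \<and> [kth_prime_factor k n = j] (mod l)} = {n \<in> {1..N}. [kth_prime_factor k n = j] (mod l)}"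
      using x by (auto simp: N_def le_nat_floor) linarith
    then have "real (residue_count (kth_prime_factor k) l j x) = (\<Sum>n=1..N. if [kth_prime_factor k n = j] (mod l) then 1 else 0)"
      unfolding residue_count_def by (simp add: sum.inter_filter[symmetric])
    moreover have "(\<Sum>n=1..N. c (kth_prime_factor k n)) = (\<Sum>n=1..N. if [kth_prime_factor k n = j] (mod l) then 1 else 0) - real N / \<phi>"
      by (simp add: c_def sum_subtractf)
    ultimately have eq: "real (residue_count (kth_prime_factor k) l j x) - x / \<phi> = (\<Sum>n=1..N. c (kth_prime_factor k n)) - (x - real N) / \<phi>"
      by (simp add: diff_divide_distrib)
    have "0 \<le> (x - real N) / \<phi>" "(x - real N) / \<phi> \<le> 1" using N \<phi> by (auto simp: divide_le_eq)
    \<comment> \<open>Absorbs the error of at most 1 made by replacing x with its integer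
      part.\<close>
    moreover have "1 \<le> x * loglog x ^ k / ln x"
    proof -
      have "ln x \<le> x * 1" using ln_le_minus_one[of x] x by simp
      also have "\<dots> \<le> x * loglog x ^ k" using x by (intro mult_left_mono one_le_power loglog_ge_1) auto
      finally show ?thesis using x by (simp add: le_divide_eq)
    qed
    moreover have "\<bar>\<Sum>n=1..N. c (kth_prime_factor k n)\<bar> \<le> K * (x * loglog x ^ k / ln x)" unfolding N_def by (rule K[OF x])
    moreover have "(K + 1) * (x * loglog x ^ k / ln x) = K * (x * loglog x ^ k / ln x) + x * loglog x ^ k / ln x"
      by (simp only: distrib_right mult_1)
    ultimately show ?thesis unfolding eq by linarith
  qed
  then show ?thesis unfolding \<phi>_def by blast
qed

lemma residue_count_bigo:
  assumes k: "k \<ge> 1" and l: "l \<ge> 2" and j: "coprime j l"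
  shows "(\<lambda>x::real. real (residue_count (kth_prime_factor k) l j x) - x / real (totient l))
              \<in> O[at_top](\<lambda>x. x * (ln (ln x)) ^ k / ln x)"
proof -
  obtain K where K: "\<And>x. x \<ge> 2 \<Longrightarrow>
      \<bar>real (residue_count (kth_prime_factor k) l j x) - x / real (totient l)\<bar> \<le> K * (x * loglog x ^ k / ln x)"
    using residue_count_error[OF assms] by blast
  have "(\<lambda>x::real. real (residue_count (kth_prime_factor k) l j x) - x / real (totient l)) \<in> O(\<lambda>x. x * loglog x ^ k / ln x)"
  proof (rule bigoI[of _ K])
    have "norm (real (residue_count (kth_prime_factor k) l j x) - x / real (totient l)) \<le> K * norm (x * loglog x ^ k / ln x)"
      if "x \<ge> 2" for x
    proof -
      have "0 \<le> x * loglog x ^ k / ln x" using that loglog_ge_1[of x] by (intro divide_nonneg_nonneg mult_nonneg_nonneg) auto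
      then have "norm (x * loglog x ^ k / ln x) = x * loglog x ^ k / ln x" by (simp only: real_norm_def abs_of_nonneg)
      then show ?thesis using K[OF that] by (simp only: real_norm_def)
    qed
    then show "\<forall>\<^sub>F x in at_top. norm (real (residue_count (kth_prime_factor k) l j x) - x / real (totient l)) \<le> K * norm (x * loglog x ^ k / ln x)"
      by (rule eventually_mono[OF eventually_ge_at_top[of 2]])
  qed
  also have "(\<lambda>x::real. x * loglog x ^ k / ln x) \<in> O(\<lambda>x. x * (ln (ln x)) ^ k / ln x)"
  proof -
    have "loglog \<in> O(\<lambda>x. ln (ln x))" unfolding loglog_def[abs_def] by real_asymp
    moreover have "\<forall>\<^sub>F x::real in at_top. ln x \<noteq> 0"
      by (rule eventually_mono[OF eventually_gt_at_top[of 1]]) simp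
    ultimately show ?thesis by (intro landau_o.big.mult landau_o.big_power landau_o.big.divide_right) auto
  qed
  finally show ?thesis .
qed

theorem theorem5p3:
  fixes k l :: nat
  assumes "k \<ge> 1" and "l \<ge> 2"
  shows "(\<forall>j. 1 \<le> j \<and> j \<le> l \<and> coprime j l \<longrightarrow>
            (\<lambda>x::real. real (residue_count (kth_prime_factor k) l j x) - x / real (totient l))
              \<in> O[at_top](\<lambda>x. x * (ln (ln x)) ^ k / ln x))
         \<and> unif_dist_reduced_residues (kth_prime_factor k) l"
proof (intro conjI allI impI)
  fix j assume "1 \<le> j \<and> j \<le> l \<and> coprime j l"
  then show "(\<lambda>x::real. real (residue_count (kth_prime_factor k) l j x) - x / real (totient l))
              \<in> O[at_top](\<lambda>x. x * (ln (ln x)) ^ k / ln x)"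
    using residue_count_bigo[OF assms] by blast
next
  show "unif_dist_reduced_residues (kth_prime_factor k) l"
    unfolding unif_dist_reduced_residues_def
  proof (intro allI impI)
    \<comment> \<open>Here j may lie outside 1..l, which \<open>residue_count_bigo\<close>
      covers.\<close>
    fix j assume j: "coprime j l"
    \<comment> \<open>Substituting y = ln ln x turns (ln ln x)^k / ln x into y^k / exp y.\<close>
    have "filterlim (\<lambda>x::real. ln (ln x)) at_top at_top" by real_asymp
    from filterlim_compose[OF tendsto_power_div_exp_0 this]
    have "((\<lambda>x::real. ln (ln x) ^ k / exp (ln (ln x))) \<longlongrightarrow> 0) at_top" .
    moreover have "\<forall>\<^sub>F x::real in at_top. ln (ln x) ^ k / exp (ln (ln x)) = x * ln (ln x) ^ k / ln x / x"
      using eventually_gt_at_top[of 1] by eventually_elim simp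
    ultimately have "((\<lambda>x::real. x * ln (ln x) ^ k / ln x / x) \<longlongrightarrow> 0) at_top"
      by (rule Lim_transform_eventually)
    then have "(\<lambda>x::real. x * ln (ln x) ^ k / ln x) \<in> o(\<lambda>x. x)"
      by (rule smalloI_tendsto) (auto intro: eventually_mono[OF eventually_gt_at_top[of 0]])
    with residue_count_bigo[OF assms j]
    have "(\<lambda>x::real. real (residue_count (kth_prime_factor k) l j x) - x / real (totient l)) \<in> o(\<lambda>x. x)"
      by (rule landau_o.big_small_trans)
    then have "((\<lambda>x::real. (real (residue_count (kth_prime_factor k) l j x) - x / real (totient l)) / x) \<longlongrightarrow> 0) at_top"
      by (rule smalloD_tendsto)
    from tendsto_add[OF filterlim_compose[OF this filterlim_real_sequentially] tendsto_const[of "1 / real (totient l)"]]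
    have "(\<lambda>N. (real (residue_count (kth_prime_factor k) l j (real N)) - real N / real (totient l)) / real N + 1 / real (totient l))
        \<longlonglongrightarrow> 1 / real (totient l)" by simp
    then show "(\<lambda>N. real (residue_count (kth_prime_factor k) l j (real N)) / real N) \<longlonglongrightarrow> 1 / real (totient l)"
    proof (rule Lim_transform_eventually)
      show "\<forall>\<^sub>F N in sequentially. (real (residue_count (kth_prime_factor k) l j (real N)) - real N / real (totient l)) / real N + 1 / real (totient l) =
          real (residue_count (kth_prime_factor k) l j (real N)) / real N"
        using eventually_gt_at_top[of 0] by eventually_elim (simp add: diff_divide_distrib)
    qed
  qed
qed

end
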